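(* Let $K$ be a field. Let $G$ be a finite bipartite graph on the vertex set $W\cup W'$, where $W=\{x_1,\dots,x_n\}$ and $W'=\{y_1,\dots,y_n\}$ are disjoint and every edge of $G$ joins a vertex of $W$ to a vertex of $W'$. Suppose that the edge set of $G$ satisfies: $\{x_i,y_i\}$ is an edge of $G$ for all $1\le i\le n$; and if $\{x_i,y_j\}$ is an edge of $G$, then $i\le j$. Then $G$ is a Cohen–Macaulay graph over $K$ if and only if the following condition is satisfied: if $\{x_i,y_j\}$ and $\{x_j,y_k\}$ are edges of $G$ with $i<j<k$, then $\{x_i,y_k\}$ is an edge of $G$.
   Context: Graphs are finite with no loops and no multiple edges. The edge ideal $I(G)$ of a graph $G$ is the ideal, in the polynomial ring over $K$ whose variables are the vertices of $G$, generated by the monomials $zz'$ such that $\{z,z'\}$ is an edge of $G$. $G$ is called Cohen–Macaulay over $K$ if the quotient of this polynomial ring by $I(G)$ is a Cohen–Macaulay ring. *)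

theory Defs
  imports
    "HOL-Algebra.QuotRing"
    "HOL-Algebra.Ring_Divisibility"
    "HOL-Algebra.Algebraic_Closure_Type"
    "HOL-Library.Poly_Mapping"
    "HOL-Library.Extended_Nat"
begin

section \<open>Cohen--Macaulay rings\<close>

text \<open>The supremum of the lengths \<open>k\<close> of chains of prime ideals
  \<open>P 0 \<subset> P 1 \<subset> \<dots> \<subset> P k\<close>.\<close>

definition krull_dim :: "('a, 'b) ring_scheme \<Rightarrow> enat" where
  "krull_dim R = Sup {enat k | k P. (\<forall>i\<le>k. primeideal (P i) R) \<and> (\<forall>i<k. P i \<subset> P (Suc i))}"

text \<open>\<open>xs ! i\<close> is a nonzerodivisor on \<open>R\<close> modulo the ideal generated by the preceding entries, and
  the quotient by all entries is nonzero.\<close>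

definition regular_sequence :: "('a, 'b) ring_scheme \<Rightarrow> 'a list \<Rightarrow> bool" where
  "regular_sequence R xs \<longleftrightarrow>
     set xs \<subseteq> carrier R \<and>
     (\<forall>i<length xs. \<forall>a\<in>carrier R.
        xs ! i \<otimes>\<^bsub>R\<^esub> a \<in> Idl\<^bsub>R\<^esub> (set (take i xs)) \<longrightarrow> a \<in> Idl\<^bsub>R\<^esub> (set (take i xs))) \<and>
     Idl\<^bsub>R\<^esub> (set xs) \<noteq> carrier R"

text \<open>For a Noetherian local ring with maximal ideal \<open>I\<close> this is its depth; in general it is
  the grade of \<open>I\<close>.\<close>

definition depth :: "'a set \<Rightarrow> ('a, 'b) ring_scheme \<Rightarrow> enat" where
  "depth I R = Sup {enat (length xs) | xs. regular_sequence R xs \<and> set xs \<subseteq> I}"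

definition local_ring :: "('a, 'b) ring_scheme \<Rightarrow> bool" where
  "local_ring R \<longleftrightarrow> cring R \<and> (\<exists>!M. maximalideal M R)"

definition cohen_macaulay_local_ring :: "('a, 'b) ring_scheme \<Rightarrow> bool" where
  "cohen_macaulay_local_ring R \<longleftrightarrow>
     noetherian_ring R \<and> local_ring R \<and> depth (THE M. maximalideal M R) R = krull_dim R"

text \<open>Elements of \<open>localization R S\<close> are equivalence classes of pairs \<open>(a, s)\<close>, standing for the
  fraction \<open>a / s\<close>.  The factor \<open>u\<close> is needed because \<open>R\<close> may have zero divisors.\<close>

definition frac_rel :: "('a, 'b) ring_scheme \<Rightarrow> 'a set \<Rightarrow> (('a \<times> 'a) \<times> ('a \<times> 'a)) set" where
  "frac_rel R S = {((a, s), (b, t)) | a s b t.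
     a \<in> carrier R \<and> s \<in> S \<and> b \<in> carrier R \<and> t \<in> S \<and>
     (\<exists>u\<in>S. u \<otimes>\<^bsub>R\<^esub> (t \<otimes>\<^bsub>R\<^esub> a) = u \<otimes>\<^bsub>R\<^esub> (s \<otimes>\<^bsub>R\<^esub> b))}"

definition localization :: "('a, 'b) ring_scheme \<Rightarrow> 'a set \<Rightarrow> ('a \<times> 'a) set ring" where
  "localization R S =
     \<lparr> carrier = (carrier R \<times> S) // frac_rel R S,
       monoid.mult = (\<lambda>A B. \<Union>(a, s)\<in>A. \<Union>(b, t)\<in>B.
                 frac_rel R S `` {(a \<otimes>\<^bsub>R\<^esub> b, s \<otimes>\<^bsub>R\<^esub> t)}),
       one = frac_rel R S `` {(\<one>\<^bsub>R\<^esub>, \<one>\<^bsub>R\<^esub>)},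
       zero = frac_rel R S `` {(\<zero>\<^bsub>R\<^esub>, \<one>\<^bsub>R\<^esub>)},
       add = (\<lambda>A B. \<Union>(a, s)\<in>A. \<Union>(b, t)\<in>B.
                 frac_rel R S `` {((t \<otimes>\<^bsub>R\<^esub> a) \<oplus>\<^bsub>R\<^esub> (s \<otimes>\<^bsub>R\<^esub> b), s \<otimes>\<^bsub>R\<^esub> t)}) \<rparr>"

definition cohen_macaulay_ring :: "('a, 'b) ring_scheme \<Rightarrow> bool" where
  "cohen_macaulay_ring R \<longleftrightarrow>
     cring R \<and> noetherian_ring R \<and>
     (\<forall>M. maximalideal M R \<longrightarrow> cohen_macaulay_local_ring (localization R (carrier R - M)))"


section \<open>Edge ideals\<close>

definition finite_simple_graph :: "'v set \<Rightarrow> 'v set set \<Rightarrow> bool" where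
  "finite_simple_graph V E \<longleftrightarrow> finite V \<and> (\<forall>e\<in>E. e \<subseteq> V \<and> card e = 2)"

text \<open>The polynomial ring over the field \<open>'k\<close> in the variables \<open>V\<close>: a polynomial is a finitely
  supported map from monomials \<open>'v \<Rightarrow>\<^sub>0 nat\<close> to coefficients, the ring operations are those of
  \<^typ>\<open>('v \<Rightarrow>\<^sub>0 nat) \<Rightarrow>\<^sub>0 'k\<close>, and only variables from \<open>V\<close> may occur.\<close>

definition polynomial_ring :: "'v set \<Rightarrow> (('v \<Rightarrow>\<^sub>0 nat) \<Rightarrow>\<^sub>0 'k::field) ring" where
  "polynomial_ring V =
     ring_of_type_algebra \<lparr> carrier := {p. \<forall>m\<in>Poly_Mapping.keys p. Poly_Mapping.keys m \<subseteq> V} \<rparr>"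

definition poly_var :: "'v \<Rightarrow> ('v \<Rightarrow>\<^sub>0 nat) \<Rightarrow>\<^sub>0 'k::field" where
  "poly_var v = Poly_Mapping.single (Poly_Mapping.single v 1) 1"

definition edge_ideal :: "'v set \<Rightarrow> 'v set set \<Rightarrow> (('v \<Rightarrow>\<^sub>0 nat) \<Rightarrow>\<^sub>0 'k::field) set" where
  "edge_ideal V E = Idl\<^bsub>polynomial_ring V\<^esub> {poly_var z * poly_var z' | z z'. {z, z'} \<in> E}"

text \<open>The argument of type \<^typ>\<open>'k itself\<close> only serves to name the coefficient field.\<close>

definition cohen_macaulay_graph :: "'k::field itself \<Rightarrow> 'v set \<Rightarrow> 'v set set \<Rightarrow> bool" where
  "cohen_macaulay_graph K V E \<longleftrightarrow>
     cohen_macaulay_ring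
       (polynomial_ring V Quot (edge_ideal V E :: (('v \<Rightarrow>\<^sub>0 nat) \<Rightarrow>\<^sub>0 'k) set))"

end

theory Submission
  imports Defs
begin

text \<open>Suppose that \<open>x\<^sub>i y\<^sub>j\<close> and \<open>x\<^sub>j y\<^sub>k\<close> are edges but \<open>x\<^sub>i y\<^sub>k\<close> is not.  A maximal independent set \<open>F\<close> that contains
  \<open>x\<^sub>i\<close> and \<open>y\<^sub>k\<close> misses the pair \<open>x\<^sub>j, y\<^sub>j\<close>, so it has fewer than \<open>n\<close> elements.  The variables outside \<open>F\<close>
  annihilate the product of those in \<open>F\<close>, hence lie in an associated prime; therefore the depth at
  the origin is at most \<open>card F\<close>, whereas the dimension there is at least \<open>n\<close>.

  Conversely, by Zariski's lemma every maximal ideal of the polynomial ring contains nonzero polynomials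
  \<open>p\<^sub>i(x\<^sub>i + y\<^sub>i)\<close>.  If the condition holds, these form a regular sequence on the quotient by the edge
  ideal: passing from \<open>J\<close> to \<open>J : y\<^sub>d\<close> and \<open>J + (y\<^sub>d)\<close> for the largest remaining index \<open>d\<close> reduces this to
  quotients in which exactly one variable of each pair vanishes.  The dimension is at most \<open>n\<close>, because a prime
  containing the edge ideal contains a vertex of every pair \<open>x\<^sub>i, y\<^sub>i\<close>.\<close>

section \<open>Depth, dimension and associated primes\<close>

text \<open>\<open>cohen_macaulay_ring\<close> tests every maximal ideal, and away from the origin
  the linear forms \<open>x_i + y_i\<close> need not lie in it. This is why the polynomials
  \<open>p_i\<close> enter; they exist because the residue field is algebraic over \<open>K\<close>.
  Transitivity acts at a single point: it keeps the set of killed variables closed when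
  \<open>J\<close> is replaced by \<open>J : y_d\<close>.

  Regular sequences are turned into prime chains in two ways. Descending from a prime that contains
  the sequence bounds the dimension from below. Climbing from an annihilator through associated
  primes of the successive quotients gives a chain as long as the sequence and entirely above the
  annihilator, which bounds the depth from above. Chains of primes containing given variables are
  bounded in turn by counting monomials: too many polynomials in the remaining variables satisfy an
  algebraic relation.

  Localizations of the quotient are described from the polynomial ring itself, through ideals that
  contain the edge ideal, so that the work on polynomials needs neither cosets nor
  fractions.\<close>

definition adjoin :: "('a, 'b) ring_scheme \<Rightarrow> 'a set \<Rightarrow> 'a \<Rightarrow> 'a set" where
  "adjoin R J f = {j \<oplus>\<^bsub>R\<^esub> g \<otimes>\<^bsub>R\<^esub> f | j g. j \<in> J \<and> g \<in> carrier R}"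

definition colon :: "('a, 'b) ring_scheme \<Rightarrow> 'a set \<Rightarrow> 'a \<Rightarrow> 'a set" where
  "colon R J w = {a \<in> carrier R. a \<otimes>\<^bsub>R\<^esub> w \<in> J}"

definition prime_chain :: "('a, 'b) ring_scheme \<Rightarrow> nat \<Rightarrow> (nat \<Rightarrow> 'a set) \<Rightarrow> bool" where
  "prime_chain R k P \<longleftrightarrow> (\<forall>i\<le>k. primeideal (P i) R) \<and> (\<forall>i<k. P i \<subset> P (Suc i))"

context cring
begin

lemma adjoin_ideal:
  assumes "ideal J R" "f \<in> carrier R"
  shows "ideal (adjoin R J f) R"
proof -
  have "adjoin R J f = J <+> PIdl f"
    by (auto simp: adjoin_def set_add_defs cgenideal_def)
  then show ?thesis using assms add_ideals cgenideal_ideal by simp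
qed

lemma adjoin_superset:
  assumes "ideal J R" "f \<in> carrier R"
  shows "J \<subseteq> adjoin R J f" "f \<in> adjoin R J f"
proof -
  interpret J: ideal J R by fact
  show "J \<subseteq> adjoin R J f"
  proof
    fix j assume "j \<in> J"
    moreover from this have "j = j \<oplus> \<zero> \<otimes> f" using assms J.Icarr by simp
    ultimately show "j \<in> adjoin R J f" unfolding adjoin_def by blast
  qed
  have "f = \<zero> \<oplus> \<one> \<otimes> f" using assms by simp
  then show "f \<in> adjoin R J f" unfolding adjoin_def using J.zero_closed by blast
qed

lemma adjoin_minimal:
  assumes "ideal I R" "J \<subseteq> I" "f \<in> I"
  shows "adjoin R J f \<subseteq> I"
proof -
  interpret I: ideal I R by fact
  show ?thesis using assms by (auto simp: adjoin_def I.I_l_closed subset_iff)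
qed

lemma Idl_insert:
  assumes "A \<subseteq> carrier R" "f \<in> carrier R"
  shows "Idl (insert f A) = adjoin R (Idl A) f"
proof
  have A: "ideal (Idl A) R" using assms by (simp add: genideal_ideal)
  show "Idl (insert f A) \<subseteq> adjoin R (Idl A) f"
    using adjoin_superset[OF A assms(2)] genideal_self[OF assms(1)]
    by (intro genideal_minimal adjoin_ideal A assms) auto
  show "adjoin R (Idl A) f \<subseteq> Idl (insert f A)"
    using assms genideal_self[of "insert f A"]
    by (intro adjoin_minimal genideal_ideal subset_Idl_subset) auto
qed

lemma colon_ideal:
  assumes "ideal J R" "w \<in> carrier R"
  shows "ideal (colon R J w) R"
proof -
  interpret J: ideal J R by fact
  show ?thesis
  proof (rule idealI[OF ring_axioms])
    show "subgroup (colon R J w) (add_monoid R)"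
    proof
      show "colon R J w \<subseteq> carrier (add_monoid R)" by (auto simp: colon_def)
      show "x \<otimes>\<^bsub>add_monoid R\<^esub> y \<in> colon R J w"
        if "x \<in> colon R J w" "y \<in> colon R J w" for x y
        using that assms by (auto simp: colon_def l_distr)
      show "\<one>\<^bsub>add_monoid R\<^esub> \<in> colon R J w" using assms by (auto simp: colon_def)
      show "inv\<^bsub>add_monoid R\<^esub> x \<in> colon R J w" if "x \<in> colon R J w" for x
        using that assms by (auto simp: colon_def a_inv_def[symmetric] l_minus)
    qed
  next
    fix a x assume a: "a \<in> colon R J w" and x: "x \<in> carrier R"
    then show "x \<otimes> a \<in> colon R J w"
      using assms by (auto simp: colon_def m_assoc J.I_l_closed)
    then show "a \<otimes> x \<in> colon R J w"
      using a x by (auto simp: colon_def m_comm)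
  qed
qed

text \<open>An ideal maximal among those that contain \<open>J\<close> and miss \<open>S\<close> is
  prime: if \<open>a\<close> and \<open>b\<close> lay outside it, adjoining either one would produce
  an element of \<open>S\<close>. The product of these two elements lies in \<open>S\<close> and,
  once \<open>a b\<close> is in the ideal, in the ideal as well.\<close>

lemma exists_prime_disjoint:
  assumes J: "ideal J R" and S: "S \<subseteq> carrier R" "\<one> \<in> S"
    and mult: "\<And>a b. a \<in> S \<Longrightarrow> b \<in> S \<Longrightarrow> a \<otimes> b \<in> S"
    and disj: "J \<inter> S = {}"
  shows "\<exists>P. primeideal P R \<and> J \<subseteq> P \<and> P \<inter> S = {}"
proof -
  define A where "A = {I. ideal I R \<and> J \<subseteq> I \<and> I \<inter> S = {}}"
  have "\<exists>M\<in>A. \<forall>Y\<in>A. M \<subseteq> Y \<longrightarrow> Y = M"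
  proof (rule subset_Zorn)
    fix C assume C: "subset.chain A C"
    show "\<exists>U\<in>A. \<forall>Y\<in>C. Y \<subseteq> U"
    proof (cases "C = {}")
      case True
      then show ?thesis using J disj by (auto simp: A_def)
    next
      case False
      have "subset.chain {I. ideal I R} C"
        using C by (auto simp: pred_on.chain_def A_def)
      then have "ideal (\<Union>C) R" using chain_Union_is_ideal[of C] False by simp
      then have "\<Union>C \<in> A" using C False by (auto simp: pred_on.chain_def A_def)
      then show ?thesis by blast
    qed
  qed
  then obtain M where M: "M \<in> A" and max: "\<And>Y. Y \<in> A \<Longrightarrow> M \<subseteq> Y \<Longrightarrow> Y = M" by blast
  then have Mi: "ideal M R" and JM: "J \<subseteq> M" and MS: "M \<inter> S = {}" by (auto simp: A_def)
  interpret M: ideal M R by fact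
  have meets: "\<exists>j g. j \<in> M \<and> g \<in> carrier R \<and> j \<oplus> g \<otimes> a \<in> S" if a: "a \<in> carrier R" "a \<notin> M" for a
  proof (rule ccontr)
    assume "\<not> ?thesis"
    then have "adjoin R M a \<in> A"
      using adjoin_ideal[OF Mi a(1)] adjoin_superset[OF Mi a(1)] JM by (auto simp: A_def adjoin_def)
    then show False using max adjoin_superset[OF Mi a(1)] a by blast
  qed
  have "primeideal M R"
  proof (rule primeidealI[OF Mi is_cring])
    show "carrier R \<noteq> M" using MS S by blast
  next
    fix a b assume ab: "a \<in> carrier R" "b \<in> carrier R" "a \<otimes> b \<in> M"
    show "a \<in> M \<or> b \<in> M"
    proof (rule ccontr)
      assume "\<not> ?thesis"
      then obtain j g j' g' where *: "j \<in> M" "g \<in> carrier R" "j \<oplus> g \<otimes> a \<in> S"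
        "j' \<in> M" "g' \<in> carrier R" "j' \<oplus> g' \<otimes> b \<in> S"
        using meets ab by metis
      have jc: "j \<in> carrier R" "j' \<in> carrier R" using * M.Icarr by auto
      have "(j \<oplus> g \<otimes> a) \<otimes> (j' \<oplus> g' \<otimes> b) = (j' \<oplus> g' \<otimes> b) \<otimes> j \<oplus> (g \<otimes> a) \<otimes> j' \<oplus> (g \<otimes> g') \<otimes> (a \<otimes> b)"
        using * ab jc by algebra
      also have "\<dots> \<in> M"
        using * ab jc M.I_l_closed[OF ab(3), of "g \<otimes> g'"]
          M.I_l_closed[OF *(1), of "j' \<oplus> g' \<otimes> b"] M.I_l_closed[OF *(4), of "g \<otimes> a"] by simp
      finally show False using mult[OF *(3,6)] MS by blast
    qed
  qed
  then show ?thesis using JM MS by blast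
qed

lemma exists_prime_above:
  assumes "ideal J R" "J \<noteq> carrier R"
  shows "\<exists>P. primeideal P R \<and> J \<subseteq> P"
proof -
  have "J \<inter> {\<one>} = {}" using ideal.one_imp_carrier assms by blast
  then show ?thesis using exists_prime_disjoint[OF assms(1), of "{\<one>}"] by auto
qed

text \<open>A prime containing \<open>J\<close> and avoiding the products \<open>s \<otimes> f\<^sup>k\<close> with \<open>s \<notin> P\<close>.\<close>

lemma smaller_prime:
  assumes J: "ideal J R" and P: "primeideal P R" "J \<subseteq> P" and f: "f \<in> P"
    and nzd: "\<And>a. a \<in> carrier R \<Longrightarrow> f \<otimes> a \<in> J \<Longrightarrow> a \<in> J"
  shows "\<exists>Q. primeideal Q R \<and> J \<subseteq> Q \<and> Q \<subset> P"
proof -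
  interpret P: primeideal P R by fact
  have fc: "f \<in> carrier R" using f P.Icarr by blast
  define S where "S = {s \<otimes> f [^] k | s k. s \<in> carrier R - P \<and> k \<in> (UNIV :: nat set)}"
  have one: "\<one> \<in> carrier R - P" using P.I_notcarr P.one_imp_carrier by blast
  have sS: "s \<in> S" if "s \<in> carrier R - P" for s
  proof -
    have "s = s \<otimes> f [^] (0::nat)" using that by simp
    then show ?thesis using that unfolding S_def by blast
  qed
  have fS: "f \<in> S"
  proof -
    have "f = \<one> \<otimes> f [^] (1::nat)" using fc by simp
    then show ?thesis using one unfolding S_def by blast
  qed
  \<comment> \<open>Powers of the nonzerodivisor \<open>f\<close> cancel modulo \<open>J\<close>. An
    element of \<open>J\<close> in \<open>S\<close> would therefore put its factor \<open>s\<close>,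
    which is outside \<open>P\<close>, into \<open>J\<close>, a subset of \<open>P\<close>.\<close>
  have cancel: "s \<in> J" if "s \<in> carrier R" "s \<otimes> f [^] k \<in> J" for s and k :: nat
    using that(2)
  proof (induction k)
    case (Suc k)
    have "s \<otimes> f [^] Suc k = f \<otimes> (s \<otimes> f [^] k)"
      using that(1) fc m_comm[of "s \<otimes> f [^] k" f] by (simp add: m_assoc)
    then have "s \<otimes> f [^] k \<in> J" using nzd[of "s \<otimes> f [^] k"] Suc.prems that(1) fc by simp
    then show ?case using Suc.IH by blast
  qed (use that in simp)
  have "\<exists>Q. primeideal Q R \<and> J \<subseteq> Q \<and> Q \<inter> S = {}"
  proof (rule exists_prime_disjoint[OF J])
    show "S \<subseteq> carrier R" using fc by (auto simp: S_def)
    show "\<one> \<in> S" using sS one by blast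
    show "J \<inter> S = {}" using cancel P(2) by (auto simp: S_def)
    fix a b assume "a \<in> S" "b \<in> S"
    then obtain s k t l where st: "a = s \<otimes> f [^] (k::nat)" "b = t \<otimes> f [^] (l::nat)"
      "s \<in> carrier R - P" "t \<in> carrier R - P" unfolding S_def by blast
    have "a \<otimes> b = (s \<otimes> t) \<otimes> f [^] (k + l)"
    proof -
      have "f [^] (k + l) = f [^] k \<otimes> f [^] l" using fc by (simp add: nat_pow_mult)
      moreover have "s \<otimes> p \<otimes> (t \<otimes> q) = s \<otimes> t \<otimes> (p \<otimes> q)" if "p \<in> carrier R" "q \<in> carrier R" for p q
        using that st by (simp add: m_ac)
      ultimately show ?thesis using st(1,2) fc by simp
    qed
    moreover have "s \<otimes> t \<in> carrier R - P" using st P.I_prime by blast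
    ultimately show "a \<otimes> b \<in> S" unfolding S_def by blast
  qed
  then obtain Q where Q: "primeideal Q R" "J \<subseteq> Q" "Q \<inter> S = {}" by blast
  interpret Q: primeideal Q R by fact
  \<comment> \<open>\<open>S\<close> contains the complement of \<open>P\<close>, so
    \<open>Q\<close> is inside \<open>P\<close>; it also contains \<open>f\<close>, so the inclusion
    is strict.\<close>
  have "Q \<subseteq> P" using Q(3) sS Q.Icarr by blast
  moreover have "f \<notin> Q" using Q fS by blast
  ultimately show ?thesis using Q f by blast
qed

text \<open>The chain is built downwards. A prime over \<open>J (Suc i)\<close> contains
  \<open>f i\<close>, a nonzerodivisor modulo \<open>J i\<close>, so \<open>smaller_prime\<close>
  gives a strictly smaller prime that still contains \<open>J i\<close>.\<close>

lemma regular_sequence_prime_chain: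
  assumes "\<And>i. i \<le> r \<Longrightarrow> ideal (J i) R"
    and "\<And>i. i < r \<Longrightarrow> J i \<subseteq> J (Suc i) \<and> f i \<in> J (Suc i)"
    and "\<And>i a. i < r \<Longrightarrow> a \<in> carrier R \<Longrightarrow> f i \<otimes> a \<in> J i \<Longrightarrow> a \<in> J i"
    and "primeideal P R" "J r \<subseteq> P"
  shows "\<exists>Q. prime_chain R r Q \<and> Q r = P"
  using assms
proof (induction r arbitrary: P)
  case 0
  then show ?case by (intro exI[of _ "\<lambda>_. P"]) (auto simp: prime_chain_def)
next
  case (Suc r)
  have "\<exists>P'. primeideal P' R \<and> J r \<subseteq> P' \<and> P' \<subset> P"
    using Suc.prems(1)[of r] Suc.prems(2,3)[of r] Suc.prems(4,5)
    by (intro smaller_prime[where f = "f r"]) auto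
  then obtain P' where P': "primeideal P' R" "J r \<subseteq> P'" "P' \<subset> P" by blast
  have "\<exists>Q. prime_chain R r Q \<and> Q r = P'"
    using Suc.prems P' by (intro Suc.IH) auto
  then obtain Q where Q: "prime_chain R r Q" "Q r = P'" by blast
  define Q' where "Q' = Q(Suc r := P)"
  have "prime_chain R (Suc r) Q'"
    using Q P' Suc.prems(4) by (auto simp: Q'_def prime_chain_def less_Suc_eq le_Suc_eq)
  moreover have "Q' (Suc r) = P" by (simp add: Q'_def)
  ultimately show ?case by blast
qed

end

section \<open>Regular sequences and the Krull dimension\<close>

lemma enat_le_krull_dim: "prime_chain R k P \<Longrightarrow> enat k \<le> krull_dim R"
  unfolding krull_dim_def prime_chain_def by (intro Sup_upper) blast

lemma krull_dim_leI:
  assumes "\<And>k P. prime_chain R k P \<Longrightarrow> k \<le> n"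
  shows "krull_dim R \<le> enat n"
  unfolding krull_dim_def using assms by (intro Sup_least) (auto simp: prime_chain_def)

lemma (in cring) Idl_take_Suc:
  assumes "set xs \<subseteq> carrier R" "i < length xs"
  shows "Idl (set (take (Suc i) xs)) = adjoin R (Idl (set (take i xs))) (xs ! i)"
proof -
  have "set (take (Suc i) xs) = insert (xs ! i) (set (take i xs))"
    using assms by (simp add: take_Suc_conv_app_nth)
  then show ?thesis using assms set_take_subset[of i xs] nth_mem[of i xs] by (subst Idl_insert[symmetric]) auto
qed

text \<open>The first \<open>m\<close> entries only generate the ideal modulo which the others are
  regular. With \<open>m = 0\<close> this bounds the depth; for the graph the prefix consists of the
  variables \<open>x_i\<close> and the rest of the \<open>y_i\<close>.\<close>

lemma (in cring) length_le_krull_dim: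
  assumes "set xs \<subseteq> carrier R" "Idl (set xs) \<noteq> carrier R" "m \<le> length xs"
    and nzd: "\<And>i a. m \<le> i \<Longrightarrow> i < length xs \<Longrightarrow> a \<in> carrier R \<Longrightarrow>
       xs ! i \<otimes> a \<in> Idl (set (take i xs)) \<Longrightarrow> a \<in> Idl (set (take i xs))"
  shows "enat (length xs - m) \<le> krull_dim R"
proof -
  define J where "J i = Idl (set (take (m + i) xs))" for i
  define f where "f i = xs ! (m + i)" for i
  obtain P where P: "primeideal P R" "Idl (set xs) \<subseteq> P"
    using exists_prime_above genideal_ideal assms by blast
  have J: "ideal (J i) R" for i unfolding J_def
    using assms(1) set_take_subset[of "m + i" xs] by (intro genideal_ideal) auto
  have "\<exists>Q. prime_chain R (length xs - m) Q \<and> Q (length xs - m) = P"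
  proof (rule regular_sequence_prime_chain[where J = J and f = f])
    fix i assume i: "i < length xs - m"
    then have "J (Suc i) = adjoin R (J i) (f i)"
      unfolding J_def f_def using Idl_take_Suc[of xs "m + i"] assms(1) by simp
    moreover have "f i \<in> carrier R" unfolding f_def using i assms(1) nth_mem[of "m + i" xs] by auto
    ultimately show "J i \<subseteq> J (Suc i) \<and> f i \<in> J (Suc i)"
      using adjoin_superset[OF J, of "f i"] by auto
    show "a \<in> J i" if "a \<in> carrier R" "f i \<otimes> a \<in> J i" for a
      using nzd[of "m + i" a] i that by (auto simp: J_def f_def)
  next
    show "J (length xs - m) \<subseteq> P" using P(2) assms(3) by (simp add: J_def)
  qed (simp_all add: J P(1))
  then obtain Q where "prime_chain R (length xs - m) Q" by blast
  then show ?thesis by (rule enat_le_krull_dim)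
qed

lemma (in cring) depth_le_krull_dim: "depth I R \<le> krull_dim R"
  unfolding depth_def
proof (rule Sup_least, clarify)
  fix xs assume "regular_sequence R xs" "set xs \<subseteq> I"
  then have "set xs \<subseteq> carrier R" "Idl (set xs) \<noteq> carrier R"
    "\<And>i a. i < length xs \<Longrightarrow> a \<in> carrier R \<Longrightarrow> xs ! i \<otimes> a \<in> Idl (set (take i xs)) \<Longrightarrow>
       a \<in> Idl (set (take i xs))"
    unfolding regular_sequence_def by blast+
  then show "enat (length xs) \<le> krull_dim R"
    using length_le_krull_dim[of xs 0] by simp
qed

section \<open>Associated primes in Noetherian rings\<close>

locale noetherian_cring = cring + noetherian_ring
begin

lemma exists_maximal_ideal_in:
  assumes "F \<noteq> {}" "\<And>I. I \<in> F \<Longrightarrow> ideal I R"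
  shows "\<exists>M\<in>F. \<forall>Y\<in>F. M \<subseteq> Y \<longrightarrow> Y = M"
proof (rule subset_Zorn)
  fix C assume C: "subset.chain F C"
  show "\<exists>U\<in>F. \<forall>Y\<in>C. Y \<subseteq> U"
  proof (cases "C = {}")
    case True
    then show ?thesis using assms by auto
  next
    case False
    have "subset.chain {I. ideal I R} C" using C assms by (auto simp: pred_on.chain_def)
    then have "\<Union>C \<in> C" using ideal_chain_is_trivial False by blast
    then show ?thesis using C by (auto simp: pred_on.chain_def)
  qed
qed

text \<open>A maximal member \<open>(J : v)\<close> of the family of annihilators containing
  \<open>A\<close> is prime. If \<open>a b\<close> lies in it and \<open>b v\<close> is not in
  \<open>J\<close>, then \<open>(J : b v)\<close> is a member of the family that contains
  \<open>(J : v)\<close>, hence equals it, and it contains \<open>a\<close>.\<close>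

lemma exists_associated_prime:
  assumes J: "ideal J R" and w: "w \<in> carrier R" "w \<notin> J" and A: "A \<subseteq> colon R J w"
  shows "\<exists>v\<in>carrier R - J. primeideal (colon R J v) R \<and> A \<subseteq> colon R J v"
proof -
  interpret J: ideal J R by fact
  define F where "F = {colon R J v | v. v \<in> carrier R - J \<and> A \<subseteq> colon R J v}"
  have "\<exists>M\<in>F. \<forall>Y\<in>F. M \<subseteq> Y \<longrightarrow> Y = M"
    using assms colon_ideal[OF J] by (intro exists_maximal_ideal_in) (auto simp: F_def)
  then obtain v where v: "v \<in> carrier R - J" "A \<subseteq> colon R J v"
    and max: "\<And>Y. Y \<in> F \<Longrightarrow> colon R J v \<subseteq> Y \<Longrightarrow> Y = colon R J v" by (auto simp: F_def)
  have "primeideal (colon R J v) R"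
  proof (rule primeidealI[OF colon_ideal[OF J] is_cring])
    show "carrier R \<noteq> colon R J v"
    proof
      assume "carrier R = colon R J v"
      then have "\<one> \<otimes> v \<in> J" using one_closed unfolding colon_def by blast
      then show False using v by simp
    qed
  next
    fix a b assume ab: "a \<in> carrier R" "b \<in> carrier R" "a \<otimes> b \<in> colon R J v"
    show "a \<in> colon R J v \<or> b \<in> colon R J v"
    proof (rule ccontr)
      assume n: "\<not> ?thesis"
      then have bv: "b \<otimes> v \<in> carrier R - J" using ab v by (auto simp: colon_def)
      have sub: "colon R J v \<subseteq> colon R J (b \<otimes> v)"
      proof
        fix c assume "c \<in> colon R J v"
        then have c: "c \<in> carrier R" "c \<otimes> v \<in> J" by (auto simp: colon_def)
        have "c \<otimes> (b \<otimes> v) = b \<otimes> (c \<otimes> v)" using c ab v by (simp add: m_ac)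
        then show "c \<in> colon R J (b \<otimes> v)" using c ab J.I_l_closed by (auto simp: colon_def)
      qed
      then have "colon R J (b \<otimes> v) = colon R J v"
        using bv v by (intro max) (auto simp: F_def)
      moreover have "a \<in> colon R J (b \<otimes> v)" using ab v by (auto simp: colon_def m_assoc)
      ultimately show False using n by blast
    qed
  qed (use v in auto)
  then show ?thesis using v by blast
qed

text \<open>Dividing \<open>w\<close> by \<open>f\<close> modulo \<open>J\<close> does not shrink \<open>(J : w)\<close>; since \<open>f\<close> lies in the Jacobson
  radical, one cannot divide forever.\<close>

lemma exists_not_in_adjoin:
  assumes J: "ideal J R" and w: "w \<in> carrier R" "w \<notin> J" and f: "f \<in> carrier R"
    and nzd: "\<And>a. a \<in> carrier R \<Longrightarrow> f \<otimes> a \<in> J \<Longrightarrow> a \<in> J"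
    and jac: "\<And>a. a \<in> carrier R \<Longrightarrow> \<one> \<ominus> a \<otimes> f \<in> Units R"
  shows "\<exists>v\<in>carrier R. v \<notin> adjoin R J f \<and> colon R J w \<subseteq> colon R J v"
proof (rule ccontr)
  assume neg: "\<not> ?thesis"
  interpret J: ideal J R by fact
  \<comment> \<open>If every candidate were divisible by \<open>f\<close> modulo \<open>J\<close>,
    take one for which \<open>J + (v)\<close> is maximal. Its quotient \<open>g\<close> by
    \<open>f\<close> is again a candidate and generates the same ideal together with
    \<open>J\<close>.\<close>
  define Z where "Z = {v \<in> carrier R - J. colon R J w \<subseteq> colon R J v}"
  have "\<exists>M\<in>adjoin R J ` Z. \<forall>Y\<in>adjoin R J ` Z. M \<subseteq> Y \<longrightarrow> Y = M"
    using w by (intro exists_maximal_ideal_in) (auto simp: Z_def adjoin_ideal[OF J])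
  then obtain v where v: "v \<in> Z"
    and max: "\<And>u. u \<in> Z \<Longrightarrow> adjoin R J v \<subseteq> adjoin R J u \<Longrightarrow> adjoin R J u = adjoin R J v" by auto
  have vc: "v \<in> carrier R" "v \<notin> J" using v by (auto simp: Z_def)
  have "v \<in> adjoin R J f" using neg v by (auto simp: Z_def)
  then obtain j g where jg: "v = j \<oplus> g \<otimes> f" "j \<in> J" "g \<in> carrier R" by (auto simp: adjoin_def)
  have jc: "j \<in> carrier R" using jg J.Icarr by blast
  have gZ: "g \<in> Z"
  proof -
    have "g \<notin> J"
      using jg vc f by (auto simp: J.I_r_closed)
    moreover have "colon R J w \<subseteq> colon R J g"
    proof
      fix q assume "q \<in> colon R J w"
      then have "q \<in> carrier R" "q \<otimes> v \<in> J" using v by (auto simp: Z_def colon_def)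
      moreover have "f \<otimes> (q \<otimes> g) = q \<otimes> v \<ominus> q \<otimes> j" if "q \<in> carrier R"
        using that jg(3) jc f unfolding jg(1) by algebra
      ultimately have "q \<in> carrier R" "f \<otimes> (q \<otimes> g) \<in> J"
        using jg(2) by (auto simp: a_minus_def J.I_l_closed)
      then show "q \<in> colon R J g" using nzd jg by (auto simp: colon_def)
    qed
    ultimately show ?thesis using jg by (auto simp: Z_def)
  qed
  have "v \<in> adjoin R J g"
    using jg f by (auto simp: adjoin_def m_comm)
  then have "adjoin R J v \<subseteq> adjoin R J g"
    using J jg by (intro adjoin_minimal adjoin_ideal adjoin_superset) auto
  then have "g \<in> adjoin R J v" using max[OF gZ] adjoin_superset(2)[OF J jg(3)] by blast
  then obtain i h where ih: "g = i \<oplus> h \<otimes> v" "i \<in> J" "h \<in> carrier R" by (auto simp: adjoin_def)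
  have ic: "i \<in> carrier R" using ih J.Icarr by blast
  \<comment> \<open>Substituting \<open>v = j + g f\<close> into \<open>g = i + h v\<close> gives
    \<open>(1 - h f) g = i + h j\<close>, an element of \<open>J\<close>, although
    \<open>1 - h f\<close> is a unit.\<close>
  define u where "u = \<one> \<ominus> h \<otimes> f"
  have u: "u \<in> Units R" "u \<in> carrier R" using jac[OF ih(3)] by (auto simp: u_def)
  have "u \<otimes> g = (g \<ominus> h \<otimes> v) \<oplus> h \<otimes> j"
    using ih(3) jc f jg(3) unfolding u_def jg(1) by algebra
  also have "g \<ominus> h \<otimes> v = i"
    by (subst ih(1)) (use ih(3) ic vc(1) in algebra)
  also have "i \<oplus> h \<otimes> j \<in> J" using ih(2,3) jg(2) by (simp add: J.I_l_closed)
  finally have "inv u \<otimes> (u \<otimes> g) \<in> J" using u J.I_l_closed by simp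
  moreover have "inv u \<otimes> (u \<otimes> g) = inv u \<otimes> u \<otimes> g"
    using u jg(3) by (simp only: m_assoc Units_inv_closed)
  ultimately have "g \<in> J" using u jg(3) by simp
  then show False using gZ by (auto simp: Z_def)
qed

text \<open>Let \<open>(J r : v)\<close> be the prime reached so far. By
  \<open>exists_not_in_adjoin\<close> some \<open>u\<close> outside \<open>J (Suc r)\<close> is
  annihilated modulo \<open>J r\<close> by this prime; modulo \<open>J (Suc r)\<close> it is
  annihilated by \<open>f r\<close> too. So a prime of the form \<open>(J (Suc r) : t)\<close>
  contains both the old prime and \<open>f r\<close>.\<close>

lemma annihilator_prime_chain:
  assumes J: "\<And>i. i \<le> r \<Longrightarrow> ideal (J i) R"
    and f: "\<And>i. i < r \<Longrightarrow> f i \<in> carrier R \<and> J (Suc i) = adjoin R (J i) (f i)"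
    and nzd: "\<And>i a. i < r \<Longrightarrow> a \<in> carrier R \<Longrightarrow> f i \<otimes> a \<in> J i \<Longrightarrow> a \<in> J i"
    and jac: "\<And>i a. i < r \<Longrightarrow> a \<in> carrier R \<Longrightarrow> \<one> \<ominus> a \<otimes> f i \<in> Units R"
    and w: "w \<in> carrier R" "w \<notin> J 0" and A: "A \<subseteq> colon R (J 0) w"
  shows "\<exists>Q. prime_chain R r Q \<and> A \<subseteq> Q 0"
proof -
  have "\<exists>Q. \<exists>v\<in>carrier R - J r. prime_chain R r Q \<and> A \<subseteq> Q 0 \<and> Q r = colon R (J r) v"
    using J f nzd jac
  proof (induction r)
    case 0
    obtain v where "v \<in> carrier R - J 0" "primeideal (colon R (J 0) v) R" "A \<subseteq> colon R (J 0) v"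
      using exists_associated_prime[OF _ w A] 0 by blast
    then show ?case by (intro exI[of _ "\<lambda>_. colon R (J 0) v"] bexI[of _ v]) (auto simp: prime_chain_def)
  next
    case (Suc r)
    have "\<exists>Q. \<exists>v\<in>carrier R - J r. prime_chain R r Q \<and> A \<subseteq> Q 0 \<and> Q r = colon R (J r) v"
      by (rule Suc.IH) (use Suc.prems in auto)
    then obtain Q v where Q: "prime_chain R r Q" "A \<subseteq> Q 0" "Q r = colon R (J r) v"
      and v: "v \<in> carrier R" "v \<notin> J r" by blast
    have Jr: "ideal (J r) R" and fr: "f r \<in> carrier R" and JS: "J (Suc r) = adjoin R (J r) (f r)"
      using Suc.prems by auto
    obtain u where u: "u \<in> carrier R" "u \<notin> J (Suc r)" "colon R (J r) v \<subseteq> colon R (J r) u"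
      using exists_not_in_adjoin[OF Jr v fr] Suc.prems(3,4)[of r] JS by auto
    have "insert (f r) (colon R (J r) v) \<subseteq> colon R (J (Suc r)) u"
    proof -
      have "f r \<otimes> u = u \<otimes> f r" using fr u by (simp add: m_comm)
      then have "f r \<otimes> u \<in> J (Suc r)"
        using adjoin_superset(2)[OF Jr fr] ideal.I_l_closed[OF adjoin_ideal[OF Jr fr]] u JS by simp
      moreover have "colon R (J r) u \<subseteq> colon R (J (Suc r)) u"
        using adjoin_superset(1)[OF Jr fr] JS by (auto simp: colon_def)
      ultimately show ?thesis using u fr by (auto simp: colon_def)
    qed
    then obtain t where t: "t \<in> carrier R - J (Suc r)" "primeideal (colon R (J (Suc r)) t) R"
      "insert (f r) (colon R (J r) v) \<subseteq> colon R (J (Suc r)) t"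
      using exists_associated_prime[OF _ u(1,2)] Suc.prems(1)[of "Suc r"] by (metis order_refl)
    \<comment> \<open>The old prime misses \<open>f r\<close>, because \<open>f r\<close> is a
      nonzerodivisor modulo \<open>J r\<close>; hence the new prime is strictly larger.\<close>
    have "f r \<notin> colon R (J r) v" using Suc.prems(3)[of r v] v by (auto simp: colon_def)
    moreover define Q' where "Q' = Q(Suc r := colon R (J (Suc r)) t)"
    ultimately have "prime_chain R (Suc r) Q'"
      using Q t by (auto simp: prime_chain_def less_Suc_eq le_Suc_eq)
    moreover have "Q' 0 = Q 0" "Q' (Suc r) = colon R (J (Suc r)) t" by (simp_all add: Q'_def)
    ultimately show ?case using Q(2) t(1) by (intro exI[of _ Q'] bexI[of _ t]) auto
  qed
  then show ?thesis by blast
qed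

end

section \<open>Localization\<close>

locale cring_localization = cring +
  fixes S
  assumes S_subset: "S \<subseteq> carrier R" and S_one: "\<one> \<in> S"
    and S_mult: "\<And>a b. a \<in> S \<Longrightarrow> b \<in> S \<Longrightarrow> a \<otimes> b \<in> S"
begin

definition frac :: "'a \<Rightarrow> 'a \<Rightarrow> ('a \<times> 'a) set" where
  "frac a s = frac_rel R S `` {(a, s)}"

abbreviation "L \<equiv> localization R S"

lemma S_carrier: "s \<in> S \<Longrightarrow> s \<in> carrier R"
  using S_subset by blast

lemma frac_rel_iff:
  "((a, s), (b, t)) \<in> frac_rel R S \<longleftrightarrow> a \<in> carrier R \<and> s \<in> S \<and> b \<in> carrier R \<and> t \<in> S \<and>
    (\<exists>u\<in>S. u \<otimes> (t \<otimes> a) = u \<otimes> (s \<otimes> b))"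
  by (simp add: frac_rel_def)

lemma equiv_frac_rel: "equiv (carrier R \<times> S) (frac_rel R S)"
proof (rule equivI)
  show "frac_rel R S \<subseteq> (carrier R \<times> S) \<times> carrier R \<times> S"
    by (auto simp: frac_rel_def)
  show "refl_on (carrier R \<times> S) (frac_rel R S)"
    using S_one by (auto simp: refl_on_def frac_rel_iff)
  show "sym (frac_rel R S)"
  proof (rule symI)
    fix p q assume "(p, q) \<in> frac_rel R S"
    then show "(q, p) \<in> frac_rel R S"
      by (cases p; cases q) (simp add: frac_rel_iff, metis)
  qed
  show "trans (frac_rel R S)"
  proof (rule transI)
    fix p q r assume pqr: "(p, q) \<in> frac_rel R S" "(q, r) \<in> frac_rel R S"
    obtain a s b t c w where p: "p = (a, s)" "q = (b, t)" "r = (c, w)"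
      by (metis prod.exhaust)
    have mem: "a \<in> carrier R" "s \<in> S" "b \<in> carrier R" "t \<in> S" "c \<in> carrier R" "w \<in> S"
      using pqr by (simp_all add: p frac_rel_iff)
    obtain u where u: "u \<in> S" and eq1: "u \<otimes> (t \<otimes> a) = u \<otimes> (s \<otimes> b)"
      using pqr(1) by (auto simp: p frac_rel_iff)
    obtain v where v: "v \<in> S" and eq2: "v \<otimes> (w \<otimes> b) = v \<otimes> (t \<otimes> c)"
      using pqr(2) by (auto simp: p frac_rel_iff)
    have c: "s \<in> carrier R" "t \<in> carrier R" "w \<in> carrier R" "u \<in> carrier R" "v \<in> carrier R"
      using mem u v by (simp_all add: S_carrier)
    \<comment> \<open>The middle denominator \<open>t\<close> cannot be cancelled, so it becomes
      part of the witness \<open>u v t\<close>.\<close>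
    have "u \<otimes> v \<otimes> t \<otimes> (w \<otimes> a) = v \<otimes> w \<otimes> (u \<otimes> (t \<otimes> a))"
      using mem(1,3,5) c by (simp add: m_ac)
    also have "\<dots> = u \<otimes> s \<otimes> (v \<otimes> (w \<otimes> b))"
      unfolding eq1 using mem(1,3,5) c by (simp add: m_ac)
    also have "\<dots> = u \<otimes> v \<otimes> t \<otimes> (s \<otimes> c)"
      unfolding eq2 using mem(1,3,5) c by (simp add: m_ac)
    finally show "(p, r) \<in> frac_rel R S"
      using mem S_mult[OF S_mult[OF u v] mem(4)] unfolding p frac_rel_iff by blast
  qed
qed

lemma frac_eq_iff:
  assumes "a \<in> carrier R" "s \<in> S" "b \<in> carrier R" "t \<in> S"
  shows "frac a s = frac b t \<longleftrightarrow> (\<exists>u\<in>S. u \<otimes> (t \<otimes> a) = u \<otimes> (s \<otimes> b))"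
proof -
  have "frac a s = frac b t \<longleftrightarrow> ((a, s), (b, t)) \<in> frac_rel R S"
    unfolding frac_def using eq_equiv_class_iff[OF equiv_frac_rel] assms by simp
  then show ?thesis using assms by (simp add: frac_rel_iff)
qed

lemma frac_eqI:
  assumes "a \<in> carrier R" "s \<in> S" "b \<in> carrier R" "t \<in> S" "t \<otimes> a = s \<otimes> b"
  shows "frac a s = frac b t"
  using assms S_one frac_eq_iff by auto

lemma mem_frac_iff:
  "(b, t) \<in> frac a s \<longleftrightarrow> b \<in> carrier R \<and> t \<in> S \<and> frac a s = frac b t" if "a \<in> carrier R" "s \<in> S"
proof -
  have "(b, t) \<in> frac a s \<longleftrightarrow> ((a, s), (b, t)) \<in> frac_rel R S" by (simp add: frac_def)
  also have "\<dots> \<longleftrightarrow> b \<in> carrier R \<and> t \<in> S \<and> frac a s = frac b t"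
    using that by (simp add: frac_rel_iff) (meson frac_eq_iff)
  finally show ?thesis .
qed

lemma carrier_L: "carrier L = {frac a s | a s. a \<in> carrier R \<and> s \<in> S}"
  by (auto simp: localization_def quotient_def frac_def)

text \<open>The operations of \<open>localization\<close> are unions over all representatives; such
  a union collapses to one value as soon as the value does not depend on the
  representatives.\<close>

lemma UN_frac:
  assumes ab: "a \<in> carrier R" "s \<in> S" "b \<in> carrier R" "t \<in> S"
    and eq: "\<And>a' s' b' t'. \<lbrakk>a' \<in> carrier R; s' \<in> S; b' \<in> carrier R; t' \<in> S;
      frac a s = frac a' s'; frac b t = frac b' t'\<rbrakk> \<Longrightarrow> F a' s' b' t' = F a s b t"
  shows "(\<Union>(a', s')\<in>frac a s. \<Union>(b', t')\<in>frac b t. F a' s' b' t') = F a s b t"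
proof -
  have mem: "(a, s) \<in> frac a s" "(b, t) \<in> frac b t" using ab by (simp_all add: mem_frac_iff)
  have F: "F a' s' b' t' = F a s b t"
    if "(a', s') \<in> frac a s" "(b', t') \<in> frac b t" for a' s' b' t'
    using that eq[of a' s' b' t'] by (simp add: mem_frac_iff ab)
  show ?thesis
  proof (rule SUP_eq_const)
    show "frac a s \<noteq> {}" using mem by blast
    fix p assume "p \<in> frac a s"
    then have "(\<Union>(b', t')\<in>frac b t. F (fst p) (snd p) b' t') = F a s b t"
      using mem by (intro SUP_eq_const) (use F[of "fst p" "snd p"] in \<open>simp_all add: split_beta, blast\<close>)
    then show "(case p of (a', s') \<Rightarrow> \<Union>(b', t')\<in>frac b t. F a' s' b' t') = F a s b t"
      by (simp add: case_prod_beta)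
  qed
qed

lemma mult_frac:
  assumes ab: "a \<in> carrier R" "s \<in> S" "b \<in> carrier R" "t \<in> S"
  shows "frac a s \<otimes>\<^bsub>L\<^esub> frac b t = frac (a \<otimes> b) (s \<otimes> t)"
proof -
  have "frac a s \<otimes>\<^bsub>L\<^esub> frac b t =
      (\<Union>(a', s')\<in>frac a s. \<Union>(b', t')\<in>frac b t. frac (a' \<otimes> b') (s' \<otimes> t'))"
    by (simp add: localization_def frac_def)
  also have "\<dots> = frac (a \<otimes> b) (s \<otimes> t)"
  proof (rule UN_frac[OF ab])
    fix a' s' b' t'
    assume m: "a' \<in> carrier R" "s' \<in> S" "b' \<in> carrier R" "t' \<in> S"
      and eq: "frac a s = frac a' s'" "frac b t = frac b' t'"
    obtain u v where uv: "u \<in> S" "v \<in> S"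
      "u \<otimes> (s' \<otimes> a) = u \<otimes> (s \<otimes> a')" "v \<otimes> (t' \<otimes> b) = v \<otimes> (t \<otimes> b')"
      using eq[unfolded frac_eq_iff[OF ab(1,2) m(1,2)] frac_eq_iff[OF ab(3,4) m(3,4)]] by blast
    have c: "s \<in> carrier R" "t \<in> carrier R" "s' \<in> carrier R" "t' \<in> carrier R" "u \<in> carrier R" "v \<in> carrier R"
      using ab m uv by (simp_all add: S_carrier)
    have "u \<otimes> v \<otimes> (s \<otimes> t \<otimes> (a' \<otimes> b')) = (u \<otimes> (s \<otimes> a')) \<otimes> (v \<otimes> (t \<otimes> b'))"
      using ab(1,3) m(1,3) c by (simp add: m_ac)
    also have "\<dots> = u \<otimes> v \<otimes> (s' \<otimes> t' \<otimes> (a \<otimes> b))"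
      unfolding uv(3,4)[symmetric] using ab(1,3) m(1,3) c by (simp add: m_ac)
    finally show "frac (a' \<otimes> b') (s' \<otimes> t') = frac (a \<otimes> b) (s \<otimes> t)"
      using ab m uv S_mult by (subst frac_eq_iff) auto
  qed
  finally show ?thesis .
qed

lemma add_frac:
  assumes ab: "a \<in> carrier R" "s \<in> S" "b \<in> carrier R" "t \<in> S"
  shows "frac a s \<oplus>\<^bsub>L\<^esub> frac b t = frac (t \<otimes> a \<oplus> s \<otimes> b) (s \<otimes> t)"
proof -
  have "frac a s \<oplus>\<^bsub>L\<^esub> frac b t =
      (\<Union>(a', s')\<in>frac a s. \<Union>(b', t')\<in>frac b t. frac (t' \<otimes> a' \<oplus> s' \<otimes> b') (s' \<otimes> t'))"
    by (simp add: localization_def frac_def)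
  also have "\<dots> = frac (t \<otimes> a \<oplus> s \<otimes> b) (s \<otimes> t)"
  proof (rule UN_frac[OF ab])
    fix a' s' b' t'
    assume m: "a' \<in> carrier R" "s' \<in> S" "b' \<in> carrier R" "t' \<in> S"
      and eq: "frac a s = frac a' s'" "frac b t = frac b' t'"
    obtain u v where uv: "u \<in> S" "v \<in> S"
      "u \<otimes> (s' \<otimes> a) = u \<otimes> (s \<otimes> a')" "v \<otimes> (t' \<otimes> b) = v \<otimes> (t \<otimes> b')"
      using eq[unfolded frac_eq_iff[OF ab(1,2) m(1,2)] frac_eq_iff[OF ab(3,4) m(3,4)]] by blast
    have c: "s \<in> carrier R" "t \<in> carrier R" "s' \<in> carrier R" "t' \<in> carrier R" "u \<in> carrier R" "v \<in> carrier R"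
      using ab m uv by (simp_all add: S_carrier)
    have "u \<otimes> v \<otimes> (s \<otimes> t \<otimes> (t' \<otimes> a' \<oplus> s' \<otimes> b')) =
        v \<otimes> (t \<otimes> t') \<otimes> (u \<otimes> (s \<otimes> a')) \<oplus> u \<otimes> (s \<otimes> s') \<otimes> (v \<otimes> (t \<otimes> b'))"
      using ab(1,3) m(1,3) c by (simp add: r_distr m_ac)
    also have "\<dots> = u \<otimes> v \<otimes> (s' \<otimes> t' \<otimes> (t \<otimes> a \<oplus> s \<otimes> b))"
      unfolding uv(3,4)[symmetric] using ab(1,3) m(1,3) c by (simp add: r_distr m_ac)
    finally show "frac (t' \<otimes> a' \<oplus> s' \<otimes> b') (s' \<otimes> t') = frac (t \<otimes> a \<oplus> s \<otimes> b) (s \<otimes> t)"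
      using ab m uv c S_mult by (subst frac_eq_iff) auto
  qed
  finally show ?thesis .
qed

lemma one_L: "\<one>\<^bsub>L\<^esub> = frac \<one> \<one>" and zero_L: "\<zero>\<^bsub>L\<^esub> = frac \<zero> \<one>"
  by (simp_all add: localization_def frac_def)

lemma frac_closed: "a \<in> carrier R \<Longrightarrow> s \<in> S \<Longrightarrow> frac a s \<in> carrier L"
  by (auto simp: carrier_L)

lemmas L_simps = mult_frac add_frac one_L zero_L S_mult S_one

lemma frac_cases:
  assumes "x \<in> carrier L"
  obtains a s where "x = frac a s" "a \<in> carrier R" "s \<in> S" "s \<in> carrier R"
  using assms S_carrier by (auto simp: carrier_L)

lemma cring_L: "cring L"
proof (rule cringI)
  show "abelian_group L"
  proof (rule abelian_groupI)
    show "x \<oplus>\<^bsub>L\<^esub> y \<in> carrier L" if "x \<in> carrier L" "y \<in> carrier L" for x y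
      using that by (elim frac_cases) (simp add: L_simps frac_closed)
    show "\<zero>\<^bsub>L\<^esub> \<in> carrier L" by (simp add: L_simps frac_closed)
    show "x \<oplus>\<^bsub>L\<^esub> y \<oplus>\<^bsub>L\<^esub> z = x \<oplus>\<^bsub>L\<^esub> (y \<oplus>\<^bsub>L\<^esub> z)"
      if "x \<in> carrier L" "y \<in> carrier L" "z \<in> carrier L" for x y z
      using that
    proof (elim frac_cases)
      fix a s b t c w
      assume x: "x = frac a s" "a \<in> carrier R" "s \<in> S" "s \<in> carrier R"
        and y: "y = frac b t" "b \<in> carrier R" "t \<in> S" "t \<in> carrier R"
        and z: "z = frac c w" "c \<in> carrier R" "w \<in> S" "w \<in> carrier R"
      have "x \<oplus>\<^bsub>L\<^esub> y \<oplus>\<^bsub>L\<^esub> z = frac (w \<otimes> (t \<otimes> a \<oplus> s \<otimes> b) \<oplus> s \<otimes> t \<otimes> c) (s \<otimes> t \<otimes> w)"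
        using x y z by (simp add: add_frac S_mult)
      also have "\<dots> = frac (t \<otimes> w \<otimes> a \<oplus> s \<otimes> (w \<otimes> b \<oplus> t \<otimes> c)) (s \<otimes> (t \<otimes> w))"
      proof -
        have "w \<otimes> (t \<otimes> a \<oplus> s \<otimes> b) \<oplus> s \<otimes> t \<otimes> c = t \<otimes> w \<otimes> a \<oplus> s \<otimes> (w \<otimes> b \<oplus> t \<otimes> c)"
          using x(2,4) y(2,4) z(2,4) by algebra
        then show ?thesis using x(2,4) y(2,4) z(2,4) by (simp add: m_assoc)
      qed
      also have "\<dots> = x \<oplus>\<^bsub>L\<^esub> (y \<oplus>\<^bsub>L\<^esub> z)"
        using x y z by (simp add: add_frac S_mult)
      finally show ?thesis .
    qed
    show "x \<oplus>\<^bsub>L\<^esub> y = y \<oplus>\<^bsub>L\<^esub> x" if "x \<in> carrier L" "y \<in> carrier L" for x y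
      using that by (elim frac_cases) (simp add: L_simps m_ac a_ac)
    show "\<zero>\<^bsub>L\<^esub> \<oplus>\<^bsub>L\<^esub> x = x" if "x \<in> carrier L" for x
      using that by (elim frac_cases) (simp add: L_simps)
    show "\<exists>y\<in>carrier L. y \<oplus>\<^bsub>L\<^esub> x = \<zero>\<^bsub>L\<^esub>" if "x \<in> carrier L" for x
      using that
    proof (elim frac_cases)
      fix a s assume x: "x = frac a s" "a \<in> carrier R" "s \<in> S" "s \<in> carrier R"
      have "frac (\<ominus> a) s \<oplus>\<^bsub>L\<^esub> x = frac \<zero> (s \<otimes> s)"
        using x by (simp add: L_simps r_minus l_neg)
      also have "\<dots> = \<zero>\<^bsub>L\<^esub>"
        unfolding zero_L using x by (intro frac_eqI) (simp_all add: L_simps)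
      finally show ?thesis
        using frac_closed[of "\<ominus> a" s] x(2,3) by (intro bexI[of _ "frac (\<ominus> a) s"]) simp_all
    qed
  qed
  show "comm_monoid L"
  proof (rule comm_monoidI)
    show "x \<otimes>\<^bsub>L\<^esub> y \<in> carrier L" if "x \<in> carrier L" "y \<in> carrier L" for x y
      using that by (elim frac_cases) (simp add: L_simps frac_closed)
    show "\<one>\<^bsub>L\<^esub> \<in> carrier L" by (simp add: L_simps frac_closed)
    show "x \<otimes>\<^bsub>L\<^esub> y \<otimes>\<^bsub>L\<^esub> z = x \<otimes>\<^bsub>L\<^esub> (y \<otimes>\<^bsub>L\<^esub> z)"
      if "x \<in> carrier L" "y \<in> carrier L" "z \<in> carrier L" for x y z
      using that by (elim frac_cases) (simp add: L_simps m_ac)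
    show "x \<otimes>\<^bsub>L\<^esub> y = y \<otimes>\<^bsub>L\<^esub> x" if "x \<in> carrier L" "y \<in> carrier L" for x y
      using that by (elim frac_cases) (simp add: L_simps m_ac)
    show "\<one>\<^bsub>L\<^esub> \<otimes>\<^bsub>L\<^esub> x = x" if "x \<in> carrier L" for x
      using that by (elim frac_cases) (simp add: L_simps)
  qed
  show "(x \<oplus>\<^bsub>L\<^esub> y) \<otimes>\<^bsub>L\<^esub> z = x \<otimes>\<^bsub>L\<^esub> z \<oplus>\<^bsub>L\<^esub> y \<otimes>\<^bsub>L\<^esub> z"
    if "x \<in> carrier L" "y \<in> carrier L" "z \<in> carrier L" for x y z
    using that
  proof (elim frac_cases)
    fix a s b t c w
    assume x: "x = frac a s" "a \<in> carrier R" "s \<in> S" "s \<in> carrier R"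
      and y: "y = frac b t" "b \<in> carrier R" "t \<in> S" "t \<in> carrier R"
      and z: "z = frac c w" "c \<in> carrier R" "w \<in> S" "w \<in> carrier R"
    have "(x \<oplus>\<^bsub>L\<^esub> y) \<otimes>\<^bsub>L\<^esub> z = frac ((t \<otimes> a \<oplus> s \<otimes> b) \<otimes> c) (s \<otimes> t \<otimes> w)"
      using x y z by (simp add: mult_frac add_frac S_mult)
    also have "\<dots> = frac ((t \<otimes> w) \<otimes> (a \<otimes> c) \<oplus> (s \<otimes> w) \<otimes> (b \<otimes> c)) ((s \<otimes> w) \<otimes> (t \<otimes> w))"
    proof (rule frac_eqI)
      show "s \<otimes> w \<otimes> (t \<otimes> w) \<otimes> ((t \<otimes> a \<oplus> s \<otimes> b) \<otimes> c) =
          s \<otimes> t \<otimes> w \<otimes> (t \<otimes> w \<otimes> (a \<otimes> c) \<oplus> s \<otimes> w \<otimes> (b \<otimes> c))"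
        using x(2,4) y(2,4) z(2,4) by algebra
    qed (use x y z in \<open>simp_all add: S_mult\<close>)
    also have "\<dots> = x \<otimes>\<^bsub>L\<^esub> z \<oplus>\<^bsub>L\<^esub> y \<otimes>\<^bsub>L\<^esub> z"
      using x y z by (simp add: mult_frac add_frac S_mult)
    finally show ?thesis .
  qed
qed

lemma frac_one_hom: "(\<lambda>a. frac a \<one>) \<in> ring_hom R L"
  by (rule ring_hom_memI) (simp_all add: L_simps frac_closed)

end

section \<open>Passing to quotients and localizations\<close>

lemma (in cring) mem_ideal_if_mult_unit:
  assumes Q: "ideal Q R" and t: "t \<in> carrier R" and u: "u \<in> Units R" and mem: "t \<otimes> u \<in> Q"
  shows "t \<in> Q"
proof -
  have "(t \<otimes> u) \<otimes> inv u \<in> Q" using ideal.I_r_closed[OF Q mem] u by simp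
  moreover have "t \<otimes> u \<otimes> inv u = t" using t u Units_closed[OF u] by (simp add: m_assoc)
  ultimately show ?thesis by simp
qed

text \<open>The contraction of \<open>J\<close> has finitely many generators, and their images
  generate \<open>J\<close>, because each \<open>t\<close> in \<open>J\<close> differs from the
  image of a contracted element by a unit. Quotients are the case \<open>u = 1\<close>,
  localizations have arbitrary denominators.\<close>

lemma (in ring_hom_cring) noetherian_if_fractions:
  assumes R: "noetherian_ring R"
    and fractions: "\<And>t. t \<in> carrier S \<Longrightarrow>
      \<exists>s\<in>carrier R. \<exists>u\<in>carrier R. h u \<in> Units S \<and> t \<otimes>\<^bsub>S\<^esub> h u = h s"
  shows "noetherian_ring S"
proof (rule S.noetherian_ringI)
  interpret N: noetherian_ring R by fact
  fix J assume J: "ideal J S"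
  have "ideal {r \<in> carrier R. h r \<in> J} R"
    by (rule ring_hom_ring.ideal_vimage[OF ring.is_ring_hom_ring J])
  then obtain A where A: "A \<subseteq> carrier R" "finite A" "{r \<in> carrier R. h r \<in> J} = Idl\<^bsub>R\<^esub> A"
    using N.finetely_gen by blast
  have AS: "h ` A \<subseteq> carrier S" using A(1) by auto
  define D where "D = Idl\<^bsub>S\<^esub> (h ` A)"
  have D: "ideal D S" unfolding D_def by (rule S.genideal_ideal[OF AS])
  have "A \<subseteq> {r \<in> carrier R. h r \<in> D}" using A(1) S.genideal_self[OF AS] by (auto simp: D_def)
  then have le: "{r \<in> carrier R. h r \<in> J} \<subseteq> {r \<in> carrier R. h r \<in> D}"
    unfolding A(3) by (intro R.genideal_minimal ring_hom_ring.ideal_vimage[OF ring.is_ring_hom_ring D])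
  have "J \<subseteq> D"
  proof
    fix t assume t: "t \<in> J"
    then have tS: "t \<in> carrier S" by (rule ideal.Icarr[OF J])
    then obtain s u where su: "s \<in> carrier R" "u \<in> carrier R" "h u \<in> Units S" "t \<otimes>\<^bsub>S\<^esub> h u = h s"
      using fractions by blast
    then have "h s \<in> J" using ideal.I_r_closed[OF J t, of "h u"] by simp
    then have "t \<otimes>\<^bsub>S\<^esub> h u \<in> D" using le su(1,4) by auto
    then show "t \<in> D" by (rule S.mem_ideal_if_mult_unit[OF D tS su(3)])
  qed
  moreover have "h ` A \<subseteq> J" using R.genideal_self[OF A(1)] A(3) by blast
  then have "D \<subseteq> J" unfolding D_def by (rule S.genideal_minimal[OF J])
  ultimately have "J = Idl\<^bsub>S\<^esub> (h ` A)" by (simp add: D_def)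
  then show "\<exists>B\<subseteq>carrier S. finite B \<and> J = Idl\<^bsub>S\<^esub> B" using AS A(2) by (intro exI[of _ "h ` A"]) simp
qed

lemma (in ideal) rcos_eq_zero_iff:
  "s \<in> carrier R \<Longrightarrow> I +> s = \<zero>\<^bsub>R Quot I\<^esub> \<longleftrightarrow> s \<in> I"
  using a_rcos_zero[OF is_ideal] rcos_const_imp_mem by (auto simp: FactRing_def)

lemma (in ideal) rcos_image_carrier: "(+>) I ` carrier R = carrier (R Quot I)"
  by (auto simp: FactRing_def A_RCOSETS_def')

lemma (in ideal) noetherian_quotient:
  assumes "cring R" "noetherian_ring R"
  shows "noetherian_ring (R Quot I)"
proof (rule ring_hom_cring.noetherian_if_fractions[OF rcos_ring_hom_cring[OF assms(1)] assms(2)])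
  interpret cring R by fact
  interpret q: ring_hom_cring R "R Quot I" "(+>) I" by (rule rcos_ring_hom_cring[OF assms(1)])
  fix t assume "t \<in> carrier (R Quot I)"
  then obtain s where s: "s \<in> carrier R" "t = I +> s" unfolding rcos_image_carrier[symmetric] by (elim imageE)
  then have "t \<otimes>\<^bsub>R Quot I\<^esub> (I +> \<one>) = I +> s" by (simp flip: q.hom_mult)
  then show "\<exists>s\<in>carrier R. \<exists>u\<in>carrier R. I +> u \<in> Units (R Quot I) \<and> t \<otimes>\<^bsub>R Quot I\<^esub> (I +> u) = I +> s"
    using s(1) by (intro bexI[of _ s] bexI[of _ "\<one>"] conjI) simp_all
qed

text \<open>\<open>\<phi>\<close> behaves like the canonical map to the localization of \<open>R / I\<close> at the image of the prime \<open>N\<close>.\<close>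

locale localization_at_prime = \<phi>: ring_hom_cring R T \<phi> + N: primeideal N R + I: ideal I R
  for R (structure) and T (structure) and \<phi> and N and I +
  assumes I_subset: "I \<subseteq> N"
    and representative: "\<And>t. t \<in> carrier T \<Longrightarrow>
      \<exists>s\<in>carrier R. \<exists>u\<in>carrier R - N. t \<otimes>\<^bsub>T\<^esub> \<phi> u = \<phi> s"
    and unit: "\<And>u. u \<in> carrier R - N \<Longrightarrow> \<phi> u \<in> Units T"
    and kernel: "\<And>s. s \<in> carrier R \<Longrightarrow> \<phi> s = \<zero>\<^bsub>T\<^esub> \<longleftrightarrow> (\<exists>u\<in>carrier R - N. u \<otimes>\<^bsub>R\<^esub> s \<in> I)"

lemma (in cring) cring_localization_at_prime:
  assumes "primeideal M R"
  shows "cring_localization R (carrier R - M)"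
proof
  interpret M: primeideal M R by fact
  have "\<one> \<notin> M" using M.I_notcarr M.one_imp_carrier by blast
  then show "\<one> \<in> carrier R - M" by simp
  show "a \<otimes> b \<in> carrier R - M" if "a \<in> carrier R - M" "b \<in> carrier R - M" for a b
    using that M.I_prime by auto
qed auto

text \<open>Numerators and denominators over \<open>Q\<close> lift along the surjection
  \<open>q\<close>, so the localization of \<open>Q\<close> can be described by elements of
  \<open>R\<close> and its kernel by multiples lying in \<open>I\<close>. Keeping \<open>q\<close>
  abstract avoids computing with cosets.\<close>

lemma localization_at_prime_comp:
  assumes q: "ring_hom_cring R Q q" and surj: "q ` carrier R = carrier Q"
    and I: "ideal I R" and ker: "\<And>s. s \<in> carrier R \<Longrightarrow> q s = \<zero>\<^bsub>Q\<^esub> \<longleftrightarrow> s \<in> I"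
    and M: "primeideal M Q"
  defines "S \<equiv> carrier Q - M"
  shows "localization_at_prime R (localization Q S)
    (\<lambda>s. cring_localization.frac Q S (q s) \<one>\<^bsub>Q\<^esub>) {s \<in> carrier R. q s \<in> M} I"
proof -
  interpret q: ring_hom_cring R Q q by fact
  interpret I: ideal I R by fact
  interpret M: primeideal M Q by fact
  interpret L: cring_localization Q S
    unfolding S_def by (rule q.S.cring_localization_at_prime[OF M])
  define \<phi> where "\<phi> s = L.frac (q s) \<one>\<^bsub>Q\<^esub>" for s
  define N where "N = {s \<in> carrier R. q s \<in> M}"
  have qN: "q u \<in> S" if "u \<in> carrier R - N" for u
    using that by (auto simp: S_def N_def)
  have "localization_at_prime R L.L \<phi> N I"
  proof (intro localization_at_prime.intro localization_at_prime_axioms.intro)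
    have "(\<lambda>a. L.frac a \<one>\<^bsub>Q\<^esub>) \<circ> q \<in> ring_hom R L.L"
      by (rule ring_hom_trans[OF q.homh L.frac_one_hom])
    moreover have "(\<lambda>a. L.frac a \<one>\<^bsub>Q\<^esub>) \<circ> q = \<phi>" by (simp add: \<phi>_def fun_eq_iff)
    ultimately have "\<phi> \<in> ring_hom R L.L" by (simp only:)
    then show "ring_hom_cring R L.L \<phi>"
      by (intro ring_hom_cring.intro ring_hom_cring_axioms.intro q.R.cring_axioms L.cring_L)
    show "primeideal N R" unfolding N_def
      by (rule ring_hom_ring.primeideal_vimage[OF q.ring.is_ring_hom_ring q.R.cring_axioms M])
    show "ideal I R" by fact
    show "I \<subseteq> N"
    proof
      fix i assume "i \<in> I"
      then have "i \<in> carrier R" "q i = \<zero>\<^bsub>Q\<^esub>" using ker I.Icarr by auto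
      then show "i \<in> N" by (simp add: N_def)
    qed
  next
    fix t assume "t \<in> carrier L.L"
    then obtain a b where ab: "t = L.frac a b" "a \<in> carrier Q" "b \<in> S" "b \<in> carrier Q"
      by (rule L.frac_cases)
    obtain s where s: "s \<in> carrier R" "a = q s" using surj ab(2) by blast
    obtain u where u: "u \<in> carrier R" "b = q u" using surj ab(4) by blast
    have "u \<in> carrier R - N" using u ab(3) by (auto simp: N_def S_def)
    moreover have "t \<otimes>\<^bsub>L.L\<^esub> \<phi> u = \<phi> s"
    proof -
      have "t \<otimes>\<^bsub>L.L\<^esub> \<phi> u = L.frac (a \<otimes>\<^bsub>Q\<^esub> b) (b \<otimes>\<^bsub>Q\<^esub> \<one>\<^bsub>Q\<^esub>)"
        unfolding \<phi>_def ab(1) u(2)[symmetric] using ab L.S_one by (intro L.mult_frac) simp_all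
      also have "\<dots> = L.frac a \<one>\<^bsub>Q\<^esub>"
        using ab L.S_one by (intro L.frac_eqI) (simp_all add: q.S.m_comm)
      finally show ?thesis by (simp add: \<phi>_def s(2))
    qed
    ultimately show "\<exists>s\<in>carrier R. \<exists>u\<in>carrier R - N. t \<otimes>\<^bsub>L.L\<^esub> \<phi> u = \<phi> s"
      using s(1) by (intro bexI)
  next
    fix u assume u: "u \<in> carrier R - N"
    have c: "q u \<in> carrier Q" using u by simp
    define v where "v = L.frac \<one>\<^bsub>Q\<^esub> (q u)"
    have v: "v \<in> carrier L.L" "\<phi> u \<in> carrier L.L"
      using qN[OF u] c L.S_one by (simp_all add: v_def \<phi>_def L.frac_closed)
    have "v \<otimes>\<^bsub>L.L\<^esub> \<phi> u = L.frac (q u) (q u)"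
      unfolding v_def \<phi>_def using qN[OF u] c by (simp add: L.mult_frac L.S_one)
    also have "\<dots> = \<one>\<^bsub>L.L\<^esub>"
      unfolding L.one_L using qN[OF u] c L.S_one by (intro L.frac_eqI) simp_all
    finally have 1: "v \<otimes>\<^bsub>L.L\<^esub> \<phi> u = \<one>\<^bsub>L.L\<^esub>" .
    then have "\<phi> u \<otimes>\<^bsub>L.L\<^esub> v = \<one>\<^bsub>L.L\<^esub>"
      using v cring.cring_simprules(14)[OF L.cring_L v] by simp
    with 1 v show "\<phi> u \<in> Units L.L"
      unfolding Units_def by - (intro CollectI conjI bexI[of _ v]; assumption)
  next
    fix s assume s: "s \<in> carrier R"
    have "\<phi> s = \<zero>\<^bsub>L.L\<^esub> \<longleftrightarrow> (\<exists>w\<in>S. w \<otimes>\<^bsub>Q\<^esub> q s = \<zero>\<^bsub>Q\<^esub>)"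
      unfolding \<phi>_def L.zero_L using s L.S_one
      by (subst L.frac_eq_iff) (simp_all add: L.S_carrier cong: bex_cong)
    also have "\<dots> \<longleftrightarrow> (\<exists>u\<in>carrier R - N. q u \<otimes>\<^bsub>Q\<^esub> q s = \<zero>\<^bsub>Q\<^esub>)"
    proof -
      have "S = q ` (carrier R - N)" using surj by (auto simp: S_def N_def)
      then show ?thesis by simp
    qed
    also have "\<dots> \<longleftrightarrow> (\<exists>u\<in>carrier R - N. u \<otimes>\<^bsub>R\<^esub> s \<in> I)"
      using s ker by (auto simp flip: q.hom_mult)
    finally show "\<phi> s = \<zero>\<^bsub>L.L\<^esub> \<longleftrightarrow> (\<exists>u\<in>carrier R - N. u \<otimes>\<^bsub>R\<^esub> s \<in> I)" .
  qed
  then show ?thesis unfolding N_def by (simp add: \<phi>_def[abs_def])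
qed

lemma localization_Quot:
  assumes R: "cring R" and I: "ideal I R" and M: "primeideal M (R Quot I)"
  defines "S \<equiv> carrier (R Quot I) - M"
  shows "localization_at_prime R (localization (R Quot I) S)
    (\<lambda>s. cring_localization.frac (R Quot I) S (I +>\<^bsub>R\<^esub> s) \<one>\<^bsub>R Quot I\<^esub>) {s \<in> carrier R. I +>\<^bsub>R\<^esub> s \<in> M} I"
  unfolding S_def
  by (rule localization_at_prime_comp[OF ideal.rcos_ring_hom_cring[OF I R]
        ideal.rcos_image_carrier[OF I] I ideal.rcos_eq_zero_iff[OF I] M])

text \<open>Regularity on \<open>R / J\<close>, with \<open>J\<close> as a parameter so that the
  recursion can enlarge it. The requirement of \<open>regular_sequence\<close> that the final ideal
  be proper is treated separately: in the localization it holds as soon as the elements lie in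
  \<open>N\<close>.\<close>

fun weakly_regular :: "('a, 'b) ring_scheme \<Rightarrow> 'a set \<Rightarrow> 'a list \<Rightarrow> bool" where
  "weakly_regular R J [] \<longleftrightarrow> True"
| "weakly_regular R J (f # fs) \<longleftrightarrow>
     (\<forall>a\<in>carrier R. f \<otimes>\<^bsub>R\<^esub> a \<in> J \<longrightarrow> a \<in> J) \<and> weakly_regular R (adjoin R J f) fs"

abbreviation adjoin_list :: "('a, 'b) ring_scheme \<Rightarrow> 'a set \<Rightarrow> 'a list \<Rightarrow> 'a set" where
  "adjoin_list R J fs \<equiv> foldl (adjoin R) J fs"

lemma weakly_regularD:
  assumes "weakly_regular R J fs" "i < length fs" "a \<in> carrier R"
    "fs ! i \<otimes>\<^bsub>R\<^esub> a \<in> adjoin_list R J (take i fs)"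
  shows "a \<in> adjoin_list R J (take i fs)"
  using assms
proof (induction fs arbitrary: J i)
  case (Cons f fs)
  then show ?case by (cases i) auto
qed simp

context cring
begin

lemma adjoin_list_ideal:
  "ideal J R \<Longrightarrow> set fs \<subseteq> carrier R \<Longrightarrow> ideal (adjoin_list R J fs) R"
  by (induction fs arbitrary: J) (auto intro: adjoin_ideal)

lemma adjoin_list_superset:
  "ideal J R \<Longrightarrow> set fs \<subseteq> carrier R \<Longrightarrow> J \<union> set fs \<subseteq> adjoin_list R J fs"
proof (induction fs arbitrary: J)
  case (Cons f fs)
  have "J \<subseteq> adjoin R J f" "f \<in> adjoin R J f" using Cons.prems adjoin_superset by auto
  moreover have "adjoin R J f \<union> set fs \<subseteq> adjoin_list R (adjoin R J f) fs"
    using Cons.prems by (intro Cons.IH adjoin_ideal) auto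
  ultimately show ?case by auto
qed auto

lemma adjoin_list_minimal:
  "ideal I R \<Longrightarrow> J \<subseteq> I \<Longrightarrow> set fs \<subseteq> I \<Longrightarrow> adjoin_list R J fs \<subseteq> I"
  by (induction fs arbitrary: J) (simp_all add: adjoin_minimal)

end

section \<open>Extension and contraction of ideals\<close>

context localization_at_prime
begin

lemma N_complement:
  shows one_notin_N: "\<one> \<in> carrier R - N"
    and mult_notin_N: "\<And>u v. u \<in> carrier R - N \<Longrightarrow> v \<in> carrier R - N \<Longrightarrow> u \<otimes> v \<in> carrier R - N"
  using N.I_notcarr N.one_imp_carrier N.I_prime by auto

text \<open>For an ideal \<open>J\<close> this is the extended ideal \<open>J T\<close>, given as
  the set of fractions with numerator in \<open>J\<close>.\<close>

definition ext :: "'a set \<Rightarrow> 'c set" where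
  "ext J = {t \<in> carrier T. \<exists>s\<in>J. \<exists>u\<in>carrier R - N. t \<otimes>\<^bsub>T\<^esub> \<phi> u = \<phi> s}"

lemma extI: "t \<in> carrier T \<Longrightarrow> s \<in> J \<Longrightarrow> u \<in> carrier R - N \<Longrightarrow> t \<otimes>\<^bsub>T\<^esub> \<phi> u = \<phi> s \<Longrightarrow> t \<in> ext J"
  unfolding ext_def by blast

lemma hom_I: "i \<in> I \<Longrightarrow> \<phi> i = \<zero>\<^bsub>T\<^esub>"
  using kernel[of i] one_notin_N I.I_l_closed[of i \<one>] I.Icarr[of i] by blast

lemma cancel_unit:
  assumes "u \<in> carrier R - N" "t \<in> carrier T" "ideal Q T" "t \<otimes>\<^bsub>T\<^esub> \<phi> u \<in> Q"
  shows "t \<in> Q"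
proof -
  show ?thesis
    using \<phi>.S.mem_ideal_if_mult_unit[OF assms(3,2) unit[OF assms(1)] assms(4)] .
qed

lemma hom_eq_imp:
  assumes "a \<in> carrier R" "b \<in> carrier R" "\<phi> a = \<phi> b"
  shows "\<exists>u\<in>carrier R - N. u \<otimes> a \<ominus> u \<otimes> b \<in> I"
proof -
  have "\<phi> (a \<ominus> b) = \<zero>\<^bsub>T\<^esub>" using assms by (simp add: \<phi>.R.minus_eq \<phi>.S.r_neg)
  then obtain u where u: "u \<in> carrier R - N" "u \<otimes> (a \<ominus> b) \<in> I" using kernel[of "a \<ominus> b"] assms by auto
  have "u \<in> carrier R" using u(1) by simp
  then have "u \<otimes> (a \<ominus> b) = u \<otimes> a \<ominus> u \<otimes> b" using assms(1,2) by algebra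
  then show ?thesis using u by auto
qed

lemma ideal_diff_imp: "ideal J R \<Longrightarrow> a \<in> carrier R \<Longrightarrow> b \<in> J \<Longrightarrow> a \<ominus> b \<in> J \<Longrightarrow> a \<in> J"
proof -
  assume J: "ideal J R" and a: "a \<in> carrier R" and b: "b \<in> J" and ab: "a \<ominus> b \<in> J"
  interpret J: ideal J R by fact
  have "a = (a \<ominus> b) \<oplus> b" using a J.Icarr[OF b] by algebra
  then show "a \<in> J" using J.a_closed[OF ab b] by simp
qed

text \<open>Contracting the extension gives the saturation of \<open>J\<close> by the complement of
  \<open>N\<close>. Equality in \<open>T\<close> only yields a congruence modulo \<open>I\<close>
  after multiplication with a denominator, and \<open>I\<close> is absorbed by
  \<open>J\<close>.\<close>

lemma hom_mem_ext_iff: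
  assumes J: "ideal J R" "I \<subseteq> J" and a: "a \<in> carrier R"
  shows "\<phi> a \<in> ext J \<longleftrightarrow> (\<exists>u\<in>carrier R - N. u \<otimes> a \<in> J)"
proof
  interpret J: ideal J R by fact
  assume "\<phi> a \<in> ext J"
  then obtain s u where su: "s \<in> J" "u \<in> carrier R - N" "\<phi> a \<otimes>\<^bsub>T\<^esub> \<phi> u = \<phi> s"
    by (auto simp: ext_def)
  then have "\<phi> (a \<otimes> u) = \<phi> s" using a by simp
  then obtain v where v: "v \<in> carrier R - N" "v \<otimes> (a \<otimes> u) \<ominus> v \<otimes> s \<in> I"
    using hom_eq_imp[of "a \<otimes> u" s] su a J.Icarr by auto
  have "v \<in> carrier R" "u \<in> carrier R" using v su by simp_all
  then have "v \<otimes> (a \<otimes> u) \<in> carrier R" "v \<otimes> s \<in> J" using a su(1) J.I_l_closed by simp_all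
  then have "v \<otimes> (a \<otimes> u) \<in> J"
    using ideal_diff_imp[OF J(1)] v(2) J(2) by blast
  moreover have "v \<otimes> (a \<otimes> u) = (v \<otimes> u) \<otimes> a"
    using v(1) su(2) a by (simp add: \<phi>.R.m_ac)
  ultimately show "\<exists>u\<in>carrier R - N. u \<otimes> a \<in> J" using mult_notin_N[OF v(1) su(2)] by auto
next
  assume "\<exists>u\<in>carrier R - N. u \<otimes> a \<in> J"
  then obtain u where u: "u \<in> carrier R - N" "u \<otimes> a \<in> J" by blast
  then have "\<phi> a \<otimes>\<^bsub>T\<^esub> \<phi> u = \<phi> (u \<otimes> a)" using a by (simp add: \<phi>.S.m_comm)
  then show "\<phi> a \<in> ext J" using u a by (intro extI[of _ "u \<otimes> a" _ u]) (simp_all add: \<phi>.S.m_comm)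
qed

lemma ext_ideal:
  assumes J: "ideal J R"
  shows "ideal (ext J) T"
proof -
  interpret J: ideal J R by fact
  show ?thesis
  proof (rule idealI[OF \<phi>.S.ring_axioms])
    show "subgroup (ext J) (add_monoid T)"
    proof
      show "ext J \<subseteq> carrier (add_monoid T)" by (auto simp: ext_def)
      show "\<one>\<^bsub>add_monoid T\<^esub> \<in> ext J"
        using one_notin_N J.zero_closed extI[of "\<zero>\<^bsub>T\<^esub>" "\<zero>" J "\<one>"] by simp
    next
      fix x y assume "x \<in> ext J" "y \<in> ext J"
      then obtain s u r v where x: "x \<in> carrier T" "s \<in> J" "u \<in> carrier R - N" "x \<otimes>\<^bsub>T\<^esub> \<phi> u = \<phi> s"
        and y: "y \<in> carrier T" "r \<in> J" "v \<in> carrier R - N" "y \<otimes>\<^bsub>T\<^esub> \<phi> v = \<phi> r"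
        unfolding ext_def by blast
      have c: "s \<in> carrier R" "r \<in> carrier R" "u \<in> carrier R" "v \<in> carrier R"
        using x y J.Icarr by auto
      have uc: "\<phi> u \<in> carrier T" "\<phi> v \<in> carrier T" using c by simp_all
      have "(x \<oplus>\<^bsub>T\<^esub> y) \<otimes>\<^bsub>T\<^esub> (\<phi> u \<otimes>\<^bsub>T\<^esub> \<phi> v) =
          \<phi> v \<otimes>\<^bsub>T\<^esub> (x \<otimes>\<^bsub>T\<^esub> \<phi> u) \<oplus>\<^bsub>T\<^esub> \<phi> u \<otimes>\<^bsub>T\<^esub> (y \<otimes>\<^bsub>T\<^esub> \<phi> v)"
        using x(1) y(1) uc by algebra
      then have "(x \<oplus>\<^bsub>T\<^esub> y) \<otimes>\<^bsub>T\<^esub> \<phi> (u \<otimes> v) = \<phi> (v \<otimes> s \<oplus> u \<otimes> r)"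
        using c x(4) y(4) by simp
      moreover have "v \<otimes> s \<oplus> u \<otimes> r \<in> J" using x y c by (simp add: J.I_l_closed)
      ultimately show "x \<otimes>\<^bsub>add_monoid T\<^esub> y \<in> ext J"
        using x(1) y(1) extI[OF _ _ mult_notin_N[OF x(3) y(3)]] by simp
    next
      fix x assume "x \<in> ext J"
      then obtain s u where x: "x \<in> carrier T" "s \<in> J" "u \<in> carrier R - N" "x \<otimes>\<^bsub>T\<^esub> \<phi> u = \<phi> s"
        unfolding ext_def by blast
      then have "(\<ominus>\<^bsub>T\<^esub> x) \<otimes>\<^bsub>T\<^esub> \<phi> u = \<phi> (\<ominus> s)"
        using J.Icarr by (simp add: \<phi>.S.l_minus)
      then show "inv\<^bsub>add_monoid T\<^esub> x \<in> ext J"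
        using x J.a_inv_closed extI[of "\<ominus>\<^bsub>T\<^esub> x" "\<ominus> s" J u] by (simp flip: a_inv_def)
    qed
  next
    fix a x assume "a \<in> ext J" and xT: "x \<in> carrier T"
    then obtain s u where a: "a \<in> carrier T" "s \<in> J" "u \<in> carrier R - N" "a \<otimes>\<^bsub>T\<^esub> \<phi> u = \<phi> s"
      unfolding ext_def by blast
    obtain r v where x: "r \<in> carrier R" "v \<in> carrier R - N" "x \<otimes>\<^bsub>T\<^esub> \<phi> v = \<phi> r"
      using representative[OF xT] by blast
    have c: "s \<in> carrier R" "u \<in> carrier R" "v \<in> carrier R" using a x J.Icarr by auto
    have uc: "\<phi> u \<in> carrier T" "\<phi> v \<in> carrier T" using c by simp_all
    have "(x \<otimes>\<^bsub>T\<^esub> a) \<otimes>\<^bsub>T\<^esub> (\<phi> v \<otimes>\<^bsub>T\<^esub> \<phi> u) = (x \<otimes>\<^bsub>T\<^esub> \<phi> v) \<otimes>\<^bsub>T\<^esub> (a \<otimes>\<^bsub>T\<^esub> \<phi> u)"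
      using a(1) xT uc by algebra
    then have "(x \<otimes>\<^bsub>T\<^esub> a) \<otimes>\<^bsub>T\<^esub> \<phi> (v \<otimes> u) = \<phi> (r \<otimes> s)"
      using c x a(4) by simp
    moreover have "r \<otimes> s \<in> J" using x a by (simp add: J.I_l_closed)
    ultimately show *: "x \<otimes>\<^bsub>T\<^esub> a \<in> ext J"
      using xT a(1) extI[OF _ _ mult_notin_N[OF x(2) a(3)]] by simp
    show "a \<otimes>\<^bsub>T\<^esub> x \<in> ext J" using * xT a(1) by (simp add: \<phi>.S.m_comm)
  qed
qed

text \<open>Translates the generated ideals occurring in \<open>regular_sequence\<close> into the
  ideals of \<open>R\<close> on which \<open>weakly_regular\<close> runs.\<close>

lemma Idl_image:
  assumes gs: "set gs \<subseteq> carrier R"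
  shows "Idl\<^bsub>T\<^esub> (\<phi> ` set gs) = ext (adjoin_list R I gs)"
proof
  define J where "J = adjoin_list R I gs"
  have J: "ideal J R" unfolding J_def by (rule \<phi>.R.adjoin_list_ideal[OF I.is_ideal gs])
  have IJ: "I \<union> set gs \<subseteq> J" unfolding J_def by (rule \<phi>.R.adjoin_list_superset[OF I.is_ideal gs])
  have gT: "\<phi> ` set gs \<subseteq> carrier T" using gs by auto
  have "\<phi> g \<in> ext J" if g: "g \<in> set gs" for g
  proof -
    have "\<one> \<otimes> g \<in> J" using g gs IJ by (auto simp: subset_iff)
    then show ?thesis using hom_mem_ext_iff[OF J] IJ g gs one_notin_N by blast
  qed
  then show "Idl\<^bsub>T\<^esub> (\<phi> ` set gs) \<subseteq> ext (adjoin_list R I gs)"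
    using ext_ideal[OF J] by (intro \<phi>.S.genideal_minimal) (auto simp: J_def)
  define D where "D = Idl\<^bsub>T\<^esub> (\<phi> ` set gs)"
  have D: "ideal D T" unfolding D_def by (rule \<phi>.S.genideal_ideal[OF gT])
  have "ideal {s \<in> carrier R. \<phi> s \<in> D} R"
    by (rule ring_hom_ring.ideal_vimage[OF \<phi>.ring.is_ring_hom_ring D])
  moreover have "I \<subseteq> {s \<in> carrier R. \<phi> s \<in> D}"
  proof
    fix i assume i: "i \<in> I"
    then have "\<phi> i = \<zero>\<^bsub>T\<^esub>" by (rule hom_I)
    then show "i \<in> {s \<in> carrier R. \<phi> s \<in> D}"
      using additive_subgroup.zero_closed[OF ideal.axioms(1)[OF D]] I.Icarr[OF i] by simp
  qed
  moreover have "set gs \<subseteq> {s \<in> carrier R. \<phi> s \<in> D}"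
    using gs \<phi>.S.genideal_self[OF gT] by (auto simp: D_def)
  ultimately have JD: "J \<subseteq> {s \<in> carrier R. \<phi> s \<in> D}"
    unfolding J_def by (rule \<phi>.R.adjoin_list_minimal)
  show "ext (adjoin_list R I gs) \<subseteq> Idl\<^bsub>T\<^esub> (\<phi> ` set gs)"
  proof
    fix t assume "t \<in> ext (adjoin_list R I gs)"
    then obtain s u where "t \<in> carrier T" "s \<in> J" "u \<in> carrier R - N" "t \<otimes>\<^bsub>T\<^esub> \<phi> u = \<phi> s"
      unfolding ext_def J_def by blast
    then show "t \<in> Idl\<^bsub>T\<^esub> (\<phi> ` set gs)"
      using cancel_unit[OF _ _ D] JD by (auto simp: D_def)
  qed
qed

lemma noetherian_T:
  assumes "noetherian_ring R"
  shows "noetherian_ring T"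
proof (rule \<phi>.noetherian_if_fractions[OF assms])
  fix t assume "t \<in> carrier T"
  then obtain s u where "s \<in> carrier R" "u \<in> carrier R - N" "t \<otimes>\<^bsub>T\<^esub> \<phi> u = \<phi> s"
    using representative by blast
  then show "\<exists>s\<in>carrier R. \<exists>u\<in>carrier R. \<phi> u \<in> Units T \<and> t \<otimes>\<^bsub>T\<^esub> \<phi> u = \<phi> s"
    using unit by blast
qed

lemma not_ext_N_unit:
  assumes "t \<in> carrier T" "t \<notin> ext N"
  shows "t \<in> Units T"
proof -
  obtain s u where su: "s \<in> carrier R" "u \<in> carrier R - N" "t \<otimes>\<^bsub>T\<^esub> \<phi> u = \<phi> s"
    using representative[OF assms(1)] by blast
  then have "s \<notin> N" using assms unfolding ext_def by blast
  then have "\<phi> s \<in> Units T" using unit su by blast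
  then have U: "t \<otimes>\<^bsub>T\<^esub> \<phi> u \<in> Units T" by (simp add: su)
  show ?thesis
    using \<phi>.S.unit_factor[OF U assms(1)] su(2) by simp
qed

lemma one_notin_ext:
  assumes "ideal J R" "I \<subseteq> J" "J \<subseteq> N"
  shows "\<one>\<^bsub>T\<^esub> \<notin> ext J"
proof
  assume "\<one>\<^bsub>T\<^esub> \<in> ext J"
  then have "\<phi> \<one> \<in> ext J" by simp
  then obtain u where "u \<in> carrier R - N" "u \<otimes> \<one> \<in> J"
    using hom_mem_ext_iff[OF assms(1,2)] by blast
  then show False using assms(3) by auto
qed

text \<open>Elements outside \<open>ext N\<close> are units, so every proper ideal is contained in
  \<open>ext N\<close>.\<close>

lemma maximalideal_T_iff: "maximalideal M T \<longleftrightarrow> M = ext N"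
proof -
  have E: "ideal (ext N) T" by (rule ext_ideal[OF N.is_ideal])
  have one: "\<one>\<^bsub>T\<^esub> \<notin> ext N" by (rule one_notin_ext[OF N.is_ideal I_subset order_refl])
  have sub: "Q \<subseteq> ext N" if Q: "ideal Q T" "Q \<noteq> carrier T" for Q
  proof (rule ccontr)
    assume "\<not> Q \<subseteq> ext N"
    then obtain t where t: "t \<in> Q" "t \<notin> ext N" by blast
    then have U: "t \<in> Units T" using not_ext_N_unit ideal.Icarr[OF Q(1)] by blast
    then have "inv\<^bsub>T\<^esub> t \<otimes>\<^bsub>T\<^esub> t \<in> Q" by (intro ideal.I_l_closed[OF Q(1) t(1)] \<phi>.S.Units_inv_closed)
    then show False using U ideal.one_imp_carrier[OF Q(1)] Q(2) by simp
  qed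
  show ?thesis
  proof
    assume M: "maximalideal M T"
    interpret M: maximalideal M T by fact
    have "M \<subseteq> ext N" using sub M.is_ideal M.I_notcarr by metis
    then have "ext N = M \<or> ext N = carrier T"
      using M.I_maximal[OF E] ideal.Icarr[OF E] by blast
    then show "M = ext N" using one by auto
  next
    assume M: "M = ext N"
    show "maximalideal M T" unfolding M
    proof (rule maximalidealI[OF E])
      show "carrier T \<noteq> ext N" using one by auto
      show "J = ext N \<or> J = carrier T" if "ideal J T" "ext N \<subseteq> J" "J \<subseteq> carrier T" for J
        using sub[OF that(1)] that(2) by blast
    qed
  qed
qed

lemma local_ring_T: "local_ring T"
  unfolding local_ring_def by (simp add: \<phi>.S.cring_axioms maximalideal_T_iff)

lemma the_maximalideal_T: "(THE M. maximalideal M T) = ext N"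
  by (simp add: maximalideal_T_iff)

text \<open>Inclusions stay strict: if \<open>t\<close> separates two primes of \<open>T\<close>, so
  does its numerator, as denominators are units.\<close>

lemma contract_prime_chain:
  assumes "prime_chain T k Q"
  shows "prime_chain R k (\<lambda>i. {s \<in> carrier R. \<phi> s \<in> Q i})" and "I \<subseteq> {s \<in> carrier R. \<phi> s \<in> Q 0}"
proof -
  have pr: "primeideal (Q i) T" if "i \<le> k" for i using assms that by (auto simp: prime_chain_def)
  have id: "ideal (Q i) T" if "i \<le> k" for i using pr[OF that] by (rule primeideal.axioms(1))
  show "I \<subseteq> {s \<in> carrier R. \<phi> s \<in> Q 0}"
  proof
    fix i assume i: "i \<in> I"
    then have "\<phi> i = \<zero>\<^bsub>T\<^esub>" by (rule hom_I)
    then show "i \<in> {s \<in> carrier R. \<phi> s \<in> Q 0}"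
      using additive_subgroup.zero_closed[OF ideal.axioms(1)[OF id]] I.Icarr[OF i] by simp
  qed
  show "prime_chain R k (\<lambda>i. {s \<in> carrier R. \<phi> s \<in> Q i})"
    unfolding prime_chain_def
  proof (intro conjI allI impI)
    fix i assume "i \<le> k"
    then show "primeideal {s \<in> carrier R. \<phi> s \<in> Q i} R"
      by (intro ring_hom_ring.primeideal_vimage[OF \<phi>.ring.is_ring_hom_ring \<phi>.R.cring_axioms] pr)
  next
    fix i assume i: "i < k"
    then have "Q i \<subset> Q (Suc i)" using assms by (auto simp: prime_chain_def)
    then obtain t where t: "t \<in> Q (Suc i)" "t \<notin> Q i" "Q i \<subseteq> Q (Suc i)" by blast
    have tT: "t \<in> carrier T" using ideal.Icarr[OF id t(1)] i by simp
    obtain s u where su: "s \<in> carrier R" "u \<in> carrier R - N" "t \<otimes>\<^bsub>T\<^esub> \<phi> u = \<phi> s"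
      using representative[OF tT] by blast
    have "\<phi> s \<in> Q (Suc i)" using ideal.I_r_closed[OF id t(1), of "\<phi> u"] su i by simp
    moreover have "\<phi> s \<notin> Q i" using cancel_unit[OF su(2) tT id[of i]] su(3) t(2) i by auto
    ultimately show "{s \<in> carrier R. \<phi> s \<in> Q i} \<subset> {s \<in> carrier R. \<phi> s \<in> Q (Suc i)}"
      using t(3) su(1) by blast
  qed
qed

text \<open>Clearing denominators turns a relation \<open>f t\<close> in \<open>ext J\<close> into
  \<open>f (v s)\<close> in \<open>J\<close> with \<open>v\<close> outside \<open>N\<close>; then
  \<open>v s\<close> is in \<open>J\<close>, which means that \<open>s\<close>, and with it
  \<open>t\<close>, is in the extension.\<close>

lemma weakly_regular_image:
  assumes gs: "set gs \<subseteq> carrier R" and fs: "set fs \<subseteq> carrier R"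
    and reg: "weakly_regular R (adjoin_list R I gs) fs"
    and i: "i < length fs" and t: "t \<in> carrier T"
    and mem: "\<phi> (fs ! i) \<otimes>\<^bsub>T\<^esub> t \<in> Idl\<^bsub>T\<^esub> (\<phi> ` set (gs @ take i fs))"
  shows "t \<in> Idl\<^bsub>T\<^esub> (\<phi> ` set (gs @ take i fs))"
proof -
  define J where "J = adjoin_list R I (gs @ take i fs)"
  have c: "set (gs @ take i fs) \<subseteq> carrier R" using gs fs set_take_subset[of i fs] by auto
  have J: "ideal J R" unfolding J_def by (rule \<phi>.R.adjoin_list_ideal[OF I.is_ideal c])
  have IJ: "I \<subseteq> J" using \<phi>.R.adjoin_list_superset[OF I.is_ideal c] unfolding J_def by blast
  have eq: "Idl\<^bsub>T\<^esub> (\<phi> ` set (gs @ take i fs)) = ext J" unfolding J_def by (rule Idl_image[OF c])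
  have f: "fs ! i \<in> carrier R" using fs i nth_mem[of i fs] by blast
  obtain s u where su: "s \<in> carrier R" "u \<in> carrier R - N" "t \<otimes>\<^bsub>T\<^esub> \<phi> u = \<phi> s"
    using representative[OF t] by blast
  have "(\<phi> (fs ! i) \<otimes>\<^bsub>T\<^esub> t) \<otimes>\<^bsub>T\<^esub> \<phi> u \<in> ext J"
    using ideal.I_r_closed[OF ext_ideal[OF J] mem[unfolded eq], of "\<phi> u"] su(2) by simp
  moreover have "(\<phi> (fs ! i) \<otimes>\<^bsub>T\<^esub> t) \<otimes>\<^bsub>T\<^esub> \<phi> u = \<phi> (fs ! i \<otimes> s)"
    using f t su by (simp add: \<phi>.S.m_assoc)
  ultimately obtain v where v: "v \<in> carrier R - N" "v \<otimes> (fs ! i \<otimes> s) \<in> J"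
    using hom_mem_ext_iff[OF J IJ, of "fs ! i \<otimes> s"] f su(1) by auto
  have "fs ! i \<otimes> (v \<otimes> s) \<in> adjoin_list R (adjoin_list R I gs) (take i fs)"
    using v f su(1) by (simp add: J_def \<phi>.R.m_lcomm)
  then have "v \<otimes> s \<in> J"
    using weakly_regularD[OF reg i, of "v \<otimes> s"] v(1) su(1) by (simp add: J_def)
  then have "\<phi> s \<in> ext J" using hom_mem_ext_iff[OF J IJ su(1)] v(1) by blast
  then show ?thesis using cancel_unit[OF su(2) t ext_ideal[OF J]] su(3) unfolding eq by simp
qed

lemma Idl_image_neq_carrier:
  assumes "set gs \<subseteq> N"
  shows "Idl\<^bsub>T\<^esub> (\<phi> ` set gs) \<noteq> carrier T"
proof -
  have c: "set gs \<subseteq> carrier R" using assms N.Icarr by blast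
  have "\<one>\<^bsub>T\<^esub> \<notin> ext (adjoin_list R I gs)"
    using \<phi>.R.adjoin_list_ideal[OF I.is_ideal c] \<phi>.R.adjoin_list_superset[OF I.is_ideal c]
      \<phi>.R.adjoin_list_minimal[OF N.is_ideal I_subset assms] by (intro one_notin_ext) auto
  then show ?thesis using Idl_image[OF c] by auto
qed

lemma hom_N_subset_ext: "\<phi> ` N \<subseteq> ext N"
proof -
  have "\<phi> s \<in> ext N" if "s \<in> N" for s
    using that N.Icarr[OF that] hom_mem_ext_iff[OF N.is_ideal I_subset, of s] one_notin_N
    by (metis N.I_l_closed Diff_iff)
  then show ?thesis by blast
qed

text \<open>A squeeze: \<open>length fs\<close> is at most the depth, the depth at most the
  dimension, and the dimension at most \<open>length fs\<close> because prime chains contract to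
  \<open>R\<close>.\<close>

lemma cohen_macaulay_T:
  assumes R: "noetherian_ring R"
    and fs: "set fs \<subseteq> N" "weakly_regular R I fs"
    and dim: "\<And>k Q. prime_chain R k Q \<Longrightarrow> I \<subseteq> Q 0 \<Longrightarrow> k \<le> length fs"
  shows "cohen_macaulay_local_ring T"
proof -
  have c: "set fs \<subseteq> carrier R" using fs(1) N.Icarr by blast
  have "regular_sequence T (map \<phi> fs)"
    unfolding regular_sequence_def
  proof (intro conjI allI impI ballI)
    show "set (map \<phi> fs) \<subseteq> carrier T" using c by auto
    show "Idl\<^bsub>T\<^esub> (set (map \<phi> fs)) \<noteq> carrier T" using Idl_image_neq_carrier[OF fs(1)] by simp
    fix i a assume "i < length (map \<phi> fs)" "a \<in> carrier T"
      "map \<phi> fs ! i \<otimes>\<^bsub>T\<^esub> a \<in> Idl\<^bsub>T\<^esub> (set (take i (map \<phi> fs)))"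
    then show "a \<in> Idl\<^bsub>T\<^esub> (set (take i (map \<phi> fs)))"
      using weakly_regular_image[of "[]" fs i a] c fs(2) by (simp add: take_map)
  qed
  moreover have "set (map \<phi> fs) \<subseteq> ext N" using hom_N_subset_ext fs(1) by auto
  ultimately have "enat (length fs) \<le> depth (ext N) T"
    unfolding depth_def by (intro Sup_upper CollectI exI[of _ "map \<phi> fs"]) simp
  moreover have "krull_dim T \<le> enat (length fs)"
    using contract_prime_chain dim by (intro krull_dim_leI) blast
  moreover have "depth (ext N) T \<le> krull_dim T" by (rule \<phi>.S.depth_le_krull_dim)
  ultimately show ?thesis
    unfolding cohen_macaulay_local_ring_def the_maximalideal_T
    using noetherian_T[OF R] local_ring_T by auto
qed

text \<open>The depth of a Noetherian local ring is at most the dimension of its quotient by any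
  associated prime.\<close>

lemma cohen_macaulay_T_imp_prime_chain:
  assumes CM: "cohen_macaulay_local_ring T"
    and gs: "set gs \<subseteq> N" and fs: "set fs \<subseteq> N" "weakly_regular R (adjoin_list R I gs) fs"
    and w: "w \<in> carrier R" "\<And>u. u \<in> carrier R - N \<Longrightarrow> u \<otimes> w \<notin> I"
    and A: "A \<subseteq> {a \<in> carrier R. a \<otimes> w \<in> I}"
  shows "\<exists>k Q. length fs \<le> k \<and> prime_chain R k Q \<and> A \<subseteq> Q 0"
proof -
  interpret noetherian_cring T
    using CM \<phi>.S.cring_axioms by (simp add: noetherian_cring_def cohen_macaulay_local_ring_def)
  have E: "ideal (ext N) T" by (rule ext_ideal[OF N.is_ideal])
  have c: "set gs \<subseteq> carrier R" "set fs \<subseteq> carrier R" using gs fs(1) N.Icarr by auto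
  \<comment> \<open>The dimension of \<open>T\<close> is at least \<open>length fs\<close>: already
    the quotient by the images of \<open>gs\<close> carries a regular sequence of that length.
    Cohen-Macaulayness moves this bound to the depth.\<close>
  have "enat (length (map \<phi> (gs @ fs)) - length gs) \<le> krull_dim T"
  proof (rule \<phi>.S.length_le_krull_dim)
    show "set (map \<phi> (gs @ fs)) \<subseteq> carrier T" using c by auto
    show "Idl\<^bsub>T\<^esub> (set (map \<phi> (gs @ fs))) \<noteq> carrier T"
      using Idl_image_neq_carrier[of "gs @ fs"] gs fs(1) by (simp add: image_Un)
    fix i a assume i: "length gs \<le> i" "i < length (map \<phi> (gs @ fs))" and a: "a \<in> carrier T"
      and mem: "map \<phi> (gs @ fs) ! i \<otimes>\<^bsub>T\<^esub> a \<in> Idl\<^bsub>T\<^esub> (set (take i (map \<phi> (gs @ fs))))"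
    have "set (take i (map \<phi> (gs @ fs))) = \<phi> ` set (gs @ take (i - length gs) fs)"
      using i by (simp add: take_map image_Un)
    moreover have "map \<phi> (gs @ fs) ! i = \<phi> (fs ! (i - length gs))"
      using i by (simp add: nth_append del: map_append)
    ultimately show "a \<in> Idl\<^bsub>T\<^esub> (set (take i (map \<phi> (gs @ fs))))"
      using weakly_regular_image[OF c fs(2), of "i - length gs" a] i a mem by (simp only:) auto
  qed simp
  then have "enat (length fs) \<le> depth (ext N) T"
    using CM by (simp add: cohen_macaulay_local_ring_def the_maximalideal_T)
  then have "\<exists>ys. regular_sequence T ys \<and> set ys \<subseteq> ext N \<and> length fs \<le> length ys" if "length fs > 0"
  proof -
    \<comment> \<open>Instead of attaining the supremum it suffices to exceed
      \<open>length fs - 1\<close>; for an empty \<open>fs\<close> the empty sequence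
      serves.\<close>
    have "enat (length fs - 1) < depth (ext N) T"
      using that \<open>enat (length fs) \<le> depth (ext N) T\<close> by (rule_tac less_le_trans) auto
    then obtain ys where "regular_sequence T ys" "set ys \<subseteq> ext N" "length fs - 1 < length ys"
      unfolding depth_def less_Sup_iff by auto
    then show ?thesis by (intro exI[of _ ys]) auto
  qed
  moreover have "regular_sequence T []"
    using Idl_image_neq_carrier[of "[]"] by (simp add: regular_sequence_def)
  ultimately obtain ys where ys: "regular_sequence T ys" "set ys \<subseteq> ext N" "length fs \<le> length ys"
    by (cases "length fs > 0") fastforce+
  have ysT: "set ys \<subseteq> carrier T" using ys(2) ideal.Icarr[OF E] by blast
  have zero: "Idl\<^bsub>T\<^esub> {} = {\<zero>\<^bsub>T\<^esub>}"
    using \<phi>.S.genideal_minimal[OF \<phi>.S.zeroideal, of "{}"]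
      additive_subgroup.zero_closed[OF ideal.axioms(1)[OF \<phi>.S.genideal_ideal[of "{}"]]] by auto
  have "\<exists>Q. prime_chain T (length ys) Q \<and> \<phi> ` A \<subseteq> Q 0"
  proof (rule annihilator_prime_chain[where J = "\<lambda>i. Idl\<^bsub>T\<^esub> (set (take i ys))" and f = "\<lambda>i. ys ! i" and w = "\<phi> w"])
    show "ideal (Idl\<^bsub>T\<^esub> (set (take i ys))) T" for i
      using ysT set_take_subset[of i ys] by (intro \<phi>.S.genideal_ideal) blast
    show "ys ! i \<in> carrier T \<and> Idl\<^bsub>T\<^esub> (set (take (Suc i) ys)) = adjoin T (Idl\<^bsub>T\<^esub> (set (take i ys))) (ys ! i)"
      if "i < length ys" for i
      using \<phi>.S.Idl_take_Suc[OF ysT that] ysT nth_mem[OF that] by blast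
    show "a \<in> Idl\<^bsub>T\<^esub> (set (take i ys))"
      if "i < length ys" "a \<in> carrier T" "ys ! i \<otimes>\<^bsub>T\<^esub> a \<in> Idl\<^bsub>T\<^esub> (set (take i ys))" for i a
      using ys(1) that unfolding regular_sequence_def by blast
    \<comment> \<open>The entries of \<open>ys\<close> lie in the only maximal ideal, so
      \<open>1 - a y\<close> lies outside it.\<close>
    show "\<one>\<^bsub>T\<^esub> \<ominus>\<^bsub>T\<^esub> a \<otimes>\<^bsub>T\<^esub> ys ! i \<in> Units T" if "i < length ys" "a \<in> carrier T" for i a
    proof (rule not_ext_N_unit)
      have y: "ys ! i \<in> ext N" "ys ! i \<in> carrier T" using ys(2) ysT nth_mem[OF that(1)] by auto
      show "\<one>\<^bsub>T\<^esub> \<ominus>\<^bsub>T\<^esub> a \<otimes>\<^bsub>T\<^esub> ys ! i \<in> carrier T" using y that by simp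
      show "\<one>\<^bsub>T\<^esub> \<ominus>\<^bsub>T\<^esub> a \<otimes>\<^bsub>T\<^esub> ys ! i \<notin> ext N"
      proof
        assume *: "\<one>\<^bsub>T\<^esub> \<ominus>\<^bsub>T\<^esub> a \<otimes>\<^bsub>T\<^esub> ys ! i \<in> ext N"
        have "a \<otimes>\<^bsub>T\<^esub> ys ! i \<in> ext N" using ideal.I_l_closed[OF E y(1) that(2)] .
        then have "(\<one>\<^bsub>T\<^esub> \<ominus>\<^bsub>T\<^esub> a \<otimes>\<^bsub>T\<^esub> ys ! i) \<oplus>\<^bsub>T\<^esub> a \<otimes>\<^bsub>T\<^esub> ys ! i \<in> ext N"
          using additive_subgroup.a_closed[OF ideal.axioms(1)[OF E] *] by blast
        moreover have "(\<one>\<^bsub>T\<^esub> \<ominus>\<^bsub>T\<^esub> a \<otimes>\<^bsub>T\<^esub> ys ! i) \<oplus>\<^bsub>T\<^esub> a \<otimes>\<^bsub>T\<^esub> ys ! i = \<one>\<^bsub>T\<^esub>"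
          using y(2) that(2) by algebra
        ultimately show False using one_notin_ext[OF N.is_ideal I_subset order_refl] by simp
      qed
    qed
    show "\<phi> w \<in> carrier T" using w by simp
    show "\<phi> w \<notin> Idl\<^bsub>T\<^esub> (set (take 0 ys))"
      using kernel[OF w(1)] w(2) by (auto simp: zero)
    show "\<phi> ` A \<subseteq> colon T (Idl\<^bsub>T\<^esub> (set (take 0 ys))) (\<phi> w)"
    proof
      fix t assume "t \<in> \<phi> ` A"
      then obtain a where a: "a \<in> carrier R" "a \<otimes> w \<in> I" "t = \<phi> a" using A by blast
      have "\<phi> (a \<otimes> w) = \<zero>\<^bsub>T\<^esub>" using a(2) by (rule hom_I)
      then show "t \<in> colon T (Idl\<^bsub>T\<^esub> (set (take 0 ys))) (\<phi> w)"
        using a w by (simp add: colon_def zero)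
    qed
  qed
  then obtain Q where Q: "prime_chain T (length ys) Q" "\<phi> ` A \<subseteq> Q 0" by blast
  have "A \<subseteq> {s \<in> carrier R. \<phi> s \<in> Q 0}" using A Q(2) by blast
  then show ?thesis
    using contract_prime_chain(1)[OF Q(1)] ys(3)
    by (intro exI[of _ "length ys"] exI[of _ "\<lambda>i. {s \<in> carrier R. \<phi> s \<in> Q i}"]) simp
qed

end

section \<open>Subrings and Hilbert's basis theorem\<close>

definition unital_subring :: "'a::comm_ring_1 set \<Rightarrow> bool" where
  "unital_subring B \<longleftrightarrow> 1 \<in> B \<and> (\<forall>a\<in>B. \<forall>b\<in>B. a - b \<in> B \<and> a * b \<in> B)"

text \<open>Polynomials over \<open>B\<close> are represented as polynomials over the ambient type,
  so that the type-based theory of \<open>poly\<close> applies to every subring.\<close>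

definition coeffs_in :: "'a::comm_ring_1 set \<Rightarrow> 'a poly \<Rightarrow> bool" where
  "coeffs_in B p \<longleftrightarrow> (\<forall>i. Polynomial.coeff p i \<in> B)"

definition ring_adjoin :: "'a::comm_ring_1 set \<Rightarrow> 'a \<Rightarrow> 'a set" where
  "ring_adjoin B a = {poly p a | p. coeffs_in B p}"

definition sub_ring :: "'a::comm_ring_1 set \<Rightarrow> 'a ring" where
  "sub_ring B = ring_of_type_algebra \<lparr> carrier := B \<rparr>"

lemma sub_ring_simps [simp]:
  "carrier (sub_ring B) = B" "a \<otimes>\<^bsub>sub_ring B\<^esub> b = a * b" "a \<oplus>\<^bsub>sub_ring B\<^esub> b = a + b"
  "\<one>\<^bsub>sub_ring B\<^esub> = 1" "\<zero>\<^bsub>sub_ring B\<^esub> = 0"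
  by (simp_all add: sub_ring_def ring_of_type_algebra_def)

context
  fixes B :: "'a::comm_ring_1 set"
  assumes B: "unital_subring B"
begin

lemma subring_one: "1 \<in> B" and subring_diff: "a \<in> B \<Longrightarrow> b \<in> B \<Longrightarrow> a - b \<in> B"
  and subring_mult: "a \<in> B \<Longrightarrow> b \<in> B \<Longrightarrow> a * b \<in> B"
  using B by (auto simp: unital_subring_def)

lemma subring_zero: "0 \<in> B"
  using subring_diff[OF subring_one subring_one] by simp

lemma subring_uminus: "a \<in> B \<Longrightarrow> - a \<in> B"
  using subring_diff[OF subring_zero] by simp

lemma subring_add: "a \<in> B \<Longrightarrow> b \<in> B \<Longrightarrow> a + b \<in> B"
  using subring_diff[OF _ subring_uminus] by fastforce

lemma subring_power: "a \<in> B \<Longrightarrow> a ^ k \<in> B"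
  by (induction k) (auto intro: subring_one subring_mult)

lemma subring_sum: "(\<And>i. i \<in> A \<Longrightarrow> f i \<in> B) \<Longrightarrow> sum f A \<in> B"
  by (induction A rule: infinite_finite_induct) (auto intro: subring_zero subring_add)

lemmas subring_closed = subring_one subring_diff subring_mult subring_zero subring_uminus
  subring_add subring_power subring_sum

lemma cring_sub_ring: "cring (sub_ring B)"
proof (rule cringI)
  show "abelian_group (sub_ring B)"
  proof (rule abelian_groupI)
    show "\<exists>y\<in>carrier (sub_ring B). y \<oplus>\<^bsub>sub_ring B\<^esub> x = \<zero>\<^bsub>sub_ring B\<^esub>"
      if "x \<in> carrier (sub_ring B)" for x
      using that subring_uminus[of x] by (intro bexI[of _ "- x"]) auto
  qed (auto simp: algebra_simps intro: subring_closed)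
  show "comm_monoid (sub_ring B)"
    by (rule comm_monoidI) (auto simp: algebra_simps intro: subring_closed)
qed (auto simp: algebra_simps)

lemma a_inv_sub_ring: "a \<in> B \<Longrightarrow> \<ominus>\<^bsub>sub_ring B\<^esub> a = - a"
proof -
  interpret cring "sub_ring B" by (rule cring_sub_ring)
  assume "a \<in> B"
  then show ?thesis using minus_equality[of "- a" a] subring_uminus[of a] by simp
qed

lemma ideal_sub_ringI:
  assumes "J \<subseteq> B" "0 \<in> J" "\<And>a b. a \<in> J \<Longrightarrow> b \<in> J \<Longrightarrow> a + b \<in> J"
    and mult: "\<And>r a. r \<in> B \<Longrightarrow> a \<in> J \<Longrightarrow> r * a \<in> J"
  shows "ideal J (sub_ring B)"
proof -
  interpret cring "sub_ring B" by (rule cring_sub_ring)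
  show ?thesis
  proof (rule idealI[OF ring_axioms])
    show "subgroup J (add_monoid (sub_ring B))"
    proof
      fix x assume x: "x \<in> J"
      then have "inv\<^bsub>add_monoid (sub_ring B)\<^esub> x = (- 1) * x"
        using a_inv_sub_ring[of x] assms(1) by (auto simp: a_inv_def)
      then show "inv\<^bsub>add_monoid (sub_ring B)\<^esub> x \<in> J"
        using mult[OF subring_uminus[OF subring_one] x] by simp
    qed (use assms in auto)
  next
    fix a x assume "a \<in> J" "x \<in> carrier (sub_ring B)"
    then have "x * a \<in> J" using mult by simp
    then show "x \<otimes>\<^bsub>sub_ring B\<^esub> a \<in> J" "a \<otimes>\<^bsub>sub_ring B\<^esub> x \<in> J" by (simp_all add: mult.commute)
  qed
qed

lemma ideal_sub_ringD:
  assumes "ideal J (sub_ring B)"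
  shows "J \<subseteq> B" "0 \<in> J" "a \<in> J \<Longrightarrow> b \<in> J \<Longrightarrow> a + b \<in> J" "r \<in> B \<Longrightarrow> a \<in> J \<Longrightarrow> r * a \<in> J"
    "a \<in> J \<Longrightarrow> - a \<in> J" "a \<in> J \<Longrightarrow> b \<in> J \<Longrightarrow> a - b \<in> J"
proof -
  interpret J: ideal J "sub_ring B" by fact
  show JB: "J \<subseteq> B" using J.Icarr by auto
  show "0 \<in> J" using additive_subgroup.zero_closed[OF J.additive_subgroup_axioms] by simp
  show add: "a + b \<in> J" if "a \<in> J" "b \<in> J" for a b
    using additive_subgroup.a_closed[OF J.additive_subgroup_axioms that] by simp
  show mult: "r * a \<in> J" if "r \<in> B" "a \<in> J" for r a using J.I_l_closed[OF that(2), of r] that by simp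
  show um: "- a \<in> J" if "a \<in> J" for a
    using mult[of "- 1" a] that subring_uminus[OF subring_one] by simp
  show "a - b \<in> J" if "a \<in> J" "b \<in> J" using add[OF that(1) um[OF that(2)]] by simp
qed

lemma coeffs_in_closed:
  "coeffs_in B p \<Longrightarrow> coeffs_in B q \<Longrightarrow> coeffs_in B (p + q)"
  "coeffs_in B p \<Longrightarrow> coeffs_in B q \<Longrightarrow> coeffs_in B (p - q)"
  "coeffs_in B p \<Longrightarrow> coeffs_in B q \<Longrightarrow> coeffs_in B (p * q)"
  "b \<in> B \<Longrightarrow> coeffs_in B p \<Longrightarrow> coeffs_in B (Polynomial.smult b p)"
  "b \<in> B \<Longrightarrow> coeffs_in B (Polynomial.monom b k)"
  "b \<in> B \<Longrightarrow> coeffs_in B p \<Longrightarrow> coeffs_in B (pCons b p)"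
  "coeffs_in B 0" "coeffs_in B 1"
  by (auto simp: coeffs_in_def Polynomial.coeff_mult coeff_pCons split: nat.split intro: subring_closed)

lemma coeffs_in_power: "coeffs_in B p \<Longrightarrow> coeffs_in B (p ^ k)"
  by (induction k) (auto intro: coeffs_in_closed)

lemma poly_in_ring_adjoin: "coeffs_in B p \<Longrightarrow> poly p a \<in> ring_adjoin B a"
  by (auto simp: ring_adjoin_def)

lemma ring_adjoin_superset: "B \<subseteq> ring_adjoin B a" "a \<in> ring_adjoin B a"
proof -
  show "B \<subseteq> ring_adjoin B a"
  proof
    fix b assume "b \<in> B"
    then show "b \<in> ring_adjoin B a"
      using poly_in_ring_adjoin[of "[:b:]" a] by (auto intro: coeffs_in_closed)
  qed
  show "a \<in> ring_adjoin B a"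
    using poly_in_ring_adjoin[of "[:0, 1:]" a]
    by (auto intro: coeffs_in_closed subring_closed)
qed

lemma unital_subring_ring_adjoin: "unital_subring (ring_adjoin B a)"
  unfolding unital_subring_def
proof (intro conjI ballI)
  show "1 \<in> ring_adjoin B a" using ring_adjoin_superset(1) subring_one by blast
  fix x y assume "x \<in> ring_adjoin B a" "y \<in> ring_adjoin B a"
  then obtain p q where pq: "x = poly p a" "y = poly q a" "coeffs_in B p" "coeffs_in B q"
    by (auto simp: ring_adjoin_def)
  then show "x - y \<in> ring_adjoin B a" "x * y \<in> ring_adjoin B a"
    using poly_in_ring_adjoin[of "p - q" a] poly_in_ring_adjoin[of "p * q" a] coeffs_in_closed
    by auto
qed

end

lemma ring_adjoin_minimal:
  assumes "unital_subring C" "B \<subseteq> C" "a \<in> C"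
  shows "ring_adjoin B a \<subseteq> C"
  using assms(2,3)
  by (auto simp: ring_adjoin_def coeffs_in_def poly_altdef
      intro!: subring_sum[OF assms(1)] subring_mult[OF assms(1)] subring_power[OF assms(1)])

lemma ring_adjoin_mono: "B \<subseteq> C \<Longrightarrow> ring_adjoin B a \<subseteq> ring_adjoin C a"
  by (auto simp: ring_adjoin_def coeffs_in_def)

section \<open>Hilbert's basis theorem\<close>

lemma (in noetherian_cring) sequence_in_ideal_of_predecessors:
  assumes "range f \<subseteq> carrier R"
  shows "\<exists>m. f m \<in> Idl (f ` {..<m :: nat})"
proof -
  define J where "J m = Idl (f ` {..<m})" for m
  have sub: "f ` A \<subseteq> carrier R" for A using assms by auto
  have id: "ideal (J m) R" for m unfolding J_def by (rule genideal_ideal[OF sub])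
  have mono: "J m \<subseteq> J k" if "m \<le> k" for m k
    unfolding J_def using that by (intro subset_Idl_subset sub image_mono) auto
  have "subset.chain {I. ideal I R} (range J)"
    unfolding subset_chain_def
  proof (intro conjI ballI)
    show "range J \<subseteq> {I. ideal I R}" using id by blast
    fix Y Z assume "Y \<in> range J" "Z \<in> range J"
    then obtain m k where mk: "Y = J m" "Z = J k" by blast
    show "Y \<subseteq> Z \<or> Z \<subseteq> Y"
      unfolding mk by (cases "m \<le> k") (use mono[of m k] mono[of k m] in auto)
  qed
  then have "\<Union> (range J) \<in> range J" by (intro ideal_chain_is_trivial) auto
  then obtain m where m: "\<Union> (range J) = J m" by auto
  have "f m \<in> J (Suc m)"
    unfolding J_def using genideal_self[OF sub, of "{..<Suc m}"] by auto
  then show ?thesis using m by (intro exI[of _ m]) (auto simp: J_def)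
qed

text \<open>Hilbert's argument, carried out on polynomials that represent the elements of
  \<open>B[a]\<close>, so \<open>a\<close> may satisfy relations. If \<open>J\<close> is not
  finitely generated, choose \<open>g k\<close> of least degree among the polynomials whose value
  lies in \<open>J\<close> but not in the ideal of the earlier values. Some leading coefficient
  \<open>b m\<close> is generated by the earlier ones, and then \<open>g m\<close> can be lowered in
  degree.\<close>

theorem noetherian_ring_adjoin:
  assumes B: "unital_subring B" and noeth: "noetherian_ring (sub_ring B)"
  shows "noetherian_ring (sub_ring (ring_adjoin B a))"
proof -
  define C where "C = ring_adjoin B a"
  have C: "unital_subring C" unfolding C_def by (rule unital_subring_ring_adjoin[OF B])
  interpret B: noetherian_cring "sub_ring B"
    using cring_sub_ring[OF B] noeth by (simp add: noetherian_cring_def)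
  interpret C: cring "sub_ring C" by (rule cring_sub_ring[OF C])
  have "\<exists>A\<subseteq>J. finite A \<and> J = Idl\<^bsub>sub_ring C\<^esub> A" if J: "ideal J (sub_ring C)" for J
  proof (rule ccontr)
    assume neg: "\<not> ?thesis"
    have JC: "J \<subseteq> C" by (rule ideal_sub_ringD(1)[OF C J])
    have Idl_sub: "Idl\<^bsub>sub_ring C\<^esub> A \<subset> J" if "finite A" "A \<subseteq> J" for A
      using C.genideal_minimal[OF J that(2)] neg that by blast
    define new where "new P p \<longleftrightarrow> coeffs_in B p \<and> poly p a \<in> J - Idl\<^bsub>sub_ring C\<^esub> ((\<lambda>p. poly p a) ` P)"
      for P p
    define pick where "pick P = arg_min Polynomial.degree (new P)" for P
    have pick: "new P (pick P)" "\<And>p. new P p \<Longrightarrow> Polynomial.degree (pick P) \<le> Polynomial.degree p"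
      if P: "finite P" "(\<lambda>p. poly p a) ` P \<subseteq> J" for P
    proof -
      obtain x where x: "x \<in> J" "x \<notin> Idl\<^bsub>sub_ring C\<^esub> ((\<lambda>p. poly p a) ` P)"
        using Idl_sub[OF finite_imageI[OF P(1)] P(2)] by blast
      then obtain p where "coeffs_in B p" "x = poly p a" using JC by (auto simp: C_def ring_adjoin_def)
      then have np: "new P p" using x by (simp add: new_def)
      show "new P (pick P)" unfolding pick_def by (rule arg_min_natI[where P = "new P", OF np])
      show "Polynomial.degree (pick P) \<le> Polynomial.degree q" if "new P q" for q
        unfolding pick_def by (rule arg_min_nat_le[where P = "new P", OF that])
    qed
    define G where "G = rec_nat [] (\<lambda>_ ps. ps @ [pick (set ps)])"
    have G: "G 0 = []" "G (Suc k) = G k @ [pick (set (G k))]" for k by (simp_all add: G_def)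
    define g where "g k = pick (set (G k))" for k
    have setG: "set (G k) = g ` {..<k}" for k
      by (induction k) (auto simp: G g_def lessThan_Suc)
    have gJ: "(\<lambda>p. poly p a) ` set (G k) \<subseteq> J" for k
    proof (induction k)
      case (Suc k)
      then have "new (set (G k)) (g k)" unfolding g_def by (intro pick) auto
      then show ?case using Suc by (auto simp: G g_def new_def)
    qed (simp add: G)
    have g: "new (g ` {..<k}) (g k)" and gmin: "\<And>p. new (g ` {..<k}) p \<Longrightarrow> Polynomial.degree (g k) \<le> Polynomial.degree p" for k
      using pick[of "g ` {..<k}"] gJ[of k] setG[of k] by (auto simp: g_def)
    have mono: "Polynomial.degree (g i) \<le> Polynomial.degree (g k)" if "i \<le> k" for i k
    proof (rule gmin)
      have "(\<lambda>p. poly p a) ` g ` {..<k} \<subseteq> C" using gJ[of k] setG[of k] JC by auto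
      then have "Idl\<^bsub>sub_ring C\<^esub> ((\<lambda>p. poly p a) ` g ` {..<i}) \<subseteq> Idl\<^bsub>sub_ring C\<^esub> ((\<lambda>p. poly p a) ` g ` {..<k})"
        using that by (intro C.subset_Idl_subset image_mono) auto
      then show "new (g ` {..<i}) (g k)" using g[of k] by (auto simp: new_def)
    qed
    define b where "b k = Polynomial.coeff (g k) (Polynomial.degree (g k))" for k
    have "range b \<subseteq> carrier (sub_ring B)"
      using g by (auto simp: b_def new_def coeffs_in_def)
    then obtain m where m: "b m \<in> Idl\<^bsub>sub_ring B\<^esub> (b ` {..<m})"
      using B.sequence_in_ideal_of_predecessors by blast
    define d where "d = Polynomial.degree (g m)"
    define I where "I = Idl\<^bsub>sub_ring C\<^esub> ((\<lambda>p. poly p a) ` g ` {..<m})"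
    have gC: "(\<lambda>p. poly p a) ` g ` {..<m} \<subseteq> C" using gJ[of m] setG[of m] JC by auto
    have I: "ideal I (sub_ring C)" unfolding I_def using gC by (intro C.genideal_ideal) simp
    note I' = ideal_sub_ringD[OF C I]
    \<comment> \<open>\<open>L\<close> collects the coefficients at \<open>d\<close> of polynomials
      of degree at most \<open>d\<close> with value in \<open>I\<close>. It is an ideal containing
      \<open>b i\<close> for \<open>i < m\<close>, after a shift of \<open>g i\<close> by a power of
      the variable. So it contains \<open>b m\<close>, and no linear combination has to be written
      down.\<close>
    define L where "L = {c \<in> B. \<exists>q. coeffs_in B q \<and> Polynomial.degree q \<le> d \<and> Polynomial.coeff q d = c \<and> poly q a \<in> I}"
    have "ideal L (sub_ring B)"
    proof (rule ideal_sub_ringI[OF B])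
      show "L \<subseteq> B" by (auto simp: L_def)
      show "0 \<in> L" using I' subring_zero[OF B] coeffs_in_closed[OF B]
        by (auto simp: L_def intro!: exI[of _ 0])
    next
      fix x y assume "x \<in> L" "y \<in> L"
      then obtain q r where qr: "x \<in> B" "coeffs_in B q" "Polynomial.degree q \<le> d" "Polynomial.coeff q d = x" "poly q a \<in> I"
        "y \<in> B" "coeffs_in B r" "Polynomial.degree r \<le> d" "Polynomial.coeff r d = y" "poly r a \<in> I"
        unfolding L_def by auto
      then show "x + y \<in> L"
        using subring_add[OF B] coeffs_in_closed(1)[OF B, of q r] I'(3) Polynomial.degree_add_le[of q d r]
        by (auto simp: L_def intro!: exI[of _ "q + r"])
    next
      fix r x assume r: "r \<in> B" and "x \<in> L"
      then obtain q where q: "x \<in> B" "coeffs_in B q" "Polynomial.degree q \<le> d" "Polynomial.coeff q d = x" "poly q a \<in> I"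
        unfolding L_def by auto
      have "r \<in> C" using r ring_adjoin_superset[OF B] by (auto simp: C_def)
      then show "r * x \<in> L"
        using r q subring_mult[OF B] coeffs_in_closed(4)[OF B r q(2)] I'(4) order_trans[OF degree_smult_le q(3)]
        by (auto simp: L_def intro!: exI[of _ "Polynomial.smult r q"])
    qed
    moreover have "b ` {..<m} \<subseteq> L"
    proof clarify
      fix i assume i: "i < m"
      let ?q = "Polynomial.monom 1 (d - Polynomial.degree (g i)) * g i"
      have deg: "Polynomial.degree (g i) \<le> d" using mono[of i m] i by (simp add: d_def)
      have 1: "coeffs_in B ?q" using g[of i] coeffs_in_closed[OF B] subring_one[OF B] by (auto simp: new_def)
      have 2: "Polynomial.degree ?q \<le> d"
        using degree_mult_le[of "Polynomial.monom 1 (d - Polynomial.degree (g i))" "g i"]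
          degree_monom_le[of "1::'a" "d - Polynomial.degree (g i)"] deg by linarith
      have 3: "Polynomial.coeff ?q d = b i"
        using deg by (simp add: Polynomial.coeff_monom_mult b_def)
      have "poly (g i) a \<in> I" unfolding I_def using i C.genideal_self[of "(\<lambda>p. poly p a) ` g ` {..<m}"] gC by auto
      moreover have "poly (Polynomial.monom 1 (d - Polynomial.degree (g i))) a \<in> C"
        unfolding C_def by (intro poly_in_ring_adjoin B coeffs_in_closed subring_one)
      ultimately have 4: "poly ?q a \<in> I" using I'(4) by simp
      show "b i \<in> L" using 1 2 3 4 g[of i] by (auto simp: L_def new_def coeffs_in_def b_def intro!: exI[of _ ?q])
    qed
    ultimately have "b m \<in> L" using m B.genideal_minimal by blast
    then obtain q where q: "coeffs_in B q" "Polynomial.degree q \<le> d" "Polynomial.coeff q d = b m" "poly q a \<in> I"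
      by (auto simp: L_def)
    define r where "r = g m - q"
    have "poly r a \<notin> I"
    proof
      assume "poly r a \<in> I"
      then have "poly r a + poly q a \<in> I" using q I'(3) by blast
      then show False using g[of m] by (simp add: r_def new_def I_def)
    qed
    moreover have "poly r a \<in> J"
    proof -
      have "I \<subseteq> J" unfolding I_def using gJ[of m] setG[of m] by (intro C.genideal_minimal J) auto
      then show ?thesis using g[of m] q(4) ideal_sub_ringD(6)[OF C J] by (auto simp: r_def new_def)
    qed
    moreover have "coeffs_in B r" using g[of m] q(1) coeffs_in_closed(2)[OF B] by (auto simp: r_def new_def)
    ultimately have "new (g ` {..<m}) r" by (simp add: new_def I_def)
    \<comment> \<open>Minimality forces \<open>r\<close> to have degree exactly \<open>d\<close>,
      but its coefficient there vanishes; hence \<open>r = 0\<close>, whose value does lie in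
      \<open>I\<close>.\<close>
    then have "d \<le> Polynomial.degree r" using gmin by (simp add: d_def)
    moreover have "Polynomial.degree r \<le> d" unfolding r_def using q(2) by (intro degree_diff_le) (simp_all add: d_def)
    moreover have "Polynomial.coeff r d = 0" using q(3) by (simp add: r_def b_def d_def)
    ultimately have "r = 0" using leading_coeff_0_iff[of r] by auto
    then show False using \<open>poly r a \<notin> I\<close> I'(2) by simp
  qed
  then show ?thesis unfolding C_def[symmetric]
    using ideal_sub_ringD(1)[OF C] by (intro C.noetherian_ringI) (metis dual_order.trans sub_ring_simps(1))
qed

section \<open>Zariski's lemma\<close>

text \<open>All statements are about the domain \<open>S / N\<close>, but phrased in \<open>S\<close>.\<close>

locale subring_prime =
  fixes S N :: "'a::comm_ring_1 set"
  assumes S: "unital_subring S" and N_ideal: "ideal N (sub_ring S)" and one_notin: "1 \<notin> N"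
    and N_prime: "\<And>a b. a \<in> S \<Longrightarrow> b \<in> S \<Longrightarrow> a * b \<in> N \<Longrightarrow> a \<in> N \<or> b \<in> N"
begin

lemmas N_closed = ideal_sub_ringD[OF S N_ideal]

lemma N_mult_right: "a \<in> N \<Longrightarrow> r \<in> S \<Longrightarrow> a * r \<in> N"
  using N_closed(4)[of r a] by (simp add: mult.commute)

lemma N_sum: "(\<And>i. i \<in> A \<Longrightarrow> f i \<in> N) \<Longrightarrow> sum f A \<in> N"
  by (induction A rule: infinite_finite_induct) (auto intro: N_closed)

lemma notin_N_mult: "a \<in> S - N \<Longrightarrow> b \<in> S - N \<Longrightarrow> a * b \<in> S - N"
  using N_prime subring_mult[OF S] by blast

lemma notin_N_one: "1 \<in> S - N"
  using one_notin subring_one[OF S] by blast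

lemma notin_N_power: "a \<in> S - N \<Longrightarrow> a ^ k \<in> S - N"
  using notin_N_one notin_N_mult[of a] by (induction k) auto

lemma N_cong_mem: "a - b \<in> N \<Longrightarrow> a \<in> N \<longleftrightarrow> b \<in> N"
  using N_closed(3)[of "a - b" b] N_closed(6)[of a "a - b"] by auto

text \<open>The relation is read over \<open>S / N\<close>, so nontriviality means a coefficient
  outside \<open>N\<close>.\<close>

definition algebraic_mod :: "'a set \<Rightarrow> 'a \<Rightarrow> bool" where
  "algebraic_mod B a \<longleftrightarrow> (\<exists>p. coeffs_in B p \<and> (\<exists>i. Polynomial.coeff p i \<notin> N) \<and> poly p a \<in> N)"

text \<open>The fraction field of \<open>B / (B \<inter> N)\<close> is generated over \<open>B / (B \<inter> N)\<close> by one inverse \<open>1 / c\<close>.\<close>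

definition G_domain :: "'a set \<Rightarrow> bool" where
  "G_domain B \<longleftrightarrow> (\<exists>c\<in>B - N. \<forall>s\<in>B - N. \<exists>k. \<exists>h\<in>B. s * h - c ^ k \<in> N)"

context
  fixes B :: "'a set" and a :: 'a
  assumes B: "unital_subring B" and BS: "B \<subseteq> S" and aS: "a \<in> S"
begin

lemma adjoin_S: "ring_adjoin B a \<subseteq> S"
  by (rule ring_adjoin_minimal[OF S BS aS])

lemma poly_S: "coeffs_in B p \<Longrightarrow> poly p a \<in> S"
  using adjoin_S poly_in_ring_adjoin[OF B] by blast

lemma coeff_B: "coeffs_in B p \<Longrightarrow> Polynomial.coeff p i \<in> B"
  by (simp add: coeffs_in_def)

lemma coeff_S: "coeffs_in B p \<Longrightarrow> Polynomial.coeff p i \<in> S"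
  using coeff_B BS by blast

lemma poly_in_N: "(\<And>i. Polynomial.coeff p i \<in> N) \<Longrightarrow> poly p a \<in> N"
  unfolding poly_altdef using subring_power[OF S aS] by (intro N_sum N_mult_right)

text \<open>Leading terms with coefficient in \<open>N\<close> are dropped until the formal degree
  is the degree over \<open>S / N\<close>; the value changes only by elements of
  \<open>N\<close>.\<close>

lemma truncate:
  assumes p: "coeffs_in B p" and i: "Polynomial.coeff p i \<notin> N"
  shows "\<exists>q. coeffs_in B q \<and> Polynomial.degree q \<le> Polynomial.degree p \<and>
    Polynomial.coeff q (Polynomial.degree q) \<notin> N \<and> poly p a - poly q a \<in> N"
  using assms
proof (induction "Polynomial.degree p" arbitrary: p i rule: less_induct)
  case less
  show ?case
  proof (cases "Polynomial.coeff p (Polynomial.degree p) \<in> N")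
    case False
    then show ?thesis using less.prems N_closed(2) by (intro exI[of _ p]) auto
  next
    case True
    define d where "d = Polynomial.degree p"
    define c where "c = Polynomial.coeff p d"
    have cN: "c \<in> N" using True by (simp add: c_def d_def)
    have id: "i < d"
      using less.prems True N_closed(2) by (metis c_def cN d_def coeff_eq_0 linorder_neqE_nat)
    define q where "q = p - Polynomial.monom c d"
    have q: "coeffs_in B q" unfolding q_def c_def
      by (intro coeffs_in_closed(2,5)[OF B] coeff_B less.prems)
    have "Polynomial.degree q \<le> d" unfolding q_def by (intro degree_diff_le) (simp_all add: d_def degree_monom_le)
    moreover have "Polynomial.coeff q d = 0" by (simp add: q_def c_def)
    ultimately have dq: "Polynomial.degree q < d"
      using id by (metis bot_nat_0.not_eq_extremum degree_0 gr_implies_not0 leading_coeff_0_iff le_neq_implies_less)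
    have "Polynomial.coeff q i \<notin> N" using less.prems id by (simp add: q_def)
    then obtain r where r: "coeffs_in B r" "Polynomial.degree r \<le> Polynomial.degree q"
      "Polynomial.coeff r (Polynomial.degree r) \<notin> N" "poly q a - poly r a \<in> N"
      using less.hyps[of q i] dq q by (auto simp: d_def)
    have "poly p a - poly r a = c * a ^ d + (poly q a - poly r a)"
      by (simp add: q_def poly_monom)
    also have "\<dots> \<in> N" using r(4) cN subring_power[OF S aS] by (intro N_closed(3) N_mult_right)
    finally show ?thesis using r dq by (intro exI[of _ r]) (auto simp: d_def)
  qed
qed

lemma coeff_mult_top_notin:
  assumes p: "coeffs_in B p" "Polynomial.coeff p m \<notin> N" "\<And>i. i > m \<Longrightarrow> Polynomial.coeff p i \<in> N"
    and q: "coeffs_in B q" "Polynomial.coeff q n \<notin> N" "\<And>i. i > n \<Longrightarrow> Polynomial.coeff q i \<in> N"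
  shows "Polynomial.coeff (p * q) (m + n) \<notin> N"
proof -
  let ?t = "\<lambda>i. Polynomial.coeff p i * Polynomial.coeff q (m + n - i)"
  have "Polynomial.coeff (p * q) (m + n) = ?t m + (\<Sum>i\<in>{..m + n} - {m}. ?t i)"
    unfolding Polynomial.coeff_mult by (subst sum.remove[of _ m]) auto
  moreover have "(\<Sum>i\<in>{..m + n} - {m}. ?t i) \<in> N"
  proof (rule N_sum)
    fix i assume "i \<in> {..m + n} - {m}"
    then consider "i > m" | "m + n - i > n" by fastforce
    then show "?t i \<in> N"
      using p q coeff_S N_closed(4) N_mult_right by cases auto
  qed
  moreover have "?t m \<notin> N" using p q N_prime coeff_S by fastforce
  ultimately show ?thesis using N_cong_mem[of "Polynomial.coeff (p * q) (m + n)" "?t m"] by simp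
qed

lemma exists_top:
  assumes "Polynomial.coeff p i \<notin> N"
  shows "\<exists>m. Polynomial.coeff p m \<notin> N \<and> (\<forall>i>m. Polynomial.coeff p i \<in> N)"
proof -
  let ?A = "{i. Polynomial.coeff p i \<notin> N}"
  have "?A \<subseteq> {..Polynomial.degree p}" using N_closed(2) by (auto intro!: leI simp: coeff_eq_0 dest: coeff_eq_0)
  then have "finite ?A" by (rule finite_subset) simp
  note fin = this
  have "Max ?A \<in> ?A" using assms by (intro Max_in[OF fin]) auto
  moreover have "Polynomial.coeff p i \<in> N" if "i > Max ?A" for i
    using Max_ge[OF fin, of i] that by auto
  ultimately show ?thesis by blast
qed

text \<open>Suppose \<open>a\<close> is transcendental modulo \<open>N\<close> and let
  \<open>c = q(a)\<close>. The value of \<open>1 + X q\<close> divides a power of \<open>c\<close>,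
  so \<open>1 + X q\<close> divides \<open>q^k\<close> modulo \<open>N\<close>. But
  \<open>(X q)^k\<close> is congruent to \<open>(-1)^k\<close> modulo \<open>1 + X q\<close>, so
  \<open>1 + X q\<close> would be a unit of positive degree over a domain.\<close>

lemma algebraic_if_G_domain:
  assumes G: "G_domain (ring_adjoin B a)"
  shows "algebraic_mod B a"
proof (rule ccontr)
  assume nalg: "\<not> algebraic_mod B a"
  have zero: "Polynomial.coeff p i \<in> N" if "coeffs_in B p" "poly p a \<in> N" for p i
    using nalg that by (auto simp: algebraic_mod_def)
  obtain c where c: "c \<in> ring_adjoin B a - N"
    and cG: "\<And>s. s \<in> ring_adjoin B a - N \<Longrightarrow> \<exists>k. \<exists>h\<in>ring_adjoin B a. s * h - c ^ k \<in> N"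
    using G by (auto simp: G_domain_def)
  obtain q where q: "coeffs_in B q" "c = poly q a" using c by (auto simp: ring_adjoin_def)
  \<comment> \<open>The constant coefficient of \<open>1 + x\<close> is 1, so its value at the
    transcendental \<open>a\<close> is outside \<open>N\<close>.\<close>
  define x where "x = pCons 0 q"
  have x: "coeffs_in B x" unfolding x_def by (intro coeffs_in_closed(6)[OF B] subring_zero[OF B] q(1))
  have x1: "coeffs_in B (1 + x)" by (intro coeffs_in_closed(1,8)[OF B] x)
  have "poly (1 + x) a \<notin> N" using zero[OF x1, of 0] one_notin by (auto simp: x_def)
  then obtain k h where h: "h \<in> ring_adjoin B a" "poly (1 + x) a * h - c ^ k \<in> N"
    using cG[of "poly (1 + x) a"] poly_in_ring_adjoin[OF B x1] by blast
  obtain r where r: "coeffs_in B r" "h = poly r a" using h by (auto simp: ring_adjoin_def)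
  have cong: "Polynomial.coeff ((1 + x) * r - q ^ k) i \<in> N" for i
  proof (rule zero)
    show "coeffs_in B ((1 + x) * r - q ^ k)"
      by (intro coeffs_in_closed(2,3)[OF B] coeffs_in_power[OF B] x1 r(1) q(1))
    show "poly ((1 + x) * r - q ^ k) a \<in> N" using h(2) r q by simp
  qed
  have "\<exists>u. coeffs_in B u \<and> x ^ k = (-1) ^ k + (1 + x) * u"
  proof (induction k)
    case 0
    then show ?case using coeffs_in_closed(7)[OF B] by (intro exI[of _ 0]) simp
  next
    case (Suc k)
    then obtain u where u: "coeffs_in B u" "x ^ k = (-1) ^ k + (1 + x) * u" by blast
    have m1: "coeffs_in B ((-1) ^ k)"
      using coeffs_in_closed(2)[OF B, of 0 1] coeffs_in_closed(7,8)[OF B] coeffs_in_power[OF B, of "-1" k] by simp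
    have "x ^ Suc k = (-1) ^ Suc k + (1 + x) * ((-1) ^ k + x * u)"
      by (simp add: u(2)) (simp add: algebra_simps)
    moreover have "coeffs_in B ((-1) ^ k + x * u)"
      by (intro coeffs_in_closed(1,3)[OF B] m1 x u(1))
    ultimately show ?case by blast
  qed
  then obtain u where u: "coeffs_in B u" "x ^ k = (-1) ^ k + (1 + x) * u" by blast
  \<comment> \<open>Multiplying the congruence by \<open>X^k\<close> and replacing
    \<open>x^k\<close> by \<open>(-1)^k + (1 + x) u\<close> shows that \<open>g\<close> inverts
    \<open>1 + x\<close> up to sign modulo \<open>N\<close>.\<close>
  define g where "g = Polynomial.monom 1 k * r - u"
  have g: "coeffs_in B g" unfolding g_def
    by (intro coeffs_in_closed(2,3,5)[OF B] r(1) u(1) subring_one[OF B])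
  have "(1 + x) * g - (-1) ^ k = Polynomial.monom 1 k * ((1 + x) * r - q ^ k)"
  proof -
    have "Polynomial.monom 1 k * q ^ k = x ^ k"
      by (simp add: x_def monom_altdef flip: power_mult_distrib)
    then show ?thesis using u(2) by (simp add: g_def algebra_simps)
  qed
  then have cong': "Polynomial.coeff ((1 + x) * g - (-1) ^ k) i \<in> N" for i
    using cong N_closed(2) by (simp add: Polynomial.coeff_monom_mult)
  have m1: "(-1 :: 'a poly) ^ k = [:(-1) ^ k:]" by (induction k) auto
  have unit: "(-1 :: 'a) ^ k \<notin> N"
    using notin_N_power[of "-1" k] N_closed(5)[of "-1"] one_notin subring_uminus[OF S subring_one[OF S]] by auto
  obtain i where i: "Polynomial.coeff g i \<notin> N"
  proof (rule ccontr)
    assume "\<not> thesis"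
    then have "Polynomial.coeff g i \<in> N" for i using that by blast
    then have "Polynomial.coeff ((1 + x) * g) 0 \<in> N"
      unfolding Polynomial.coeff_mult by (intro N_sum N_closed(4) coeff_S[OF x1])
    then show False using cong'[of 0] unit N_cong_mem by (auto simp: m1)
  qed
  obtain n where n: "Polynomial.coeff g n \<notin> N" "\<And>i. i > n \<Longrightarrow> Polynomial.coeff g i \<in> N"
    using exists_top[OF i] by blast
  \<comment> \<open>As \<open>c\<close> is outside \<open>N\<close>, so is some coefficient of
    \<open>q\<close>, and \<open>1 + x\<close> has one in positive degree. The product with
    \<open>g\<close> then has a top coefficient outside \<open>N\<close> in positive degree, unlike
    the constant \<open>(-1)^k\<close>.\<close>
  obtain j where "Polynomial.coeff q j \<notin> N" using poly_in_N[of q] c q by blast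
  then have "Polynomial.coeff (1 + x) (Suc j) \<notin> N" by (simp add: x_def)
  then obtain m where m: "Polynomial.coeff (1 + x) m \<notin> N" "\<And>i. i > m \<Longrightarrow> Polynomial.coeff (1 + x) i \<in> N"
    and "m > 0"
    using exists_top[of "1 + x"] \<open>Polynomial.coeff (1 + x) (Suc j) \<notin> N\<close> by (metis gr0I zero_less_Suc)
  have "Polynomial.coeff ((1 + x) * g) (m + n) \<notin> N"
    by (rule coeff_mult_top_notin[OF x1 m g n])
  moreover have "Polynomial.coeff ((-1) ^ k :: 'a poly) (m + n) = 0"
    using \<open>m > 0\<close> by (simp add: m1 coeff_pCons split: nat.split)
  ultimately show False using cong'[of "m + n"] by simp
qed

text \<open>Long division, where each step multiplies by the leading coefficient \<open>b\<close>
  instead of dividing by it. The bound on the degree of the quotient \<open>t\<close> is needed when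
  a minimal relation is divided by a polynomial of smaller degree.\<close>

lemma pseudo_division:
  assumes p: "coeffs_in B p" and q: "coeffs_in B q"
    and e: "e = Polynomial.degree p" "e > 0" and b: "b = Polynomial.coeff p e"
  shows "\<exists>l t r. coeffs_in B t \<and> coeffs_in B r \<and> Polynomial.degree r < e \<and>
    Polynomial.degree t \<le> Polynomial.degree q - e \<and> Polynomial.smult (b ^ l) q = t * p + r"
  using q
proof (induction "Polynomial.degree q" arbitrary: q rule: less_induct)
  case less
  show ?case
  proof (cases "Polynomial.degree q < e")
    case True
    then show ?thesis using less.prems coeffs_in_closed(7)[OF B]
      by (intro exI[of _ 0] exI[of _ "0 :: 'a poly"] exI[of _ q]) simp
  next
    case False
    define d where "d = Polynomial.degree q"
    define c where "c = Polynomial.coeff q d"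
    have bB: "b \<in> B" "c \<in> B" using p less.prems by (auto simp: b c_def coeff_B)
    define q' where "q' = Polynomial.smult b q - Polynomial.monom c (d - e) * p"
    have q': "coeffs_in B q'" unfolding q'_def
      by (intro coeffs_in_closed(2,3,4,5)[OF B] bB p less.prems)
    have "Polynomial.degree q' \<le> d" unfolding q'_def
    proof (rule degree_diff_le)
      show "Polynomial.degree (Polynomial.smult b q) \<le> d" by (simp add: d_def degree_smult_le)
      show "Polynomial.degree (Polynomial.monom c (d - e) * p) \<le> d"
        using degree_mult_le[of "Polynomial.monom c (d - e)" p] degree_monom_le[of c "d - e"] False e
        by (simp add: d_def)
    qed
    moreover have "Polynomial.coeff q' d = 0"
    proof -
      have "Polynomial.coeff (Polynomial.monom c (d - e) * p) d = c * b"
        using False by (simp add: Polynomial.coeff_monom_mult b d_def)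
      then show ?thesis by (simp add: q'_def c_def mult.commute[of b])
    qed
    ultimately have dq: "Polynomial.degree q' < d"
      using False e by (metis d_def degree_0 gr_zeroI leading_coeff_0_iff le_neq_implies_less not_gr_zero)
    then obtain l t r where *: "coeffs_in B t" "coeffs_in B r" "Polynomial.degree r < e"
      "Polynomial.degree t \<le> Polynomial.degree q' - e" "Polynomial.smult (b ^ l) q' = t * p + r"
      using less.hyps[of q'] q' by (auto simp: d_def)
    define t' where "t' = t + Polynomial.monom (b ^ l * c) (d - e)"
    have "coeffs_in B t'" unfolding t'_def
      by (intro coeffs_in_closed(1,5)[OF B] *(1) subring_mult[OF B] subring_power[OF B] bB)
    moreover have "Polynomial.degree t' \<le> d - e" unfolding t'_def
      using *(4) dq by (intro Polynomial.degree_add_le degree_monom_le) auto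
    moreover have "Polynomial.smult (b ^ Suc l) q = t' * p + r"
    proof -
      have "Polynomial.smult (b ^ Suc l) q = Polynomial.smult (b ^ l) q' +
          Polynomial.smult (b ^ l) (Polynomial.monom c (d - e) * p)"
        by (simp add: q'_def smult_diff_right smult_monom mult.commute)
      also have "\<dots> = t' * p + r"
      proof -
        have "Polynomial.smult (b ^ l) (Polynomial.monom c (d - e) * p) = Polynomial.monom (b ^ l * c) (d - e) * p"
          by (metis mult_smult_left smult_monom)
        then show ?thesis by (simp add: *(5) t'_def distrib_right)
      qed
      finally show ?thesis .
    qed
    ultimately show ?thesis using *(2,3) unfolding d_def by blast
  qed
qed

text \<open>Let \<open>p\<close> be a relation for \<open>a\<close> of least degree
  \<open>n\<close>, with leading coefficient \<open>b\<close>. Up to powers of \<open>b\<close>,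
  every element of \<open>B[a]\<close> has a representing polynomial of degree below
  \<open>n\<close>, and such representations are unique modulo \<open>N\<close>. Some multiple of
  \<open>c\<close> is congruent to an element \<open>b'\<close> of \<open>B\<close>, and
  \<open>b b'\<close> is the required element for \<open>B\<close>.\<close>

lemma G_domain_if_adjoin:
  assumes G: "G_domain (ring_adjoin B a)"
  shows "G_domain B"
proof -
  note cl = coeffs_in_closed[OF B]
  obtain c where c: "c \<in> ring_adjoin B a" "c \<notin> N"
    and cG: "\<And>s. s \<in> ring_adjoin B a - N \<Longrightarrow> \<exists>k. \<exists>h\<in>ring_adjoin B a. s * h - c ^ k \<in> N"
    using G by (auto simp: G_domain_def)
  have cS: "c \<in> S" using c adjoin_S by blast
  define rel where "rel p \<longleftrightarrow> coeffs_in B p \<and> Polynomial.coeff p (Polynomial.degree p) \<notin> N \<and> poly p a \<in> N" for p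
  have "\<exists>p. rel p"
  proof -
    obtain p i where p: "coeffs_in B p" "Polynomial.coeff p i \<notin> N" "poly p a \<in> N"
      using algebraic_if_G_domain[OF G] by (auto simp: algebraic_mod_def)
    then show ?thesis using truncate[OF p(1,2)] N_cong_mem unfolding rel_def by blast
  qed
  then obtain p0 where "rel p0" by blast
  define p where "p = arg_min Polynomial.degree rel"
  have p: "rel p" and pmin: "\<And>q. rel q \<Longrightarrow> Polynomial.degree p \<le> Polynomial.degree q"
    unfolding p_def using arg_min_natI[where P = rel, OF \<open>rel p0\<close>] arg_min_nat_le[where P = rel] by blast+
  define n where "n = Polynomial.degree p"
  define b where "b = Polynomial.coeff p n"
  have pB: "coeffs_in B p" and pN: "poly p a \<in> N" and bN: "b \<notin> N" "b \<in> B" "b \<in> S"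
    using p coeff_B coeff_S by (auto simp: rel_def b_def n_def)
  have n: "n > 0"
  proof (rule gr0I)
    assume "n = 0"
    then obtain u where u: "p = [:u:]" unfolding n_def by (rule degree_eq_zeroE)
    then have "u = b" using \<open>n = 0\<close> by (simp add: b_def)
    then show False using pN bN(1) u by simp
  qed
  \<comment> \<open>By minimality of \<open>n\<close>, a polynomial of smaller degree with value in
    \<open>N\<close> vanishes modulo \<open>N\<close>; this is the uniqueness that later allows
    comparing coefficients.\<close>
  have small: "Polynomial.coeff q i \<in> N"
    if asm: "coeffs_in B q" "Polynomial.degree q < n" "poly q a \<in> N" for q i
  proof (rule ccontr)
    assume i: "Polynomial.coeff q i \<notin> N"
    then obtain r where "coeffs_in B r" "Polynomial.degree r \<le> Polynomial.degree q"
      "Polynomial.coeff r (Polynomial.degree r) \<notin> N" "poly q a - poly r a \<in> N"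
      using truncate[OF asm(1) i] by blast
    moreover from this(4) have "poly r a \<in> N" using N_cong_mem asm(3) by blast
    ultimately show False using pmin[of r] asm(2) by (simp add: rel_def n_def)
  qed
  have reduce: "\<exists>l r. coeffs_in B r \<and> Polynomial.degree r < n \<and> b ^ l * poly q a - poly r a \<in> N"
    if asm: "coeffs_in B q" for q
  proof -
    obtain l t r where "coeffs_in B t" "coeffs_in B r" "Polynomial.degree r < n"
      "Polynomial.smult (b ^ l) q = t * p + r"
      using pseudo_division[OF pB asm n_def n b_def] by blast
    moreover from this(4) have "b ^ l * poly q a - poly r a = poly t a * poly p a"
      by (metis add_diff_cancel_right' poly_add poly_mult poly_smult)
    ultimately show ?thesis using N_closed(4)[OF poly_S pN] by metis
  qed
  \<comment> \<open>These polynomials represent nonzero multiples of \<open>c\<close> modulo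
    \<open>N\<close>; a constant one shows that \<open>c\<close> divides a nonzero element of
    \<open>B\<close>. One of least degree turns out to be constant.\<close>
  define inverts where "inverts r \<longleftrightarrow> coeffs_in B r \<and> Polynomial.coeff r (Polynomial.degree r) \<notin> N \<and> poly r a \<notin> N \<and>
    (\<exists>h\<in>ring_adjoin B a. c * h - poly r a \<in> N)" for r
  have inverts_reduce: "\<exists>r'. inverts r' \<and> Polynomial.degree r' \<le> Polynomial.degree r"
    if r: "coeffs_in B r" "poly r a \<notin> N" "h \<in> ring_adjoin B a" "c * h - poly r a \<in> N" for r h
  proof -
    obtain i where "Polynomial.coeff r i \<notin> N" using poly_in_N r(2) by blast
    then obtain r' where r': "coeffs_in B r'" "Polynomial.degree r' \<le> Polynomial.degree r"
      "Polynomial.coeff r' (Polynomial.degree r') \<notin> N" "poly r a - poly r' a \<in> N"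
      using truncate r(1) by blast
    have "c * h - poly r' a \<in> N" using N_closed(3)[OF r(4) r'(4)] by simp
    then show ?thesis using r r' N_cong_mem unfolding inverts_def by blast
  qed
  have "\<exists>r. inverts r"
  proof -
    obtain q where "coeffs_in B q" "c = poly q a" using c by (auto simp: ring_adjoin_def)
    then show ?thesis
      using inverts_reduce[of q 1] c N_closed(2) subring_one[OF unital_subring_ring_adjoin[OF B]] by auto
  qed
  then obtain r0 where "inverts r0" by blast
  define r where "r = arg_min Polynomial.degree inverts"
  have r: "inverts r" and rmin: "\<And>q. inverts q \<Longrightarrow> Polynomial.degree r \<le> Polynomial.degree q"
    unfolding r_def using arg_min_natI[where P = inverts, OF \<open>inverts r0\<close>] arg_min_nat_le[where P = inverts] by blast+
  obtain h where h: "h \<in> ring_adjoin B a" "c * h - poly r a \<in> N" using r by (auto simp: inverts_def)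
  have hS: "h \<in> S" using h adjoin_S by blast
  have rB: "coeffs_in B r" and rN: "poly r a \<notin> N" using r by (auto simp: inverts_def)
  define e where "e = Polynomial.degree r"
  define b' where "b' = Polynomial.coeff r e"
  have b': "b' \<notin> N" "b' \<in> B" "b' \<in> S" using r coeff_B[OF rB] coeff_S[OF rB] by (auto simp: inverts_def b'_def e_def)
  have "e < n"
  proof -
    obtain l r' where r': "coeffs_in B r'" "Polynomial.degree r' < n" "b ^ l * poly r a - poly r' a \<in> N"
      using reduce[OF rB] by blast
    have bl: "b ^ l \<in> ring_adjoin B a" "b ^ l \<in> S - N"
      using ring_adjoin_superset[OF B] subring_power[OF B bN(2)] notin_N_power bN by auto
    have "poly r' a \<notin> N"
      using N_cong_mem[OF r'(3)] notin_N_mult[OF bl(2)] poly_S[OF rB] rN by auto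
    moreover have "c * (b ^ l * h) - poly r' a = b ^ l * (c * h - poly r a) + (b ^ l * poly r a - poly r' a)"
      by (simp add: algebra_simps)
    then have "c * (b ^ l * h) - poly r' a \<in> N"
      using N_closed(3)[OF N_closed(4)[OF _ h(2), of "b ^ l"] r'(3)] bl(2) by (simp only: DiffD1)
    moreover have "b ^ l * h \<in> ring_adjoin B a"
      using bl h subring_mult[OF unital_subring_ring_adjoin[OF B]] by blast
    ultimately show ?thesis using inverts_reduce[OF r'(1)] rmin r'(2) unfolding e_def by fastforce
  qed
  \<comment> \<open>Pseudo-divide \<open>p\<close> by \<open>r\<close>. A remainder with value
    outside \<open>N\<close> would be a multiple of \<open>c\<close> of smaller degree. Otherwise
    \<open>t(a) r(a)\<close> is in \<open>N\<close>, so \<open>t\<close>, of degree below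
    \<open>n\<close>, vanishes modulo \<open>N\<close>, and then so does a power of
    \<open>b'\<close> times the leading coefficient of \<open>p\<close>.\<close>
  have "e = 0"
  proof (rule ccontr)
    assume "e \<noteq> 0"
    then have "e > 0" by simp
    obtain l t v where t: "coeffs_in B t" "coeffs_in B v" "Polynomial.degree v < e"
      "Polynomial.degree t \<le> n - e" "Polynomial.smult (b' ^ l) p = t * r + v"
      using pseudo_division[OF rB pB e_def \<open>e > 0\<close> b'_def] unfolding n_def by blast
    have eq: "b' ^ l * poly p a = poly t a * poly r a + poly v a"
      using arg_cong[OF t(5), of "\<lambda>p. poly p a"] by simp
    have plN: "b' ^ l * poly p a \<in> N" using pN b' subring_power[OF S] N_closed(4) by blast
    have vN: "poly v a \<in> N"
    proof (rule ccontr)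
      assume v: "poly v a \<notin> N"
      have "c * (- poly t a * h) - poly v a = - (poly t a * (c * h - poly r a)) - b' ^ l * poly p a"
        unfolding eq by (simp add: algebra_simps)
      also have "\<dots> \<in> N"
        using N_closed(6)[OF N_closed(5)[OF N_closed(4)[OF poly_S[OF t(1)] h(2)]] plN] .
      finally have "c * (- poly t a * h) - poly v a \<in> N" .
      moreover have "- poly t a * h \<in> ring_adjoin B a"
        using subring_mult[OF unital_subring_ring_adjoin[OF B]] subring_uminus[OF unital_subring_ring_adjoin[OF B]]
          poly_in_ring_adjoin[OF B t(1)] h(1) by blast
      ultimately show False using inverts_reduce[OF t(2) v] rmin t(3) unfolding e_def by fastforce
    qed
    have "poly t a * poly r a = b' ^ l * poly p a - poly v a" using eq by simp
    then have "poly t a * poly r a \<in> N" using N_closed(6)[OF plN vN] by simp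
    then have "poly t a \<in> N" using N_prime[OF poly_S[OF t(1)] poly_S[OF rB]] rN by blast
    moreover have "Polynomial.degree t < n" using t(4) \<open>e > 0\<close> \<open>e < n\<close> by linarith
    ultimately have tN: "Polynomial.coeff t i \<in> N" for i using small[OF t(1)] by blast
    have "Polynomial.coeff (t * r) n \<in> N"
      unfolding Polynomial.coeff_mult using tN coeff_S[OF rB] by (intro N_sum N_mult_right)
    moreover have "Polynomial.coeff v n = 0" using t(3) \<open>e < n\<close> by (intro coeff_eq_0) simp
    ultimately have "b' ^ l * b \<in> N"
      using arg_cong[OF t(5), of "\<lambda>p. Polynomial.coeff p n"] by (simp add: b_def)
    then show False using notin_N_mult[of "b' ^ l" b] notin_N_power[of b' l] b' bN by auto
  qed
  then obtain u where u: "r = [:u:]" unfolding e_def by (rule degree_eq_zeroE)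
  then have "u = b'" using \<open>e = 0\<close> by (simp add: b'_def)
  then have ch: "c * h - b' \<in> N" using h(2) u by simp
  have pow_cong: "(c * h) ^ k - b' ^ k \<in> N" for k
  proof (induction k)
    case (Suc k)
    have "(c * h) ^ Suc k - b' ^ Suc k = (c * h) * ((c * h) ^ k - b' ^ k) + (c * h - b') * b' ^ k"
      by (simp add: algebra_simps)
    moreover have "\<dots> \<in> N"
      by (rule N_closed(3)[OF N_closed(4)[OF subring_mult[OF S cS hS] Suc] N_mult_right[OF ch subring_power[OF S b'(3)]]])
    ultimately show ?case by (simp only:)
  qed (simp add: N_closed(2))
  \<comment> \<open>Modulo \<open>N\<close>, \<open>s y = c^k\<close> yields
    \<open>s (y h^k) = b'^k\<close>. After multiplication by \<open>b^l\<close> the cofactor of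
    \<open>s\<close> has a representative \<open>v\<close> of degree below \<open>n\<close>, and
    comparing constant coefficients brings the equation down to \<open>B\<close>.\<close>
  have "\<exists>m. \<exists>g\<in>B. s * g - (b * b') ^ m \<in> N" if s: "s \<in> B - N" for s
  proof -
    have "s \<in> ring_adjoin B a - N" using s ring_adjoin_superset[OF B] by blast
    then obtain k y where y: "y \<in> ring_adjoin B a" "s * y - c ^ k \<in> N" using cG by blast
    have sS: "s \<in> S" and yS: "y \<in> S" using s BS y adjoin_S by auto
    have "y * h ^ k \<in> ring_adjoin B a"
      using y h subring_mult[OF unital_subring_ring_adjoin[OF B]] subring_power[OF unital_subring_ring_adjoin[OF B]] by blast
    then obtain q where q: "coeffs_in B q" "y * h ^ k = poly q a" by (auto simp: ring_adjoin_def)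
    then obtain l v where v: "coeffs_in B v" "Polynomial.degree v < n" "b ^ l * poly q a - poly v a \<in> N"
      using reduce by blast
    define w where "w = Polynomial.smult s v - [:b ^ l * b' ^ k:]"
    have w: "coeffs_in B w" unfolding w_def
      by (intro cl(2,4,6,7) subring_mult[OF B] subring_power[OF B] v(1) bN(2) b'(2) DiffD1[OF s])
    have "Polynomial.degree w < n" unfolding w_def
      using v(2) n degree_smult_le[of s v] by (intro degree_diff_less) auto
    moreover have "poly w a \<in> N"
    proof -
      have "poly w a = b ^ l * ((c * h) ^ k - b' ^ k) + (b ^ l * h ^ k) * (s * y - c ^ k) - s * (b ^ l * poly q a - poly v a)"
        by (simp add: w_def q(2)[symmetric] algebra_simps power_mult_distrib)
      also have "\<dots> \<in> N"
        using N_closed(6)[OF N_closed(3)[OF N_closed(4)[OF subring_power[OF S bN(3)] pow_cong]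
            N_closed(4)[OF subring_mult[OF S subring_power[OF S bN(3)] subring_power[OF S hS]] y(2)]]
            N_closed(4)[OF sS v(3)]] .
      finally show ?thesis .
    qed
    ultimately have "Polynomial.coeff w 0 \<in> N" using small[OF w] by blast
    then have *: "s * Polynomial.coeff v 0 - b ^ l * b' ^ k \<in> N" by (simp add: w_def)
    \<comment> \<open>The factor \<open>b^k b'^l\<close> evens out the exponents, so that a power of
      \<open>b b'\<close> appears.\<close>
    have "s * (Polynomial.coeff v 0 * (b ^ k * b' ^ l)) - (b * b') ^ (k + l) =
        (b ^ k * b' ^ l) * (s * Polynomial.coeff v 0 - b ^ l * b' ^ k)"
      by (simp add: algebra_simps power_add power_mult_distrib)
    also have "\<dots> \<in> N"
      using N_closed(4)[OF subring_mult[OF S subring_power[OF S bN(3)] subring_power[OF S b'(3)]] *] .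
    finally have "s * (Polynomial.coeff v 0 * (b ^ k * b' ^ l)) - (b * b') ^ (k + l) \<in> N" .
    moreover have "Polynomial.coeff v 0 * (b ^ k * b' ^ l) \<in> B"
      by (intro subring_mult[OF B] subring_power[OF B] coeff_B v(1) bN(2) b'(2))
    ultimately show ?thesis by blast
  qed
  moreover have "b * b' \<in> B - N" using notin_N_mult[of b b'] bN b' subring_mult[OF B, of b b'] by simp
  ultimately show ?thesis unfolding G_domain_def by blast
qed

end

lemma G_domain_foldl:
  assumes "unital_subring B" "B \<subseteq> S" "set as \<subseteq> S" "G_domain (foldl ring_adjoin B as)"
  shows "G_domain B"
  using assms
proof (induction as arbitrary: B)
  case (Cons a as)
  have as: "a \<in> S" "set as \<subseteq> S" "G_domain (foldl ring_adjoin (ring_adjoin B a) as)"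
    using Cons.prems(3,4) by simp_all
  have "G_domain (ring_adjoin B a)"
    by (rule Cons.IH[OF unital_subring_ring_adjoin[OF Cons.prems(1)]
          ring_adjoin_minimal[OF S Cons.prems(2) as(1)] as(2,3)])
  then show ?case by (rule G_domain_if_adjoin[OF Cons.prems(1,2) as(1)])
qed simp

text \<open>Adjoin \<open>t\<close> before the generators: \<open>S\<close> is generated by
  \<open>as\<close> over \<open>B[t]\<close> as well. As \<open>S / N\<close> is a field,
  \<open>S\<close> has the property \<open>G_domain\<close> with \<open>c = 1\<close>; the property
  descends to \<open>B[t]\<close>, where it makes \<open>t\<close> algebraic over
  \<open>B\<close>.\<close>

theorem exists_algebraic_relation:
  assumes max: "\<And>s. s \<in> S - N \<Longrightarrow> \<exists>h\<in>S. s * h - 1 \<in> N"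
    and B: "unital_subring B" "B \<subseteq> S" and as: "set as \<subseteq> S" "S \<subseteq> foldl ring_adjoin B as" and t: "t \<in> S"
  shows "\<exists>p. coeffs_in B p \<and> (\<exists>i. Polynomial.coeff p i \<notin> N) \<and> poly p t \<in> N"
proof -
  define C where "C = ring_adjoin B t"
  have C: "unital_subring C" "B \<subseteq> C" "C \<subseteq> S"
    unfolding C_def by (fact unital_subring_ring_adjoin[OF B(1)] ring_adjoin_superset(1)[OF B(1)]
        ring_adjoin_minimal[OF S B(2) t])+
  have fold: "foldl ring_adjoin B as \<subseteq> foldl ring_adjoin C as" if "B \<subseteq> C" for B C :: "'a set"
    using that
  proof (induction as arbitrary: B C)
    case (Cons a as)
    show ?case using Cons.IH[OF ring_adjoin_mono[OF Cons.prems]] by simp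
  qed simp
  have sub: "foldl ring_adjoin C as \<subseteq> S" if "unital_subring C" "C \<subseteq> S" for C
    using that as(1)
  proof (induction as arbitrary: C)
    case (Cons a as)
    then show ?case
      using Cons.IH[OF unital_subring_ring_adjoin[OF Cons.prems(1)] ring_adjoin_minimal[OF S Cons.prems(2)]]
      by simp
  qed simp
  have "foldl ring_adjoin C as = S" using fold[OF C(2)] as(2) sub[OF C(1,3)] by blast
  moreover have "G_domain S"
    unfolding G_domain_def
  proof (intro bexI[of _ 1] ballI)
    show "1 \<in> S - N" by (rule notin_N_one)
    fix s assume "s \<in> S - N"
    then obtain h where "h \<in> S" "s * h - 1 \<in> N" using max by blast
    then show "\<exists>k. \<exists>h\<in>S. s * h - 1 ^ k \<in> N" by (intro exI[of _ 0] bexI[of _ h]) simp_all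
  qed
  ultimately have "G_domain C" using G_domain_foldl[OF C(1,3) as(1)] by simp
  then show ?thesis
    using algebraic_if_G_domain[OF B t] by (simp add: C_def algebraic_mod_def)
qed

end

section \<open>Polynomial rings\<close>

abbreviation "keys \<equiv> Poly_Mapping.keys"
abbreviation "lookup \<equiv> Poly_Mapping.lookup"
abbreviation "single \<equiv> Poly_Mapping.single"

type_synonym ('v, 'k) mpoly = "('v \<Rightarrow>\<^sub>0 nat) \<Rightarrow>\<^sub>0 'k"

definition pol :: "'v set \<Rightarrow> ('v, 'k::field) mpoly set" where
  "pol V = {p. \<forall>m\<in>keys p. keys m \<subseteq> V}"

lemma polynomial_ring_eq: "polynomial_ring V = sub_ring (pol V)"
  by (simp add: polynomial_ring_def sub_ring_def pol_def)

lemma keys_add_nat: "keys (m + t) = keys m \<union> keys (t :: 'v \<Rightarrow>\<^sub>0 nat)"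
  by (auto simp: in_keys_iff lookup_add)

lemma keys_sum_monomials: "(p :: ('v, 'k::field) mpoly) = (\<Sum>m\<in>keys p. single m (lookup p m))"
  by (rule poly_mapping_eqI)
    (simp add: lookup_sum lookup_single when_def in_keys_iff sum.delta if_distrib cong: if_cong)

lemma mpoly_induct [case_names single plus]:
  assumes "\<And>m c. m \<in> keys p \<or> c = 0 \<Longrightarrow> P (single m c)" "\<And>p q. P p \<Longrightarrow> P q \<Longrightarrow> P (p + q)"
  shows "P (p :: ('v, 'k::field) mpoly)"
proof -
  have "P (\<Sum>m\<in>A. single m (lookup p m))" if "finite A" "A \<subseteq> keys p" for A
    using that
  proof (induction A rule: finite_induct)
    case empty
    then show ?case using assms(1)[of 0 0] by simp
  qed (auto intro: assms)
  then have "P (\<Sum>m\<in>keys p. single m (lookup p m))" by simp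
  then show ?thesis by (simp only: keys_sum_monomials[symmetric])
qed

lemma lookup_single_mult:
  "lookup (single m c * p) (m + t) = c * lookup (p :: ('v, 'k::field) mpoly) t"
proof (induction p rule: mpoly_induct)
  case (single s d)
  then show ?case by (simp add: mult_single lookup_single when_def)
qed (simp add: algebra_simps lookup_add)

lemma single_mult_keys: "keys (single m c * p) \<subseteq> (+) m ` keys (p :: ('v, 'k::field) mpoly)"
  using keys_mult[of "single m c" p] by (auto split: if_splits)

lemma unital_subring_pol: "unital_subring (pol V :: ('v, 'k::field) mpoly set)"
  unfolding unital_subring_def
proof (intro conjI ballI)
  show "1 \<in> (pol V :: ('v, 'k) mpoly set)" by (simp add: pol_def)
  fix a b :: "('v, 'k) mpoly" assume ab: "a \<in> pol V" "b \<in> pol V"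
  show "a - b \<in> pol V"
    using ab keys_add[of a "- b"] by (auto simp: pol_def in_keys_iff lookup_minus)
  show "a * b \<in> pol V"
    unfolding pol_def
  proof (intro CollectI ballI)
    fix m assume "m \<in> keys (a * b)"
    then obtain s t where "m = s + t" "s \<in> keys a" "t \<in> keys b" using keys_mult[of a b] by blast
    then show "keys m \<subseteq> V" using ab by (auto simp: pol_def keys_add_nat)
  qed
qed

lemmas pol_closed = subring_closed[OF unital_subring_pol]

lemma single_in_pol: "keys m \<subseteq> V \<Longrightarrow> single m c \<in> pol V"
  by (auto simp: pol_def)

lemma poly_var_in_pol: "v \<in> V \<Longrightarrow> poly_var v \<in> pol V"
  unfolding poly_var_def by (rule single_in_pol) auto

lemma poly_var_power: "poly_var v ^ k = single (single v k) 1"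
proof (induction k)
  case (Suc k)
  have "single v 1 + single v k = single v (Suc k)" by (simp flip: single_add)
  then show ?case using Suc by (simp add: poly_var_def mult_single)
qed simp

lemma pol_mono: "U \<subseteq> V \<Longrightarrow> pol U \<subseteq> pol V"
  by (auto simp: pol_def)

lemma pol_empty: "pol {} = range (single 0)"
proof -
  have "p = single 0 (lookup p 0)" if "p \<in> pol {}" for p :: "('v, 'k::field) mpoly"
    using that by (intro poly_mapping_eqI) (auto simp: pol_def lookup_single when_def in_keys_iff)
  then show ?thesis by (auto simp: pol_def split: if_splits)
qed

text \<open>Every monomial splits off its power of \<open>v\<close>. Iterating this makes
  \<open>pol V\<close> a tower of \<open>ring_adjoin\<close> steps, the form required by the basis
  theorem and by Zariski's lemma.\<close>

lemma pol_insert: "pol (insert v V) = ring_adjoin (pol V) (poly_var v :: ('v, 'k::field) mpoly)"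
proof
  show "ring_adjoin (pol V) (poly_var v) \<subseteq> pol (insert v V)"
    by (intro ring_adjoin_minimal unital_subring_pol pol_mono poly_var_in_pol) auto
  have R: "unital_subring (ring_adjoin (pol V) (poly_var v :: ('v, 'k) mpoly))"
    by (rule unital_subring_ring_adjoin[OF unital_subring_pol])
  show "pol (insert v V) \<subseteq> ring_adjoin (pol V) (poly_var v :: ('v, 'k) mpoly)"
  proof
    fix p :: "('v, 'k) mpoly" assume p: "p \<in> pol (insert v V)"
    have "single m (lookup p m) \<in> ring_adjoin (pol V) (poly_var v)" if m: "m \<in> keys p" for m
    proof -
      define t where "t = m - single v (lookup m v)"
      have mt: "m = t + single v (lookup m v)"
        by (rule poly_mapping_eqI) (auto simp: t_def lookup_add lookup_minus lookup_single when_def)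
      have "keys t \<subseteq> V"
      proof
        fix u assume "u \<in> keys t"
        then have "lookup t u \<noteq> 0" by (simp add: in_keys_iff)
        then have "u \<noteq> v" "lookup m u \<noteq> 0" by (auto simp: t_def lookup_minus lookup_single when_def)
        moreover have "keys m \<subseteq> insert v V" using p m by (simp add: pol_def)
        moreover from calculation have "u \<in> keys m" by (simp add: in_keys_iff)
        ultimately show "u \<in> V" by blast
      qed
      then have "single t (lookup p m) \<in> ring_adjoin (pol V) (poly_var v)"
        using single_in_pol ring_adjoin_superset(1)[OF unital_subring_pol] by blast
      moreover have "single m (lookup p m) = single t (lookup p m) * poly_var v ^ lookup m v"
        using mt by (simp add: poly_var_power mult_single)
      ultimately show ?thesis
        using subring_mult[OF R] subring_power[OF R] ring_adjoin_superset(2)[OF unital_subring_pol] by metis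
    qed
    then have "(\<Sum>m\<in>keys p. single m (lookup p m)) \<in> ring_adjoin (pol V) (poly_var v)"
      by (rule subring_sum[OF R])
    then show "p \<in> ring_adjoin (pol V) (poly_var v)" using keys_sum_monomials[of p] by simp
  qed
qed

lemma pol_foldl: "pol (U \<union> set vs) = foldl ring_adjoin (pol U) (map poly_var vs)"
proof (induction vs arbitrary: U)
  case (Cons v vs)
  have "U \<union> set (v # vs) = insert v U \<union> set vs" by simp
  then show ?case using Cons[of "insert v U"] by (simp only: list.map foldl_Cons pol_insert)
qed simp

theorem noetherian_pol:
  assumes "finite V"
  shows "noetherian_ring (sub_ring (pol V :: ('v, 'k::field) mpoly set))"
  using assms
proof (induction V rule: finite_induct)
  case empty
  interpret R: cring "sub_ring (pol {} :: ('v, 'k) mpoly set)" by (rule cring_sub_ring[OF unital_subring_pol])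
  show ?case
  proof (rule R.noetherian_ringI)
    fix J :: "('v, 'k) mpoly set" assume J: "ideal J (sub_ring (pol {}))"
    note J' = ideal_sub_ringD[OF unital_subring_pol J]
    show "\<exists>A\<subseteq>carrier (sub_ring (pol {})). finite A \<and> J = Idl\<^bsub>sub_ring (pol {})\<^esub> A"
    proof (cases "J = {0}")
      case True
      then show ?thesis using R.genideal_zero pol_closed(4) by (intro exI[of _ "{0}"]) auto
    next
      case False
      then obtain p where p: "p \<in> J" "p \<noteq> 0" using J'(2) by blast
      then obtain c where c: "p = single 0 c" using J'(1) pol_empty by blast
      then have "c \<noteq> 0" using p by auto
      then have "single 0 (inverse c) * p = 1" using c by (simp add: mult_single)
      then have "1 \<in> J" using J'(4)[OF single_in_pol p(1), of 0 "inverse c"] by simp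
      then have "J = pol {}" using ideal.one_imp_carrier[OF J] by simp
      then show ?thesis using R.genideal_one pol_closed(1) by (intro exI[of _ "{1}"]) auto
    qed
  qed
next
  case (insert v V)
  then show ?case unfolding pol_insert by (intro noetherian_ring_adjoin unital_subring_pol)
qed

definition keep :: "('a \<Rightarrow> bool) \<Rightarrow> ('a \<Rightarrow>\<^sub>0 'b::zero) \<Rightarrow> 'a \<Rightarrow>\<^sub>0 'b" where
  "keep P p = Abs_poly_mapping (\<lambda>m. if P m then lookup p m else 0)"

lemma lookup_keep: "lookup (keep P p) m = (if P m then lookup p m else 0)"
proof -
  have "finite {m. (if P m then lookup p m else 0) \<noteq> 0}"
    by (rule finite_subset[OF _ finite_lookup[of p]]) auto
  then show ?thesis by (simp add: keep_def)
qed

lemma keys_keep: "keys (keep P p) = {m \<in> keys p. P m}"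
  by (auto simp: in_keys_iff lookup_keep split: if_splits)

lemma keep_split: "p = keep P p + keep (\<lambda>m. \<not> P m) (p :: ('v, 'k::field) mpoly)"
  by (rule poly_mapping_eqI) (simp add: lookup_add lookup_keep)

section \<open>Squarefree monomial ideals\<close>

text \<open>The ideal generated by the squarefree monomials with support \<open>e\<close>, for
  \<open>e\<close> in \<open>F\<close>, encoded by its membership test. Edges and single variables
  are both such supports, so all ideals of the induction have this form;
  \<open>mon_ideal_minimal\<close> confirms that the monomials generate.\<close>

definition mon_ideal :: "'v set \<Rightarrow> 'v set set \<Rightarrow> ('v, 'k::field) mpoly set" where
  "mon_ideal V F = {p \<in> pol V. \<forall>m\<in>keys p. \<exists>e\<in>F. e \<subseteq> keys m}"

lemma ideal_mon_ideal: "ideal (mon_ideal V F :: ('v, 'k::field) mpoly set) (sub_ring (pol V))"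
proof (rule ideal_sub_ringI[OF unital_subring_pol])
  show "a + b \<in> mon_ideal V F" if "a \<in> mon_ideal V F" "b \<in> mon_ideal V F" for a b :: "('v, 'k::field) mpoly"
    using that pol_closed(6) keys_add[of a b] by (fastforce simp: mon_ideal_def)
  show "r * a \<in> mon_ideal V F" if "r \<in> pol V" and a: "a \<in> mon_ideal V F" for r a :: "('v, 'k::field) mpoly"
    unfolding mon_ideal_def
  proof (intro CollectI conjI ballI)
    show "r * a \<in> pol V" using that pol_closed(3) by (auto simp: mon_ideal_def)
    fix m assume "m \<in> keys (r * a)"
    then obtain s t where "m = s + t" "t \<in> keys a" using keys_mult[of r a] by blast
    moreover from this(2) obtain e where "e \<in> F" "e \<subseteq> keys t"
      using a unfolding mon_ideal_def by blast
    ultimately show "\<exists>e\<in>F. e \<subseteq> keys m" by (intro bexI[of _ e]) (auto simp: keys_add_nat)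
  qed
qed (auto simp: mon_ideal_def pol_closed)

lemma mon_ideal_subset_pol: "mon_ideal V F \<subseteq> pol V"
  by (auto simp: mon_ideal_def)

lemma mon_ideal_cong_subset:
  assumes "\<And>e. e \<in> F \<Longrightarrow> \<exists>e'\<in>G. e' \<subseteq> e"
  shows "mon_ideal V F \<subseteq> mon_ideal V G"
  unfolding mon_ideal_def
proof (rule Collect_mono, intro impI conjI ballI)
  fix p m assume p: "p \<in> pol V \<and> (\<forall>m\<in>keys p. \<exists>e\<in>F. e \<subseteq> keys m)" and "m \<in> keys p"
  then obtain e where "e \<in> F" "e \<subseteq> keys m" by blast
  then show "\<exists>e\<in>G. e \<subseteq> keys m" using assms[of e] by blast
qed simp

lemma lookup_sum_singles:
  "finite e \<Longrightarrow> lookup (\<Sum>v\<in>e. single v (Suc 0)) u = (if u \<in> e then 1 else 0)"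
  by (simp add: lookup_sum lookup_single when_def)

lemma keys_sum_singles: "finite e \<Longrightarrow> keys (\<Sum>v\<in>e. single v (1 :: nat)) = e"
  by (auto simp: in_keys_iff lookup_sum_singles split: if_splits)

lemma mon_ideal_minimal:
  assumes J: "ideal J (sub_ring (pol V :: ('v, 'k::field) mpoly set))"
    and F: "\<And>e. e \<in> F \<Longrightarrow> e \<subseteq> V \<Longrightarrow> finite e \<Longrightarrow> single (\<Sum>v\<in>e. single v 1) 1 \<in> J"
  shows "mon_ideal V F \<subseteq> J"
proof
  note cl = ideal_sub_ringD[OF unital_subring_pol J]
  fix p :: "('v, 'k) mpoly" assume p: "p \<in> mon_ideal V F"
  show "p \<in> J"
  proof (induction p rule: mpoly_induct)
    case (single m c)
    show ?case
    proof (cases "c = 0")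
      case False
      then have m: "m \<in> keys p" using single by blast
      then obtain e where e: "e \<in> F" "e \<subseteq> keys m" and mV: "keys m \<subseteq> V"
        using p unfolding mon_ideal_def pol_def by blast
      have fin: "finite e" using e(2) by (rule finite_subset) simp
      define s where "s = (\<Sum>v\<in>e. single v (1 :: nat))"
      define t where "t = m - s"
      have mt: "m = t + s"
      proof (rule poly_mapping_eqI)
        fix v
        have "v \<in> e \<Longrightarrow> lookup m v \<noteq> 0" using e(2) by (auto simp: in_keys_iff)
        then show "lookup m v = lookup (t + s) v"
          by (simp add: t_def s_def lookup_add lookup_minus lookup_sum_singles[OF fin])
      qed
      have "single m c = single t c * single s 1"
        unfolding mult_single by (simp only: mt[symmetric] mult_1_right)
      moreover have "single t c \<in> pol V" using mV mt by (intro single_in_pol) (auto simp: keys_add_nat)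
      ultimately show ?thesis using cl(4) F[OF e(1) _ fin] e(2) mV by (simp add: s_def)
    qed (use cl(2) in simp)
  qed (rule cl(3))
qed

lemma mon_ideal_singles_subset:
  assumes "ideal J (sub_ring (pol V :: ('v, 'k::field) mpoly set))" "poly_var ` C \<subseteq> J"
  shows "mon_ideal V ((\<lambda>c. {c}) ` C) \<subseteq> J"
  using assms(2) by (intro mon_ideal_minimal assms(1)) (auto simp: poly_var_def)

text \<open>This computes the colon ideal by a variable: multiplication by \<open>v\<close> shifts
  the monomials injectively and adds exactly \<open>v\<close> to their supports.\<close>

lemma poly_var_mult_in_mon_ideal:
  assumes "c \<in> pol V" "v \<in> V"
  shows "poly_var v * c \<in> mon_ideal V F \<longleftrightarrow> c \<in> mon_ideal V ((\<lambda>e. e - {v}) ` F)"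
proof
  assume L: "poly_var v * c \<in> mon_ideal V F"
  show "c \<in> mon_ideal V ((\<lambda>e. e - {v}) ` F)"
    unfolding mon_ideal_def
  proof (intro CollectI conjI ballI)
    fix m assume "m \<in> keys c"
    then have "single v 1 + m \<in> keys (poly_var v * c)"
      unfolding poly_var_def by (simp add: in_keys_iff lookup_single_mult)
    then obtain e where "e \<in> F" "e \<subseteq> keys (single v 1 + m)" using L unfolding mon_ideal_def by blast
    then show "\<exists>e\<in>(\<lambda>e. e - {v}) ` F. e \<subseteq> keys m" by (auto simp: keys_add_nat)
  qed fact
next
  assume R: "c \<in> mon_ideal V ((\<lambda>e. e - {v}) ` F)"
  show "poly_var v * c \<in> mon_ideal V F"
    unfolding mon_ideal_def
  proof (intro CollectI conjI ballI)
    show "poly_var v * c \<in> pol V" by (intro pol_closed(3) poly_var_in_pol assms)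
    fix m assume "m \<in> keys (poly_var v * c)"
    then obtain t where t: "m = single v 1 + t" "t \<in> keys c"
      using single_mult_keys[of "single v 1" 1 c] by (auto simp: poly_var_def)
    then obtain e where "e \<in> F" "e - {v} \<subseteq> keys t" using R unfolding mon_ideal_def by blast
    then show "\<exists>e\<in>F. e \<subseteq> keys m" using t by (auto simp: keys_add_nat intro!: bexI[of _ e])
  qed
qed

lemma mon_ideal_insert:
  assumes v: "v \<in> V"
  shows "mon_ideal V (insert {v} F) = adjoin (sub_ring (pol V)) (mon_ideal V F) (poly_var v :: ('v, 'k::field) mpoly)"
proof
  interpret R: cring "sub_ring (pol V :: ('v, 'k) mpoly set)" by (rule cring_sub_ring[OF unital_subring_pol])
  have "(poly_var v :: ('v, 'k) mpoly) \<in> mon_ideal V (insert {v} F)"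
    using poly_var_in_pol[OF v] by (auto simp: mon_ideal_def poly_var_def)
  moreover have "mon_ideal V F \<subseteq> (mon_ideal V (insert {v} F) :: ('v, 'k) mpoly set)"
    by (rule mon_ideal_cong_subset) auto
  ultimately show "adjoin (sub_ring (pol V)) (mon_ideal V F) (poly_var v :: ('v, 'k) mpoly) \<subseteq> mon_ideal V (insert {v} F)"
    by (intro R.adjoin_minimal ideal_mon_ideal)
  have id: "ideal (adjoin (sub_ring (pol V)) (mon_ideal V F) (poly_var v :: ('v, 'k) mpoly)) (sub_ring (pol V))"
    using poly_var_in_pol[OF v] by (intro R.adjoin_ideal ideal_mon_ideal) simp
  have sup: "mon_ideal V F \<subseteq> adjoin (sub_ring (pol V)) (mon_ideal V F) (poly_var v :: ('v, 'k) mpoly)"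
    "poly_var v \<in> adjoin (sub_ring (pol V)) (mon_ideal V F) (poly_var v :: ('v, 'k) mpoly)"
    using poly_var_in_pol[OF v] by (intro R.adjoin_superset ideal_mon_ideal; simp)+
  show "mon_ideal V (insert {v} F) \<subseteq> adjoin (sub_ring (pol V)) (mon_ideal V F) (poly_var v :: ('v, 'k) mpoly)"
  proof (rule mon_ideal_minimal[OF id])
    fix e assume e: "e \<in> insert {v} F" "e \<subseteq> V" "finite e"
    note keys = keys_sum_singles[OF e(3)]
    have "single (\<Sum>v\<in>e. single v 1) 1 \<in> (mon_ideal V F :: ('v, 'k) mpoly set)" if "e \<in> F"
      using that e(2) keys unfolding mon_ideal_def by (auto intro!: single_in_pol bexI[of _ e])
    then show "single (\<Sum>v\<in>e. single v 1) 1 \<in> adjoin (sub_ring (pol V)) (mon_ideal V F) (poly_var v :: ('v, 'k) mpoly)"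
      using e(1) sup by (cases "e = {v}") (auto simp: poly_var_def)
  qed
qed

lemma edge_ideal_eq:
  assumes "finite_simple_graph V E"
  shows "edge_ideal V E = (mon_ideal V E :: ('v, 'k::field) mpoly set)"
proof
  interpret R: cring "sub_ring (pol V :: ('v, 'k) mpoly set)" by (rule cring_sub_ring[OF unital_subring_pol])
  define G :: "('v, 'k) mpoly set" where "G = {poly_var z * poly_var z' | z z'. {z, z'} \<in> E}"
  have E: "e \<subseteq> V" "card e = 2" if "e \<in> E" for e using assms that by (auto simp: finite_simple_graph_def)
  have prod: "poly_var z * poly_var z' = (single (single z 1 + single z' 1) 1 :: ('v, 'k) mpoly)" for z z' :: 'v
    by (simp add: poly_var_def mult_single)
  have G: "G \<subseteq> (mon_ideal V E :: ('v, 'k) mpoly set)"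
  proof
    fix g assume "g \<in> G"
    then obtain z z' where z: "g = poly_var z * poly_var z'" "{z, z'} \<in> E" by (auto simp: G_def)
    have "{z, z'} \<subseteq> V" using E z by blast
    then show "g \<in> (mon_ideal V E :: ('v, 'k) mpoly set)"
      using z(2) unfolding z(1) prod
      by (auto simp: mon_ideal_def pol_def keys_add_nat intro!: bexI[of _ "{z, z'}"])
  qed
  then show "edge_ideal V E \<subseteq> (mon_ideal V E :: ('v, 'k) mpoly set)"
    unfolding edge_ideal_def polynomial_ring_eq G_def[symmetric]
    by (intro R.genideal_minimal ideal_mon_ideal)
  have Gc: "G \<subseteq> (pol V :: ('v, 'k) mpoly set)" using G mon_ideal_subset_pol by blast
  have id: "ideal (Idl\<^bsub>sub_ring (pol V)\<^esub> G) (sub_ring (pol V :: ('v, 'k) mpoly set))"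
    using Gc by (intro R.genideal_ideal) simp
  show "(mon_ideal V E :: ('v, 'k) mpoly set) \<subseteq> edge_ideal V E"
    unfolding edge_ideal_def polynomial_ring_eq G_def[symmetric]
  proof (rule mon_ideal_minimal[OF id])
    fix e assume e: "e \<in> E"
    obtain z z' where z: "e = {z, z'}" "z \<noteq> z'" using E(2)[OF e] by (auto simp: card_2_iff)
    have "single (\<Sum>v\<in>e. single v 1) 1 = (poly_var z * poly_var z' :: ('v, 'k) mpoly)"
      unfolding prod using z by simp
    also have "\<dots> \<in> G" using e z(1) by (auto simp: G_def)
    also have "G \<subseteq> Idl\<^bsub>sub_ring (pol V)\<^esub> G" using Gc by (intro R.genideal_self) simp
    finally show "single (\<Sum>v\<in>e. single v 1) 1 \<in> Idl\<^bsub>sub_ring (pol V)\<^esub> G" .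
  qed
qed

section \<open>Regular sequences of univariate polynomials\<close>

text \<open>The coefficient of \<open>z^k\<close> when \<open>p\<close> is read as a polynomial in
  \<open>z\<close> over the other variables.\<close>

definition strip :: "'v \<Rightarrow> nat \<Rightarrow> ('v, 'k::field) mpoly \<Rightarrow> ('v, 'k) mpoly" where
  "strip z k p = Abs_poly_mapping (\<lambda>m. if lookup m z = 0 then lookup p (m + single z k) else 0)"

lemma lookup_strip:
  "lookup (strip z k p) m = (if lookup m z = 0 then lookup p (m + single z k) else 0)"
proof -
  have "finite ((\<lambda>m. m + single z k) -` {m. lookup p m \<noteq> 0})"
    by (intro finite_vimageI finite_lookup) (auto simp: inj_def)
  then have "finite {m. (if lookup m z = 0 then lookup p (m + single z k) else 0) \<noteq> 0}"
    by (rule finite_subset[rotated]) auto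
  then show ?thesis by (simp add: strip_def)
qed

lemma strip_0 [simp]: "strip z k 0 = 0"
  by (rule poly_mapping_eqI) (simp add: lookup_strip)

lemma strip_add: "strip z k (p + q) = strip z k p + strip z k q"
  by (rule poly_mapping_eqI) (simp add: lookup_strip lookup_add)

lemma strip_single:
  "strip z k (single m c) = (if lookup m z = k then single (m - single z k) c else 0)"
proof (rule poly_mapping_eqI)
  fix t
  have "m = t + single z k \<and> lookup t z = 0 \<longleftrightarrow> lookup m z = k \<and> t = m - single z k"
  proof
    assume "m = t + single z k \<and> lookup t z = 0"
    then show "lookup m z = k \<and> t = m - single z k" by (simp add: lookup_add)
  next
    assume *: "lookup m z = k \<and> t = m - single z k"
    then have "m = t + single z k"
      by (intro poly_mapping_eqI) (auto simp: lookup_add lookup_minus lookup_single when_def)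
    moreover have "lookup t z = 0" using * by (simp add: lookup_minus)
    ultimately show "m = t + single z k \<and> lookup t z = 0" by blast
  qed
  then show "lookup (strip z k (single m c)) t =
      lookup (if lookup m z = k then single (m - single z k) c else 0) t"
    by (auto simp: lookup_strip lookup_single when_def)
qed

lemma strip_mult_free:
  assumes "\<And>m. m \<in> keys h \<Longrightarrow> lookup m z = 0"
  shows "strip z k (g * h) = strip z k g * h"
proof (induction g rule: mpoly_induct)
  case (single s d)
  show ?case
  proof (induction h rule: mpoly_induct)
    case (single t c)
    show ?case
    proof (cases "c = 0")
      case False
      then have t: "lookup t z = 0" using single assms by blast
      have "s + t - single z (lookup s z) = s - single z (lookup s z) + t"
        by (intro poly_mapping_eqI) (auto simp: lookup_add lookup_minus lookup_single when_def)
      then show ?thesis using t by (auto simp: mult_single strip_single lookup_add)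
    qed simp
  qed (simp add: distrib_left strip_add)
qed (simp add: distrib_right strip_add)

lemma strip_poly_var_mult_0: "strip z 0 (poly_var z * p) = 0"
proof (rule poly_mapping_eqI)
  fix m
  have "lookup (poly_var z * p) m = 0" if "lookup m z = 0"
  proof (rule ccontr)
    assume "lookup (poly_var z * p) m \<noteq> 0"
    then have "m \<in> keys (single (single z 1) 1 * p)" by (simp add: in_keys_iff poly_var_def)
    then obtain t where "m = single z 1 + t" using single_mult_keys by blast
    then show False using that by (simp add: lookup_add)
  qed
  then show "lookup (strip z 0 (poly_var z * p)) m = lookup 0 m" by (simp add: lookup_strip)
qed

lemma strip_poly_var_mult_Suc: "strip z (Suc k) (poly_var z * p) = strip z k p"
proof (rule poly_mapping_eqI)
  fix m
  have "m + single z (Suc k) = single z 1 + (m + single z k)"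
    by (simp add: add.left_commute flip: single_add)
  then have "lookup (poly_var z * p) (m + single z (Suc k)) = lookup p (m + single z k)"
    unfolding poly_var_def by (simp only: lookup_single_mult mult_1)
  then show "lookup (strip z (Suc k) (poly_var z * p)) m = lookup (strip z k p) m"
    by (simp add: lookup_strip)
qed

lemma sum_strip:
  "p = (\<Sum>k\<in>(\<lambda>m. lookup m z) ` keys p. single (single z k) 1 * strip z k p)" (is "p = ?r")
proof (rule poly_mapping_eqI)
  fix m
  have *: "lookup (single (single z k) 1 * strip z k p) m = (if lookup m z = k then lookup p m else 0)" for k
  proof (cases "k \<le> lookup m z")
    case True
    define t where "t = m - single z k"
    have m: "m = single z k + t" using True
      by (intro poly_mapping_eqI) (auto simp: t_def lookup_add lookup_minus lookup_single when_def)
    have "lookup (single (single z k) 1 * strip z k p) m = lookup (strip z k p) t"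
      unfolding m by (simp add: lookup_single_mult)
    also have "\<dots> = (if lookup t z = 0 then lookup p (t + single z k) else 0)" by (rule lookup_strip)
    also have "\<dots> = (if lookup m z = k then lookup p m else 0)"
      using True by (simp add: m lookup_add add.commute)
    finally show ?thesis .
  next
    case False
    have "m \<notin> keys (single (single z k) 1 * strip z k p)"
    proof
      assume "m \<in> keys (single (single z k) 1 * strip z k p)"
      then obtain t where "m = single z k + t" using single_mult_keys by blast
      then show False using False by (simp add: lookup_add)
    qed
    then show ?thesis using False by (auto simp: in_keys_iff)
  qed
  have "lookup ?r m = (\<Sum>k\<in>(\<lambda>m. lookup m z) ` keys p. if lookup m z = k then lookup p m else 0)"
    by (simp add: lookup_sum *)
  also have "\<dots> = (if lookup m z \<in> (\<lambda>m. lookup m z) ` keys p then lookup p m else 0)"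
    by (simp add: sum.delta)
  also have "\<dots> = lookup p m" by (auto simp: in_keys_iff)
  finally show "lookup p m = lookup ?r m" by simp
qed

lemma strip_in_pol:
  assumes "p \<in> pol V"
  shows "strip z k p \<in> pol V"
  unfolding pol_def
proof (intro CollectI ballI)
  fix m assume "m \<in> keys (strip z k p)"
  then have "m + single z k \<in> keys p" by (auto simp: in_keys_iff lookup_strip split: if_splits)
  then have "keys (m + single z k) \<subseteq> V" using assms by (simp add: pol_def)
  then show "keys m \<subseteq> V" by (simp add: keys_add_nat)
qed

text \<open>Such a \<open>J\<close> is extended from the polynomials that do not involve \<open>z\<close>.\<close>

definition extended :: "'v \<Rightarrow> ('v, 'k::field) mpoly set \<Rightarrow> bool" where
  "extended z J \<longleftrightarrow> (\<forall>p\<in>J. \<forall>k. strip z k p \<in> J)"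

context
  fixes V :: "'v set" and J :: "('v, 'k::field) mpoly set" and z :: 'v
  assumes J: "ideal J (sub_ring (pol V))" and z: "z \<in> V"
begin

lemmas J_closed = ideal_sub_ringD[OF unital_subring_pol J]

lemma mem_if_strips: "(\<And>k. strip z k a \<in> J) \<Longrightarrow> a \<in> J"
proof -
  assume s: "\<And>k. strip z k a \<in> J"
  have "(\<Sum>k\<in>A. single (single z k) 1 * strip z k a) \<in> J" for A
  proof (induction A rule: infinite_finite_induct)
    case (insert k A)
    show ?case
      unfolding sum.insert[OF insert(1,2)]
      by (rule J_closed(3)[OF J_closed(4)[OF single_in_pol s] insert(3)]) (use z in auto)
  qed (simp_all add: J_closed(2))
  then have "(\<Sum>k\<in>(\<lambda>m. lookup m z) ` keys a. single (single z k) 1 * strip z k a) \<in> J" .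
  then show "a \<in> J" by (simp only: sum_strip[symmetric])
qed

lemma strip_const_mult:
  assumes "c \<in> pol {}"
  shows "strip z k (c * a) = c * strip z k a"
proof -
  have "lookup m z = 0" if "m \<in> keys c" for m
    using assms that by (auto simp: pol_def)
  then show ?thesis using strip_mult_free[of c z k a] by (simp add: mult.commute)
qed

text \<open>The coefficients of \<open>q(z) a\<close> below \<open>z^k\<close> are constant
  combinations of those of \<open>a\<close> below \<open>z^k\<close>.\<close>

lemma strip_poly_mem:
  assumes "coeffs_in (pol {}) q" "\<And>j. j < k \<Longrightarrow> strip z j a \<in> J"
  shows "j < k \<Longrightarrow> strip z j (poly q (poly_var z) * a) \<in> J"
  using assms(1)
proof (induction q arbitrary: j)
  case 0
  then show ?case using J_closed(2) by simp
next
  case (pCons c q)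
  have c: "c \<in> pol {}" and q: "coeffs_in (pol {}) q"
    using pCons.prems(2) by (auto simp: coeffs_in_def coeff_pCons split: nat.splits)
  have eq: "poly (pCons c q) (poly_var z) * a = c * a + poly_var z * (poly q (poly_var z) * a)"
    by (simp add: algebra_simps)
  have "strip z j (c * a) \<in> J"
    unfolding strip_const_mult[OF c] using c pol_mono[of "{}" V] assms(2)[OF pCons.prems(1)] by (intro J_closed(4)) auto
  moreover have "strip z j (poly_var z * (poly q (poly_var z) * a)) \<in> J"
  proof (cases j)
    case 0
    then show ?thesis using J_closed(2) by (simp add: strip_poly_var_mult_0)
  next
    case (Suc i)
    then show ?thesis using pCons.IH[of i] pCons.prems(1) q by (simp add: strip_poly_var_mult_Suc)
  qed
  ultimately show ?case unfolding eq strip_add by (rule J_closed(3))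
qed

text \<open>A zero constant coefficient of \<open>p\<close> allows dividing by \<open>z\<close>,
  which shifts the strips. Otherwise it is a unit \<open>c\<close>, and the coefficient of
  \<open>z^k\<close> in the product is \<open>c\<close> times that of \<open>a\<close> plus a
  combination of lower ones, so the coefficients of \<open>a\<close> enter \<open>J\<close> one
  after another.\<close>

lemma univariate_nonzerodivisor:
  assumes ext: "extended z J" and p: "coeffs_in (pol {}) p" "p \<noteq> 0"
    and mem: "poly p (poly_var z) * a \<in> J"
  shows "a \<in> J"
  using p mem
proof (induction p)
  case (pCons c q)
  have c: "c \<in> pol {}" and q: "coeffs_in (pol {}) q"
    using pCons.prems(1) by (auto simp: coeffs_in_def coeff_pCons split: nat.splits)
  have eq: "poly (pCons c q) (poly_var z) * a = c * a + poly_var z * (poly q (poly_var z) * a)"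
    by (simp add: algebra_simps)
  have mem: "strip z k (poly (pCons c q) (poly_var z) * a) \<in> J" for k
    using pCons.prems(3) ext by (simp only: extended_def)
  show ?case
  proof (cases "c = 0")
    case True
    have "strip z k (poly q (poly_var z) * a) \<in> J" for k
      using mem[of "Suc k", unfolded eq] unfolding True
      by (simp only: mult_zero_left add_0_left strip_poly_var_mult_Suc)
    then have "poly q (poly_var z) * a \<in> J" by (rule mem_if_strips)
    then show ?thesis using pCons.IH q pCons.prems(2) True by simp
  next
    case False
    obtain c0 where c0: "c = single 0 c0" using c pol_empty by blast
    with False have "c0 \<noteq> 0" by auto
    then have unit: "single 0 (inverse c0) * c = 1" by (simp add: c0 mult_single)
    have "strip z k a \<in> J" for k
    proof (induction k rule: less_induct)
      case (less k)
      have "strip z k (poly_var z * (poly q (poly_var z) * a)) \<in> J"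
      proof (cases k)
        case 0
        then show ?thesis using J_closed(2) by (simp add: strip_poly_var_mult_0)
      next
        case (Suc i)
        then show ?thesis
          using strip_poly_mem[where k = k and j = i, OF q less.IH] by (simp add: strip_poly_var_mult_Suc)
      qed
      from J_closed(6)[OF mem[of k, unfolded eq strip_add strip_const_mult[OF c]] this]
      have "c * strip z k a \<in> J" by (simp only: add_diff_cancel_right')
      then have "single 0 (inverse c0) * (c * strip z k a) \<in> J"
        by (rule J_closed(4)[rotated]) (simp add: single_in_pol)
      then show ?case by (simp only: mult.assoc[symmetric] unit mult_1)
    qed
    then show ?thesis by (rule mem_if_strips)
  qed
qed simp

end

lemma extended_adjoin:
  assumes "extended z J" "\<And>m. m \<in> keys f \<Longrightarrow> lookup m z = 0"
  shows "extended z (adjoin (sub_ring (pol V)) J f)"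
  unfolding extended_def
proof (intro ballI allI)
  fix p k assume "p \<in> adjoin (sub_ring (pol V)) J f"
  then obtain j g where "p = j + g * f" "j \<in> J" "g \<in> pol V" by (auto simp: adjoin_def)
  then have "strip z k p = strip z k j + strip z k g * f" "strip z k j \<in> J" "strip z k g \<in> pol V"
    using assms strip_in_pol by (simp_all add: strip_add strip_mult_free extended_def)
  then show "strip z k p \<in> adjoin (sub_ring (pol V)) J f"
    by (auto simp: adjoin_def)
qed

lemma poly_poly_var_in_pol: "coeffs_in (pol {}) p \<Longrightarrow> poly p (poly_var z) \<in> pol {z}"
  using poly_in_ring_adjoin[OF unital_subring_pol] pol_insert[of z "{}"] by auto

text \<open>Adjoining a polynomial in \<open>z\<close> alone keeps the ideal extended in each of the
  other variables, so \<open>univariate_nonzerodivisor\<close> applies again.\<close>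

lemma weakly_regular_univariate:
  assumes "ideal J (sub_ring (pol V :: ('v, 'k::field) mpoly set))" "distinct zs" "set zs \<subseteq> V" "\<And>z. z \<in> set zs \<Longrightarrow> extended z J"
    and "\<And>z. z \<in> set zs \<Longrightarrow> coeffs_in (pol {} :: ('v, 'k) mpoly set) (p z) \<and> p z \<noteq> 0"
  shows "weakly_regular (sub_ring (pol V)) J (map (\<lambda>z. poly (p z) (poly_var z)) zs)"
  using assms
proof (induction zs arbitrary: J)
  case (Cons z zs)
  interpret R: cring "sub_ring (pol V :: ('v, 'k) mpoly set)" by (rule cring_sub_ring[OF unital_subring_pol])
  let ?f = "poly (p z) (poly_var z :: ('v, 'k) mpoly)"
  have f: "?f \<in> pol {z}" using Cons.prems(5) by (intro poly_poly_var_in_pol) simp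
  then have fV: "?f \<in> pol V" using pol_mono[of "{z}" V] Cons.prems(3) by auto
  have "weakly_regular (sub_ring (pol V)) (adjoin (sub_ring (pol V)) J ?f)
      (map (\<lambda>z. poly (p z) (poly_var z)) zs)"
  proof (rule Cons.IH)
    show "ideal (adjoin (sub_ring (pol V)) J ?f) (sub_ring (pol V))"
      using Cons.prems(1) fV by (intro R.adjoin_ideal) simp_all
    fix z' assume z': "z' \<in> set zs"
    then have "z' \<noteq> z" using Cons.prems(2) by auto
    then have "z' \<notin> keys m" if "m \<in> keys ?f" for m
      using f that unfolding pol_def by blast
    then have "lookup m z' = 0" if "m \<in> keys ?f" for m
      using that by (simp add: in_keys_iff)
    then show "extended z' (adjoin (sub_ring (pol V)) J ?f)"
      using Cons.prems(4) z' by (intro extended_adjoin) auto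
  qed (use Cons.prems in auto)
  moreover have "a \<in> J" if "?f * a \<in> J" for a
    using univariate_nonzerodivisor[OF Cons.prems(1) _ _ _ _ that] Cons.prems(3,4,5) by simp
  ultimately show ?case by simp
qed simp

section \<open>Transfer of weak regularity between ideals\<close>

context
  fixes S :: "'a::comm_ring_1 set"
  assumes S: "unital_subring S"
begin

lemma mem_adjoin_sub_ring:
  "p \<in> adjoin (sub_ring S) J f \<longleftrightarrow> (\<exists>j\<in>J. \<exists>g\<in>S. p = j + g * f)"
  by (auto simp: adjoin_def)

lemma adjoin_swap:
  "adjoin (sub_ring S) (adjoin (sub_ring S) J f) g \<subseteq> adjoin (sub_ring S) (adjoin (sub_ring S) J g) f"
proof
  fix p assume "p \<in> adjoin (sub_ring S) (adjoin (sub_ring S) J f) g"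
  then obtain q b where q: "q \<in> adjoin (sub_ring S) J f" "b \<in> S" "p = q + b * g"
    unfolding mem_adjoin_sub_ring[of p] by blast
  then obtain j a where j: "j \<in> J" "a \<in> S" "q = j + a * f" unfolding mem_adjoin_sub_ring by blast
  have "j + b * g \<in> adjoin (sub_ring S) J g" unfolding mem_adjoin_sub_ring using j(1) q(2) by blast
  moreover have "p = (j + b * g) + a * f" by (simp add: q(3) j(3))
  ultimately show "p \<in> adjoin (sub_ring S) (adjoin (sub_ring S) J g) f"
    unfolding mem_adjoin_sub_ring[of p] using j(2) by blast
qed

text \<open>Congruent elements multiply alike modulo \<open>J\<close> and generate the same ideal
  together with it. This replaces \<open>x_i + y_i\<close> by the one variable of the pair that
  survives.\<close>

lemma weakly_regular_cong:
  assumes "ideal J (sub_ring S)" "list_all2 (\<lambda>f g. f \<in> S \<and> g \<in> S \<and> f - g \<in> J) fs gs"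
    and "weakly_regular (sub_ring S) J gs"
  shows "weakly_regular (sub_ring S) J fs"
  using assms
proof (induction fs arbitrary: gs J)
  case (Cons f fs)
  interpret R: cring "sub_ring S" by (rule cring_sub_ring[OF S])
  note cl = ideal_sub_ringD[OF S Cons.prems(1)]
  obtain g gs' where gs: "gs = g # gs'" and fg: "f \<in> S" "g \<in> S" "f - g \<in> J"
    and rest: "list_all2 (\<lambda>f g. f \<in> S \<and> g \<in> S \<and> f - g \<in> J) fs gs'"
    using Cons.prems(2) by (auto simp: list_all2_Cons1)
  have "adjoin (sub_ring S) J f = adjoin (sub_ring S) J g"
  proof (intro equalityI R.adjoin_minimal R.adjoin_ideal Cons.prems(1) R.adjoin_superset(1))
    show "f \<in> adjoin (sub_ring S) J g"
      unfolding mem_adjoin_sub_ring using fg(3) subring_one[OF S]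
      by (intro bexI[of _ "f - g"] bexI[of _ 1]) simp_all
    show "g \<in> adjoin (sub_ring S) J f"
      unfolding mem_adjoin_sub_ring using cl(5)[OF fg(3)] subring_one[OF S]
      by (intro bexI[of _ "- (f - g)"] bexI[of _ 1]) simp_all
  qed (use fg in auto)
  moreover have "weakly_regular (sub_ring S) (adjoin (sub_ring S) J g) fs"
  proof (rule Cons.IH[where gs = gs'])
    show "ideal (adjoin (sub_ring S) J g) (sub_ring S)"
      using fg Cons.prems(1) by (intro R.adjoin_ideal) simp_all
    have le: "J \<subseteq> adjoin (sub_ring S) J g" using fg Cons.prems(1) by (intro R.adjoin_superset) simp_all
    show "list_all2 (\<lambda>f g'. f \<in> S \<and> g' \<in> S \<and> f - g' \<in> adjoin (sub_ring S) J g) fs gs'"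
      by (rule list_all2_mono[OF rest]) (use le in blast)
    show "weakly_regular (sub_ring S) (adjoin (sub_ring S) J g) gs'" using Cons.prems(3) gs by simp
  qed
  moreover have "a \<in> J" if "a \<in> S" "f * a \<in> J" for a
  proof -
    have "g * a = f * a - a * (f - g)" by (simp add: algebra_simps)
    also have "\<dots> \<in> J" by (intro cl(6) cl(4) that fg)
    finally show ?thesis using Cons.prems(3) that(1) gs by auto
  qed
  ultimately show ?case by simp
qed simp

text \<open>Regularity on \<open>S / J'\<close> and \<open>S / J''\<close> implies regularity on \<open>S / J\<close>, because of the exact sequence
  \<open>0 \<rightarrow> S / (J : y) \<rightarrow> S / J \<rightarrow> S / (J + y S) \<rightarrow> 0\<close> given by multiplication with \<open>y\<close>.\<close>

lemma weakly_regular_exact: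
  assumes "ideal J (sub_ring S)" "ideal J' (sub_ring S)" "y \<in> S" "set fs \<subseteq> S"
    and "\<And>c. c \<in> S \<Longrightarrow> y * c \<in> J \<longleftrightarrow> c \<in> J'"
    and "weakly_regular (sub_ring S) J' fs"
    and "weakly_regular (sub_ring S) (adjoin (sub_ring S) J y) fs"
  shows "weakly_regular (sub_ring S) J fs"
  using assms
proof (induction fs arbitrary: J J')
  case (Cons f fs)
  interpret R: cring "sub_ring S" by (rule cring_sub_ring[OF S])
  note cl = ideal_sub_ringD[OF S Cons.prems(1)] and cl' = ideal_sub_ringD[OF S Cons.prems(2)]
  note y = Cons.prems(3) and colon = Cons.prems(5)
  have f: "f \<in> S" using Cons.prems(4) by simp
  let ?K = "adjoin (sub_ring S) J y"
  have nzd': "c \<in> J'" if "c \<in> S" "f * c \<in> J'" for c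
    using Cons.prems(6) that unfolding weakly_regular.simps sub_ring_simps by blast
  have nzd'': "c \<in> ?K" if "c \<in> S" "f * c \<in> ?K" for c
    using Cons.prems(7) that unfolding weakly_regular.simps sub_ring_simps by blast
  have JK: "J \<subseteq> ?K" using y Cons.prems(1) by (intro R.adjoin_superset) simp_all
  have "a \<in> J" if a: "a \<in> S" "f * a \<in> J" for a
  proof -
    obtain j b where jb: "j \<in> J" "b \<in> S" "a = j + b * y"
    proof -
      have "a \<in> ?K" using nzd''[OF a(1)] a(2) JK by blast
      then show thesis using that unfolding mem_adjoin_sub_ring by blast
    qed
    have "y * (f * b) = f * a - f * j" by (simp add: jb algebra_simps)
    also have "\<dots> \<in> J" by (intro cl(6) cl(4) a f jb)
    finally have "f * b \<in> J'" using colon subring_mult[OF S f jb(2)] by blast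
    then have "y * b \<in> J" using nzd' colon jb(2) by blast
    then have "j + y * b \<in> J" by (rule cl(3)[OF jb(1)])
    then show ?thesis by (simp add: jb(3) mult.commute)
  qed
  moreover have "weakly_regular (sub_ring S) (adjoin (sub_ring S) J f) fs"
  proof (rule Cons.IH)
    show "ideal (adjoin (sub_ring S) J f) (sub_ring S)" "ideal (adjoin (sub_ring S) J' f) (sub_ring S)"
      using f Cons.prems(1,2) by (simp_all add: R.adjoin_ideal)
    show "weakly_regular (sub_ring S) (adjoin (sub_ring S) J' f) fs" using Cons.prems(6) by simp
    have "adjoin (sub_ring S) (adjoin (sub_ring S) J f) y = adjoin (sub_ring S) ?K f"
      using adjoin_swap by blast
    then show "weakly_regular (sub_ring S) (adjoin (sub_ring S) (adjoin (sub_ring S) J f) y) fs"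
      using Cons.prems(7) by simp
    fix c assume c: "c \<in> S"
    \<comment> \<open>The exact sequence persists modulo \<open>f\<close>: the colon of
      \<open>J + (f)\<close> by \<open>y\<close> is \<open>J' + (f)\<close>. The forward inclusion
      rests on \<open>f\<close> being a nonzerodivisor modulo \<open>J + (y)\<close>.\<close>
    show "y * c \<in> adjoin (sub_ring S) J f \<longleftrightarrow> c \<in> adjoin (sub_ring S) J' f"
    proof
      assume "y * c \<in> adjoin (sub_ring S) J f"
      then obtain j g where jg: "j \<in> J" "g \<in> S" "y * c = j + g * f" unfolding mem_adjoin_sub_ring by blast
      have "f * g = - j + c * y" using jg(3) by (simp add: algebra_simps)
      then have "f * g \<in> ?K" unfolding mem_adjoin_sub_ring using cl(5)[OF jg(1)] c
        by (intro bexI[of _ "- j"] bexI[of _ c])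
      then obtain i h where ih: "i \<in> J" "h \<in> S" "g = i + h * y"
      proof -
        have "g \<in> ?K" using nzd''[OF jg(2)] \<open>f * g \<in> ?K\<close> by blast
        then show thesis using that unfolding mem_adjoin_sub_ring by blast
      qed
      have "y * (c - h * f) = y * c - y * h * f" by (simp add: algebra_simps)
      also have "\<dots> = j + f * i" unfolding jg(3) ih(3) by (simp add: algebra_simps)
      also have "\<dots> \<in> J" by (intro cl(3) cl(4) jg ih f)
      finally have "c - h * f \<in> J'"
        using colon subring_diff[OF S c subring_mult[OF S ih(2) f]] by blast
      moreover have "c = (c - h * f) + h * f" by simp
      ultimately show "c \<in> adjoin (sub_ring S) J' f" unfolding mem_adjoin_sub_ring using ih(2) by blast
    next
      assume "c \<in> adjoin (sub_ring S) J' f"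
      then obtain j g where jg: "j \<in> J'" "g \<in> S" "c = j + g * f" unfolding mem_adjoin_sub_ring by blast
      have "y * j \<in> J" using colon jg(1) cl'(1) by blast
      moreover have "y * c = y * j + (y * g) * f" by (simp add: jg(3) algebra_simps)
      ultimately show "y * c \<in> adjoin (sub_ring S) J f"
        unfolding mem_adjoin_sub_ring using subring_mult[OF S y jg(2)] by blast
    qed
  qed (use Cons.prems(3,4) in auto)
  ultimately show ?case by simp
qed simp

lemma poly_diff_mem:
  assumes J: "ideal J (sub_ring S)" and p: "coeffs_in S p" and ab: "a \<in> S" "b \<in> S" "a - b \<in> J"
  shows "poly p a - poly p b \<in> J"
  using p
proof (induction p)
  case 0
  then show ?case using ideal_sub_ringD(2)[OF S J] by simp
next
  case (pCons c q)
  note cl = ideal_sub_ringD[OF S J]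
  have q: "coeffs_in S q" using pCons.prems by (auto simp: coeffs_in_def coeff_pCons split: nat.splits)
  have "poly q b \<in> S" using poly_in_ring_adjoin[OF S q] ring_adjoin_minimal[OF S order_refl ab(2)] by blast
  then have "a * (poly q a - poly q b) + poly q b * (a - b) \<in> J"
    by (intro cl(3) cl(4) ab pCons.IH q)
  moreover have "poly (pCons c q) a - poly (pCons c q) b = a * (poly q a - poly q b) + poly q b * (a - b)"
    by (simp add: algebra_simps)
  ultimately show ?case by simp
qed

end

section \<open>Algebraic relations along prime chains\<close>

fun monomial_value :: "'a::comm_ring_1 list \<Rightarrow> nat list \<Rightarrow> 'a" where
  "monomial_value [] a = 1"
| "monomial_value (g # gs) a = g ^ hd a * monomial_value gs (tl a)"

text \<open>In a relation between the \<open>g\<^sub>i \<in> Q\<^sub>i\<^sub>+\<^sub>1 - Q\<^sub>i\<close> one can cancel the lowest power of \<open>g\<^sub>0\<close> modulo \<open>Q\<^sub>0\<close>, and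
  modulo \<open>Q\<^sub>1\<close> only the terms without \<open>g\<^sub>0\<close> survive.\<close>

lemma prime_chain_no_relation:
  fixes q :: "nat list \<Rightarrow> 'k::field"
  assumes "\<And>i. i \<le> length gs \<Longrightarrow> primeideal (Q i) (sub_ring (pol V :: ('v, 'k) mpoly set))"
    and "\<And>i. i < length gs \<Longrightarrow> gs ! i \<in> Q (Suc i) - Q i \<and> Q i \<subseteq> Q (Suc i)"
    and "finite B" "B \<noteq> {}" "\<And>a. a \<in> B \<Longrightarrow> length a = length gs \<and> q a \<noteq> 0"
  shows "(\<Sum>a\<in>B. single 0 (q a) * monomial_value gs a) \<notin> Q 0"
  using assms
proof (induction gs arbitrary: Q B q)
  case Nil
  interpret Q: primeideal "Q 0" "sub_ring (pol V :: ('v, 'k) mpoly set)" by (rule Nil.prems(1)) simp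
  note cl = ideal_sub_ringD[OF unital_subring_pol Q.is_ideal]
  have B: "B = {[]}" using Nil.prems(4,5) by fastforce
  show ?case
  proof
    assume "(\<Sum>a\<in>B. single 0 (q a) * monomial_value [] a) \<in> Q 0"
    then have "single 0 (q []) \<in> Q 0" by (simp add: B)
    then have "single 0 (inverse (q [])) * single 0 (q []) \<in> Q 0"
      by (intro cl(4) single_in_pol) simp_all
    then have "1 \<in> Q 0" using Nil.prems(5)[of "[]"] by (simp add: B mult_single)
    then show False using Q.one_imp_carrier Q.I_notcarr by simp
  qed
next
  case (Cons g gs)
  interpret Q0: primeideal "Q 0" "sub_ring (pol V :: ('v, 'k) mpoly set)" by (rule Cons.prems(1)) simp
  interpret Q1: primeideal "Q 1" "sub_ring (pol V :: ('v, 'k) mpoly set)" by (rule Cons.prems(1)) simp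
  note cl0 = ideal_sub_ringD[OF unital_subring_pol Q0.is_ideal]
  note cl1 = ideal_sub_ringD[OF unital_subring_pol Q1.is_ideal]
  have g: "g \<in> Q 1" "g \<notin> Q 0" and Q01: "Q 0 \<subseteq> Q 1" using Cons.prems(2)[of 0] by simp_all
  have gV: "g \<in> pol V" using g(1) cl1(1) by blast
  have gs: "set gs \<subseteq> pol V"
  proof
    fix h assume "h \<in> set gs"
    then obtain i where i: "i < length gs" "h = gs ! i" by (auto simp: in_set_conv_nth)
    then have "h \<in> Q (Suc (Suc i))" using Cons.prems(2)[of "Suc i"] by simp
    moreover have "primeideal (Q (Suc (Suc i))) (sub_ring (pol V))" using Cons.prems(1)[of "Suc (Suc i)"] i by simp
    ultimately show "h \<in> pol V"
      using ideal_sub_ringD(1)[OF unital_subring_pol primeideal.axioms(1)] by blast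
  qed
  have mv: "monomial_value gs a \<in> pol V" for a
    using gs by (induction gs arbitrary: a) (auto intro!: pol_closed(1,3,7))
  have cons: "a = hd a # tl a" if "a \<in> B" for a using Cons.prems(5)[OF that] by (cases a) auto
  have power: "g ^ k * s \<in> Q 0 \<Longrightarrow> s \<in> Q 0" if "s \<in> pol V" for k s
  proof (induction k)
    case (Suc k)
    have "g * (g ^ k * s) \<in> Q 0" using Suc.prems by (simp add: mult.assoc)
    then have "g \<in> Q 0 \<or> g ^ k * s \<in> Q 0"
      using Q0.I_prime[of g "g ^ k * s"] gV that by (simp add: pol_closed)
    then show ?case using g(2) Suc.IH by blast
  qed simp
  define \<alpha> where "\<alpha> = Min (hd ` B)"
  have \<alpha>: "\<alpha> \<le> hd a" if "a \<in> B" for a unfolding \<alpha>_def using Cons.prems(3) that by simp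
  define t where "t a = single 0 (q a) * (g ^ (hd a - \<alpha>) * monomial_value gs (tl a))" for a
  have tV: "t a \<in> pol V" for a
    unfolding t_def by (intro pol_closed(3) pol_closed(7) single_in_pol mv gV) simp
  define B0 where "B0 = {a \<in> B. hd a = \<alpha>}"
  show ?case
  proof
    assume mem: "(\<Sum>a\<in>B. single 0 (q a) * monomial_value (g # gs) a) \<in> Q 0"
    have "(\<Sum>a\<in>B. single 0 (q a) * monomial_value (g # gs) a) = g ^ \<alpha> * (\<Sum>a\<in>B. t a)"
      unfolding sum_distrib_left
    proof (rule sum.cong[OF refl])
      fix a assume "a \<in> B"
      then have "g ^ hd a = g ^ \<alpha> * g ^ (hd a - \<alpha>)" using \<alpha> by (simp flip: power_add)
      then show "single 0 (q a) * monomial_value (g # gs) a = g ^ \<alpha> * t a"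
        by (simp add: t_def mult_ac)
    qed
    then have "g ^ \<alpha> * (\<Sum>a\<in>B. t a) \<in> Q 0" using mem by (simp only:)
    then have "(\<Sum>a\<in>B. t a) \<in> Q 0" by (rule power[rotated]) (intro pol_closed(8) tV)
    then have all: "(\<Sum>a\<in>B. t a) \<in> Q 1" using Q01 by blast
    have rest: "(\<Sum>a\<in>B - B0. t a) \<in> Q 1"
    proof -
      have "t a \<in> Q 1" if a: "a \<in> B - B0" for a
      proof -
        have "\<alpha> < hd a" using \<alpha>[of a] a by (auto simp: B0_def)
        then obtain k where k: "hd a - \<alpha> = Suc k" by (metis Suc_diff_Suc)
        have "single 0 (q a) * (g ^ k * monomial_value gs (tl a)) \<in> pol V"
          by (intro pol_closed(3) pol_closed(7) single_in_pol mv gV) simp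
        then have "single 0 (q a) * (g ^ k * monomial_value gs (tl a)) * g \<in> Q 1" using g(1) by (rule cl1(4))
        then show ?thesis by (simp add: t_def k mult_ac)
      qed
      then have "(\<Sum>a\<in>A. t a) \<in> Q 1" if "A \<subseteq> B - B0" for A
        using that by (induction A rule: infinite_finite_induct) (simp_all add: cl1(2,3) del: One_nat_def)
      then show ?thesis by blast
    qed
    have "(\<Sum>a\<in>B. t a) = (\<Sum>a\<in>B - B0. t a) + (\<Sum>a\<in>B0. t a)"
      using Cons.prems(3) by (intro sum.subset_diff) (auto simp: B0_def)
    then have "(\<Sum>a\<in>B0. t a) = (\<Sum>a\<in>B. t a) - (\<Sum>a\<in>B - B0. t a)" by simp
    then have B0: "(\<Sum>a\<in>B0. t a) \<in> Q 1" using cl1(6)[OF all rest] by (simp only:)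
    have "(\<Sum>b\<in>tl ` B0. single 0 (q (\<alpha> # b)) * monomial_value gs b) = (\<Sum>a\<in>B0. t a)"
    proof (rule sum.reindex_cong[where l = "\<lambda>b. \<alpha> # b", symmetric])
      show "B0 = (\<lambda>b. \<alpha> # b) ` tl ` B0"
        using cons by (force simp: B0_def image_iff)
    qed (auto simp: t_def)
    then have "(\<Sum>b\<in>tl ` B0. single 0 (q (\<alpha> # b)) * monomial_value gs b) \<in> Q (Suc 0)" using B0 by simp
    moreover have "(\<Sum>b\<in>tl ` B0. single 0 (q (\<alpha> # b)) * monomial_value gs b) \<notin> (\<lambda>i. Q (Suc i)) 0"
    proof (rule Cons.IH)
      show "primeideal (Q (Suc i)) (sub_ring (pol V))" if "i \<le> length gs" for i
        using Cons.prems(1)[of "Suc i"] that by simp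
      show "gs ! i \<in> Q (Suc (Suc i)) - Q (Suc i) \<and> Q (Suc i) \<subseteq> Q (Suc (Suc i))" if "i < length gs" for i
        using Cons.prems(2)[of "Suc i"] that by simp
      show "finite (tl ` B0)" using Cons.prems(3) by (simp add: B0_def)
      have "\<alpha> \<in> hd ` B" unfolding \<alpha>_def using Cons.prems(3,4) by (intro Min_in) auto
      then show "tl ` B0 \<noteq> {}" by (auto simp: B0_def)
      fix b assume "b \<in> tl ` B0"
      then have "\<alpha> # b \<in> B" using cons by (auto simp: B0_def) 
      then show "length b = length gs \<and> q (\<alpha> # b) \<noteq> 0" using Cons.prems(5) by fastforce
    qed
    ultimately show False by simp
  qed
qed

section \<open>The dimension of a polynomial ring\<close>

definition exponent_box :: "'v set \<Rightarrow> nat \<Rightarrow> ('v \<Rightarrow>\<^sub>0 nat) set" where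
  "exponent_box W L = {m. keys m \<subseteq> W \<and> (\<forall>v. lookup m v \<le> L)}"

lemma exponent_box_mono: "L \<le> L' \<Longrightarrow> exponent_box W L \<subseteq> exponent_box W L'"
  by (auto simp: exponent_box_def intro: order_trans)

lemma card_exponent_box:
  assumes "finite W"
  shows "finite (exponent_box W L)" "card (exponent_box W L) \<le> (L + 1) ^ card W"
proof -
  let ?f = "\<lambda>m. restrict (lookup m) W"
  have inj: "inj_on ?f (exponent_box W L)"
  proof (rule inj_onI)
    fix m t assume mt: "m \<in> exponent_box W L" "t \<in> exponent_box W L" "?f m = ?f t"
    show "m = t"
    proof (rule poly_mapping_eqI)
      fix v
      show "lookup m v = lookup t v"
      proof (cases "v \<in> W")
        case True
        then show ?thesis using fun_cong[OF mt(3), of v] by simp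
      next
        case False
        then have "v \<notin> keys m" "v \<notin> keys t" using mt(1,2) by (auto simp: exponent_box_def)
        then show ?thesis by (simp add: in_keys_iff)
      qed
    qed
  qed
  have sub: "?f ` exponent_box W L \<subseteq> PiE W (\<lambda>_. {..L})" by (auto simp: exponent_box_def)
  have fin: "finite (PiE W (\<lambda>_. {..L}))" using assms by (intro finite_PiE) auto
  show "finite (exponent_box W L)" using finite_imageD[OF finite_subset[OF sub fin] inj] .
  show "card (exponent_box W L) \<le> (L + 1) ^ card W"
    using card_inj_on_le[OF inj sub fin] assms by (simp add: card_PiE)
qed

lemma keys_mult_box:
  assumes "keys p \<subseteq> exponent_box W L" "keys q \<subseteq> exponent_box W L'"
  shows "keys (p * q :: ('v, 'k::field) mpoly) \<subseteq> exponent_box W (L + L')"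
proof
  fix m assume "m \<in> keys (p * q)"
  then obtain s t where st: "m = s + t" "s \<in> keys p" "t \<in> keys q" using keys_mult[of p q] by blast
  then have "s \<in> exponent_box W L" "t \<in> exponent_box W L'" using assms by blast+
  then show "m \<in> exponent_box W (L + L')"
    by (auto simp: exponent_box_def st(1) keys_add_nat lookup_add add_mono)
qed

lemma keys_power_box:
  assumes "keys p \<subseteq> exponent_box W L"
  shows "keys (p ^ k :: ('v, 'k::field) mpoly) \<subseteq> exponent_box W (k * L)"
proof (induction k)
  case (Suc k)
  then show ?case using keys_mult_box[OF assms Suc] by simp
qed (auto simp: exponent_box_def)

lemma keys_monomial_value_box:
  assumes "\<And>g. g \<in> set gs \<Longrightarrow> keys g \<subseteq> exponent_box W D" "set a \<subseteq> {..M}" "length a = length gs"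
  shows "keys (monomial_value gs a :: ('v, 'k::field) mpoly) \<subseteq> exponent_box W (length gs * (M * D))"
  using assms
proof (induction gs arbitrary: a)
  case Nil
  then show ?case by (auto simp: exponent_box_def)
next
  case (Cons g gs)
  obtain k b where a: "a = k # b" using Cons.prems(3) by (cases a) auto
  have "keys (g ^ k) \<subseteq> exponent_box W (k * D)" using Cons.prems(1) by (intro keys_power_box) simp
  also have "\<dots> \<subseteq> exponent_box W (M * D)" using Cons.prems(2) by (intro exponent_box_mono) (simp add: a)
  finally have "keys (g ^ k) \<subseteq> exponent_box W (M * D)" .
  moreover have "keys (monomial_value gs b) \<subseteq> exponent_box W (length gs * (M * D))"
    using Cons.prems by (intro Cons.IH) (auto simp: a)
  ultimately show ?case using keys_mult_box by (fastforce simp: a)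
qed

lemma exists_box:
  assumes "finite A" "\<And>m. m \<in> A \<Longrightarrow> keys m \<subseteq> W"
  shows "\<exists>D. A \<subseteq> exponent_box W D"
  using assms
proof (induction A rule: finite_induct)
  case (insert m A)
  then obtain D where D: "A \<subseteq> exponent_box W D" by auto
  define L where "L = (\<Sum>v\<in>keys m. lookup m v)"
  have "lookup m v \<le> L" for v
  proof (cases "v \<in> keys m")
    case True
    then show ?thesis unfolding L_def by (intro member_le_sum) auto
  qed (simp add: in_keys_iff)
  then have "m \<in> exponent_box W L" using insert.prems by (simp add: exponent_box_def)
  then show ?case
    using D exponent_box_mono[of L "D + L" W] exponent_box_mono[of D "D + L" W] by (intro exI[of _ "D + L"]) auto
qed auto

lemma vector_space_mpoly: "vector_space (\<lambda>(c :: 'k::field) (p :: ('v, 'k) mpoly). single 0 c * p)"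
proof
  show "single 0 (1 :: 'k) * p = p" for p :: "('v, 'k) mpoly" by simp
qed (simp_all add: algebra_simps single_add mult_single flip: mult.assoc)

text \<open>More polynomials than variables are algebraically dependent, by counting. There are
  \<open>(M + 1)^n\<close> exponent vectors with entries up to \<open>M\<close>, and the
  corresponding products lie in the span of the monomials with exponents up to \<open>L\<close>, at
  most \<open>(L + 1)^r\<close> of them, where \<open>r < n\<close> and \<open>L\<close> is linear
  in \<open>M\<close>.\<close>

lemma exists_relation:
  fixes gs :: "('v, 'k::field) mpoly list"
  assumes W: "finite W" "card W < length gs" and gs: "\<And>g. g \<in> set gs \<Longrightarrow> \<forall>m\<in>keys g. keys m \<subseteq> W"
  shows "\<exists>B q. finite B \<and> B \<noteq> {} \<and> (\<forall>a\<in>B. length a = length gs \<and> q a \<noteq> 0) \<and>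
    (\<Sum>a\<in>B. single 0 (q a) * monomial_value gs a) = 0"
proof -
  interpret vs: vector_space "\<lambda>(c :: 'k) (p :: ('v, 'k) mpoly). single 0 c * p" by (rule vector_space_mpoly)
  define n where "n = length gs"
  obtain D where "(\<Union>g\<in>set gs. keys g) \<subseteq> exponent_box W D"
    using exists_box[of "\<Union>g\<in>set gs. keys g" W] gs by auto
  then have D: "keys g \<subseteq> exponent_box W D" if "g \<in> set gs" for g using that by blast
  define r where "r = card W"
  \<comment> \<open>Chosen so that \<open>(L + 1)^r\<close>, which is at most
    \<open>(n D + 1)^r (M + 1)^r\<close>, is at most \<open>M (M + 1)^r\<close> and hence below
    \<open>(M + 1)^(r + 1)\<close>.\<close>
  define M where "M = (n * D + 1) ^ r"
  define L where "L = n * (M * D)"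
  define A where "A = {a. set a \<subseteq> {..M} \<and> length a = n}"
  have A: "finite A" "card A = (M + 1) ^ n"
    unfolding A_def by (simp_all add: finite_lists_length_eq card_lists_length_eq)
  define T where "T = (\<lambda>m. single m (1 :: 'k)) ` exponent_box W L"
  have T: "finite T" "card T \<le> (L + 1) ^ r"
    using card_exponent_box[OF W(1), of L] card_image_le[of "exponent_box W L" "\<lambda>m. single m (1 :: 'k)"]
    unfolding T_def r_def by (auto intro: order_trans)
  have "L + 1 \<le> (n * D + 1) * (M + 1)" by (simp add: L_def algebra_simps)
  then have "(L + 1) ^ r \<le> ((n * D + 1) * (M + 1)) ^ r" by (rule power_mono) simp
  also have "\<dots> = M * (M + 1) ^ r" by (simp only: power_mult_distrib M_def)
  also have "\<dots> < (M + 1) * (M + 1) ^ r" by simp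
  also have "\<dots> = (M + 1) ^ Suc r" by simp
  also have "\<dots> \<le> (M + 1) ^ n" using W(2) by (intro power_increasing) (auto simp: r_def n_def)
  finally have lt: "card T < card A" using T(2) A(2) by simp
  define G where "G = monomial_value gs"
  have span: "G ` A \<subseteq> vs.span T"
  proof clarify
    fix a assume "a \<in> A"
    then have keys: "keys (G a) \<subseteq> exponent_box W L"
      unfolding G_def L_def n_def using D by (intro keys_monomial_value_box) (auto simp: A_def n_def)
    have "single m (lookup (G a) m) \<in> vs.span T" if "m \<in> keys (G a)" for m
    proof -
      have "single m 1 \<in> vs.span T" using keys that by (intro vs.span_base) (auto simp: T_def)
      then have "single 0 (lookup (G a) m) * single m 1 \<in> vs.span T" by (rule vs.span_scale)
      then show ?thesis by (simp add: mult_single)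
    qed
    then have "(\<Sum>m\<in>keys (G a). single m (lookup (G a) m)) \<in> vs.span T" by (rule vs.span_sum)
    then show "G a \<in> vs.span T" by (simp only: keys_sum_monomials[symmetric])
  qed
  show ?thesis
  \<comment> \<open>Linear dependence concerns the set of products, so it says nothing about
    exponent vectors with equal products; two such vectors give a relation by their
    difference.\<close>
  proof (cases "inj_on G A")
    case True
    have "vs.dependent (G ` A)"
    proof (rule ccontr)
      assume "\<not> vs.dependent (G ` A)"
      then have "card (G ` A) \<le> card T" using vs.independent_span_bound[OF T(1) _ span] by blast
      then show False using lt card_image[OF True] by simp
    qed
    then have "\<not> (\<forall>S\<subseteq>G ` A. finite S \<longrightarrow>
        (\<forall>u. (\<Sum>v\<in>S. single 0 (u v) * v) = 0 \<longrightarrow> (\<forall>v\<in>S. u v = 0)))"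
      by (simp only: vs.independent_explicit_finite_subsets[symmetric] not_not)
    then obtain S where S: "S \<subseteq> G ` A" "finite S"
      and "\<not> (\<forall>u. (\<Sum>v\<in>S. single 0 (u v) * v) = 0 \<longrightarrow> (\<forall>v\<in>S. u v = 0))" by blast
    from this(3) obtain u where u: "(\<Sum>v\<in>S. single 0 (u v) * v) = 0" "\<not> (\<forall>v\<in>S. u v = 0)" by blast
    then obtain v0 where v0: "v0 \<in> S" "u v0 \<noteq> 0" by blast
    define B where "B = {a \<in> A. G a \<in> S \<and> u (G a) \<noteq> 0}"
    have GB: "G ` B = {v \<in> S. u v \<noteq> 0}" using S(1) by (auto simp: B_def)
    have "(\<Sum>a\<in>B. single 0 (u (G a)) * G a) = (\<Sum>v\<in>G ` B. single 0 (u v) * v)"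
      using True by (subst sum.reindex) (auto simp: B_def inj_on_def)
    also have "\<dots> = (\<Sum>v\<in>S. single 0 (u v) * v)"
      unfolding GB using S(2) by (intro sum.mono_neutral_left) auto
    finally have "(\<Sum>a\<in>B. single 0 (u (G a)) * G a) = 0" using u(1) by simp
    moreover have "finite B" using A(1) by (simp add: B_def)
    moreover have "B \<noteq> {}" using v0 GB by blast
    ultimately show ?thesis
      by (intro exI[of _ B] exI[of _ "\<lambda>a. u (G a)"]) (auto simp: B_def A_def n_def G_def)
  next
    case False
    then obtain a b where ab: "a \<in> A" "b \<in> A" "G a = G b" "a \<noteq> b" by (auto simp: inj_on_def)
    define q :: "nat list \<Rightarrow> 'k" where "q c = (if c = a then 1 else -1)" for c
    have "(\<Sum>c\<in>{a, b}. single 0 (q c) * G c) = 0" using ab by (simp add: q_def single_uminus)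
    then show ?thesis
      using ab by (intro exI[of _ "{a, b}"] exI[of _ q]) (auto simp: q_def A_def n_def G_def)
  qed
qed

text \<open>Elements \<open>f i\<close> witnessing the strict inclusions may be replaced by
  polynomials in the variables outside \<open>C\<close>. In a longer chain there would be more of
  them than such variables, and the resulting relation contradicts
  \<open>prime_chain_no_relation\<close>.\<close>

theorem prime_chain_length_le:
  fixes Q :: "nat \<Rightarrow> ('v, 'k::field) mpoly set"
  assumes V: "finite V" and Q: "prime_chain (sub_ring (pol V)) k Q" and C: "poly_var ` C \<subseteq> Q 0"
  shows "k \<le> card (V - C)"
proof (rule ccontr)
  assume neg: "\<not> k \<le> card (V - C)"
  define W where "W = V - C"
  define n where "n = Suc (card W)"
  have nk: "n \<le> k" using neg by (simp add: n_def W_def)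
  have pr: "primeideal (Q i) (sub_ring (pol V))" if "i \<le> k" for i using Q that by (simp add: prime_chain_def)
  have id: "ideal (Q i) (sub_ring (pol V))" if "i \<le> k" for i using pr[OF that] by (rule primeideal.axioms(1))
  have sub: "Q i \<subset> Q (Suc i)" if "i < k" for i using Q that by (simp add: prime_chain_def)
  have mono: "Q 0 \<subseteq> Q i" if "i \<le> k" for i
    using that
  proof (induction i)
    case (Suc i)
    then show ?case using sub[of i] by auto
  qed simp
  have "\<exists>f. f \<in> Q (Suc i) - Q i" if "i < n" for i using sub[of i] that nk by auto
  then obtain f where f: "\<And>i. i < n \<Longrightarrow> f i \<in> Q (Suc i) - Q i" by metis
  \<comment> \<open>The discarded monomials involve a variable of \<open>C\<close> and thus lie in
    \<open>Q 0\<close>, so membership in each prime of the chain is unaffected.\<close>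
  define g where "g i = keep (\<lambda>m. keys m \<subseteq> W) (f i)" for i
  have g: "g i \<in> Q (Suc i) - Q i" if "i < n" for i
  proof -
    note c1 = ideal_sub_ringD[OF unital_subring_pol id[of "Suc i"]] and c0 = ideal_sub_ringD[OF unital_subring_pol id[of i]]
    have fV: "f i \<in> pol V" using f[OF that] c1(1) that nk by auto
    define h where "h = keep (\<lambda>m. \<not> keys m \<subseteq> W) (f i)"
    have eq: "f i = g i + h" unfolding g_def h_def by (rule keep_split)
    have "h \<in> mon_ideal V ((\<lambda>c. {c}) ` C)"
      using fV by (fastforce simp: h_def mon_ideal_def pol_def keys_keep W_def)
    then have "h \<in> Q 0" using mon_ideal_singles_subset[OF id C] by auto
    then have h: "h \<in> Q i" "h \<in> Q (Suc i)" using mono[of i] mono[of "Suc i"] that nk by auto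
    have "g i = f i - h" using eq by simp
    then have "g i \<in> Q (Suc i)" using c1(6) f[OF that] h(2) that nk by simp
    moreover have "g i \<notin> Q i" using c0(3)[of "g i" h] eq f[OF that] h(1) that nk by auto
    ultimately show ?thesis by blast
  qed
  define gs where "gs = map g [0..<n]"
  have gW: "\<forall>m\<in>keys h. keys m \<subseteq> W" if "h \<in> set gs" for h
    using that by (auto simp: gs_def g_def keys_keep)
  have "finite W" "card W < length gs" using V by (simp_all add: gs_def n_def W_def)
  have "\<exists>B q. finite B \<and> B \<noteq> {} \<and> (\<forall>a\<in>B. length a = length gs \<and> q a \<noteq> 0) \<and>
      (\<Sum>a\<in>B. single 0 (q a) * monomial_value gs a) = 0"
    by (rule exists_relation[OF \<open>finite W\<close> \<open>card W < length gs\<close>]) (rule gW)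
  then obtain B q where *: "finite B \<and> B \<noteq> {} \<and>
      (\<forall>a\<in>B. length a = length gs \<and> q a \<noteq> 0) \<and> (\<Sum>a\<in>B. single 0 (q a) * monomial_value gs a) = 0"
    by (elim exE)
  note B = conjunct1[OF *] conjunct1[OF conjunct2[OF *]] conjunct1[OF conjunct2[OF conjunct2[OF *]]]
    and rel = conjunct2[OF conjunct2[OF conjunct2[OF *]]]
  have "(\<Sum>a\<in>B. single 0 (q a) * monomial_value gs a) \<notin> Q 0"
  proof (rule prime_chain_no_relation)
    show "primeideal (Q i) (sub_ring (pol V))" if "i \<le> length gs" for i
      using that nk by (intro pr) (simp add: gs_def)
    show "gs ! i \<in> Q (Suc i) - Q i \<and> Q i \<subseteq> Q (Suc i)" if "i < length gs" for i
      using that g[of i] sub[of i] nk by (simp add: gs_def)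
    show "finite B" by (fact B(1))
    show "B \<noteq> {}" by (fact B(2))
    show "length a = length gs \<and> q a \<noteq> 0" if "a \<in> B" for a using B(3) that by blast
  qed
  then show False using rel ideal_sub_ringD(2)[OF unital_subring_pol id[of 0]] by simp
qed

section \<open>Maximal ideals of quotients\<close>

lemma (in cring) maximalideal_exists_inverse:
  assumes M: "maximalideal M R" and a: "a \<in> carrier R" "a \<notin> M"
  shows "\<exists>b\<in>carrier R. \<one> \<ominus> b \<otimes> a \<in> M"
proof -
  interpret M: maximalideal M R by fact
  have "adjoin R M a = M \<or> adjoin R M a = carrier R"
    using adjoin_superset(1)[OF M.is_ideal a(1)] ideal.Icarr[OF adjoin_ideal[OF M.is_ideal a(1)]]
    by (intro M.I_maximal adjoin_ideal M.is_ideal a(1)) auto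
  then have "adjoin R M a = carrier R" using adjoin_superset(2)[OF M.is_ideal a(1)] a(2) by auto
  then have "\<one> \<in> adjoin R M a" by simp
  then obtain j b where jb: "\<one> = j \<oplus> b \<otimes> a" "j \<in> M" "b \<in> carrier R" unfolding adjoin_def by blast
  have "j \<in> carrier R" using jb(2) M.Icarr by blast
  then have "\<one> \<ominus> b \<otimes> a = j" unfolding jb(1) using jb(3) a(1) by algebra
  then show ?thesis using jb(2,3) by auto
qed

text \<open>Says that \<open>R\<close> modulo the contraction of \<open>M\<close> is a field without
  forming this quotient, which is how Zariski's lemma expects it.\<close>

lemma (in ring_hom_cring) vimage_maximal_inverse:
  assumes surj: "h ` carrier R = carrier S" and M: "maximalideal M S"
    and s: "s \<in> carrier R" "h s \<notin> M"
  shows "\<exists>t\<in>carrier R. h (\<one>\<^bsub>R\<^esub> \<ominus>\<^bsub>R\<^esub> t \<otimes>\<^bsub>R\<^esub> s) \<in> M"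
proof -
  obtain b where b: "b \<in> carrier S" "\<one>\<^bsub>S\<^esub> \<ominus>\<^bsub>S\<^esub> b \<otimes>\<^bsub>S\<^esub> h s \<in> M"
    using S.maximalideal_exists_inverse[OF M hom_closed[OF s(1)] s(2)] by (elim bexE)
  obtain t where t: "t \<in> carrier R" "b = h t" using surj b(1) by blast
  have "h (\<one>\<^bsub>R\<^esub> \<ominus>\<^bsub>R\<^esub> t \<otimes>\<^bsub>R\<^esub> s) = \<one>\<^bsub>S\<^esub> \<ominus>\<^bsub>S\<^esub> b \<otimes>\<^bsub>S\<^esub> h s"
    using t s by (simp add: R.minus_eq S.minus_eq)
  then show ?thesis using b(2) t(1) by (intro bexI[of _ t]) (simp_all only:)
qed

text \<open>The part of the correspondence theorem that lets the origin serve as a maximal ideal of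
  the quotient.\<close>

lemma (in cring) maximalideal_Quot:
  assumes I: "ideal I R" and N: "maximalideal N R" "I \<subseteq> N"
  shows "maximalideal ((+>) I ` N) (R Quot I)" "{s \<in> carrier R. I +> s \<in> (+>) I ` N} = N"
proof -
  interpret I: ideal I R by fact
  interpret N: maximalideal N R by fact
  interpret q: ring_hom_cring R "R Quot I" "(+>) I" by (rule I.rcos_ring_hom_cring[OF is_cring])
  show eq: "{s \<in> carrier R. I +> s \<in> (+>) I ` N} = N"
  proof (intro equalityI subsetI)
    fix s assume "s \<in> {s \<in> carrier R. I +> s \<in> (+>) I ` N}"
    then obtain t where t: "s \<in> carrier R" "t \<in> N" "I +> s = I +> t" by auto
    then have "s \<ominus> t \<in> I" using quotient_eq_iff_same_a_r_cos[OF I, of s t] N.Icarr by simp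
    then have "(s \<ominus> t) \<oplus> t \<in> N" using N(2) t(2) N.a_closed by blast
    moreover have "(s \<ominus> t) \<oplus> t = s" using t(1) N.Icarr[OF t(2)] by algebra
    ultimately show "s \<in> N" by simp
  next
    fix s assume "s \<in> N"
    then show "s \<in> {s \<in> carrier R. I +> s \<in> (+>) I ` N}" using N.Icarr by simp
  qed
  show "maximalideal ((+>) I ` N) (R Quot I)"
  proof (rule maximalidealI)
    show "ideal ((+>) I ` N) (R Quot I)" by (rule ring_ideal_imp_quot_ideal[OF I N.is_ideal])
    show "carrier (R Quot I) \<noteq> (+>) I ` N"
    proof
      assume *: "carrier (R Quot I) = (+>) I ` N"
      have "carrier R \<subseteq> N" by (subst eq[symmetric]) (use * q.hom_closed in auto)
      then show False using N.I_notcarr N.Icarr by auto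
    qed
    fix J assume J: "ideal J (R Quot I)" "(+>) I ` N \<subseteq> J" "J \<subseteq> carrier (R Quot I)"
    have "ideal {r \<in> carrier R. I +> r \<in> J} R"
      by (rule ring_hom_ring.ideal_vimage[OF q.ring.is_ring_hom_ring J(1)])
    moreover have "N \<subseteq> {r \<in> carrier R. I +> r \<in> J}" using J(2) N.Icarr by auto
    ultimately have "{r \<in> carrier R. I +> r \<in> J} = N \<or> {r \<in> carrier R. I +> r \<in> J} = carrier R"
      by (intro N.I_maximal) auto
    moreover have "J = (+>) I ` {r \<in> carrier R. I +> r \<in> J}"
    proof (intro equalityI subsetI)
      fix t assume t: "t \<in> J"
      then have "t \<in> (+>) I ` carrier R" unfolding I.rcos_image_carrier using J(3) by (rule rev_subsetD)
      then obtain r where "r \<in> carrier R" "t = I +> r" by (elim imageE)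
      then show "t \<in> (+>) I ` {r \<in> carrier R. I +> r \<in> J}" using t by simp
    qed (elim imageE, simp)
    ultimately show "J = (+>) I ` N \<or> J = carrier (R Quot I)"
      unfolding I.rcos_image_carrier[symmetric] by (elim disjE) simp_all
  qed
qed

section \<open>Bipartite graphs with an ordered perfect matching\<close>

lemma extended_mon_ideal_singles:
  assumes "z \<notin> C"
  shows "extended z (mon_ideal V ((\<lambda>c. {c}) ` C) :: ('v, 'k::field) mpoly set)"
  unfolding extended_def
proof (intro ballI allI)
  fix p :: "('v, 'k) mpoly" and k assume p: "p \<in> mon_ideal V ((\<lambda>c. {c}) ` C)"
  show "strip z k p \<in> mon_ideal V ((\<lambda>c. {c}) ` C)"
    unfolding mon_ideal_def
  proof (intro CollectI conjI ballI)
    show "strip z k p \<in> pol V" using p by (intro strip_in_pol) (simp add: mon_ideal_def)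
    fix m assume "m \<in> keys (strip z k p)"
    then have "m + single z k \<in> keys p" by (auto simp: in_keys_iff lookup_strip split: if_splits)
    then obtain c where "c \<in> C" "c \<in> keys (m + single z k)" using p unfolding mon_ideal_def by blast
    then have "{c} \<in> (\<lambda>c. {c}) ` C" "{c} \<subseteq> keys m"
      using assms by (auto simp: keys_add_nat split: if_splits)
    then show "\<exists>e\<in>(\<lambda>c. {c}) ` C. e \<subseteq> keys m" by blast
  qed
qed

lemma origin_maximal: "maximalideal {p \<in> pol V. lookup p 0 = 0} (sub_ring (pol V :: ('v, 'k::field) mpoly set))"
    (is "maximalideal ?N ?R")
proof -
  have mult: "lookup (r * a) 0 = 0" if "lookup a 0 = 0" for r a :: "('v, 'k) mpoly"
  proof (rule ccontr)
    assume "lookup (r * a) 0 \<noteq> 0"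
    then have "0 \<in> keys (r * a)" by (simp add: in_keys_iff)
    then obtain s t where st: "s + t = 0" "t \<in> keys a" using keys_mult[of r a] by fastforce
    have "t = 0"
    proof (rule poly_mapping_eqI)
      fix v show "lookup t v = lookup 0 v" using arg_cong[OF st(1), of "\<lambda>m. lookup m v"] by (simp add: lookup_add)
    qed
    then show False using st(2) that by (simp add: in_keys_iff)
  qed
  have N: "ideal ?N ?R"
    by (rule ideal_sub_ringI[OF unital_subring_pol])
      (auto simp: lookup_add mult intro: pol_closed)
  show ?thesis
  proof (rule maximalidealI[OF N])
    have "1 \<in> (pol V :: ('v, 'k) mpoly set)" "1 \<notin> ?N" by (simp_all add: pol_closed)
    then show "carrier ?R \<noteq> ?N" by (metis sub_ring_simps(1))
    fix J assume J: "ideal J ?R" "?N \<subseteq> J" "J \<subseteq> carrier ?R"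
    note cl = ideal_sub_ringD[OF unital_subring_pol J(1)]
    show "J = ?N \<or> J = carrier ?R"
    proof (cases "J \<subseteq> ?N")
      case False
      then obtain p where p: "p \<in> J" "lookup p 0 \<noteq> 0" using cl(1) by blast
      define c where "c = lookup p 0"
      have c0: "single 0 c \<in> (pol V :: ('v, 'k) mpoly set)" by (intro single_in_pol) simp
      have "p - single 0 c \<in> pol V" using p(1) cl(1) c0 by (intro pol_closed(2)) auto
      then have "p - single 0 c \<in> J" using J(2) by (auto simp: lookup_minus c_def)
      then have "p - (p - single 0 c) \<in> J" by (rule cl(6)[OF p(1)])
      then have "single 0 c \<in> J" by simp
      then have "single 0 (inverse c) * single 0 c \<in> J" by (intro cl(4) single_in_pol) simp_all
      then have "1 \<in> J" using p(2) by (simp add: mult_single c_def)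
      then show ?thesis using ideal.one_imp_carrier[OF J(1)] by simp
    qed (use J(2) in blast)
  qed
qed

locale ordered_bipartite_graph =
  fixes V :: "'v set" and E :: "'v set set" and n :: nat and x y :: "nat \<Rightarrow> 'v"
  assumes graph: "finite_simple_graph V E"
    and vertices: "V = x ` {1..n} \<union> y ` {1..n}"
    and distinct: "inj_on x {1..n}" "inj_on y {1..n}" "x ` {1..n} \<inter> y ` {1..n} = {}"
    and bipartite: "\<forall>e\<in>E. \<exists>w\<in>x ` {1..n}. \<exists>w'\<in>y ` {1..n}. e = {w, w'}"
    and perfect_matching: "\<forall>i\<in>{1..n}. {x i, y i} \<in> E"
    and ordered: "\<forall>i\<in>{1..n}. \<forall>j\<in>{1..n}. {x i, y j} \<in> E \<longrightarrow> i \<le> j"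
begin

lemma set_indices: "set [1..<Suc n] = {1..n}"
  by auto

lemma finite_V: "finite V"
  using graph by (simp add: finite_simple_graph_def)

lemma x_V: "i \<in> {1..n} \<Longrightarrow> x i \<in> V" and y_V: "i \<in> {1..n} \<Longrightarrow> y i \<in> V"
  using vertices by auto

lemma xy_neq: "i \<in> {1..n} \<Longrightarrow> j \<in> {1..n} \<Longrightarrow> x i \<noteq> y j"
  using distinct(3) by blast

lemma x_eq_iff: "i \<in> {1..n} \<Longrightarrow> j \<in> {1..n} \<Longrightarrow> x i = x j \<longleftrightarrow> i = j"
  and y_eq_iff: "i \<in> {1..n} \<Longrightarrow> j \<in> {1..n} \<Longrightarrow> y i = y j \<longleftrightarrow> i = j"
  using distinct(1,2) by (auto dest: inj_onD)

lemma edge_cases: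
  assumes "e \<in> E"
  obtains i j where "i \<in> {1..n}" "j \<in> {1..n}" "e = {x i, y j}" "i \<le> j"
proof -
  obtain i j where ij: "i \<in> {1..n}" "j \<in> {1..n}" "e = {x i, y j}" using bipartite assms by blast
  then have "i \<le> j" using ordered assms by blast
  then show thesis using that ij by blast
qed

lemma card_V: "card V = 2 * n"
  unfolding vertices using distinct by (subst card_Un_disjoint) (auto simp: card_image)

lemma cring_quotient: "cring (polynomial_ring V Quot (edge_ideal V E :: ('v, 'k::field) mpoly set))"
  unfolding polynomial_ring_eq edge_ideal_eq[OF graph]
  by (rule ideal.quotient_is_cring[OF ideal_mon_ideal cring_sub_ring[OF unital_subring_pol]])

lemma noetherian_quotient:
  "noetherian_ring (polynomial_ring V Quot (edge_ideal V E :: ('v, 'k::field) mpoly set))"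
  unfolding polynomial_ring_eq edge_ideal_eq[OF graph]
  by (rule ideal.noetherian_quotient[OF ideal_mon_ideal cring_sub_ring[OF unital_subring_pol]
        noetherian_pol[OF finite_V]])

section \<open>Necessity of the condition\<close>

lemma independent_superset:
  assumes "F0 \<subseteq> V" "\<And>e. e \<in> E \<Longrightarrow> \<not> e \<subseteq> F0"
  obtains F where "F0 \<subseteq> F" "F \<subseteq> V" "\<And>e. e \<in> E \<Longrightarrow> \<not> e \<subseteq> F"
    "\<And>v. v \<in> V - F \<Longrightarrow> \<exists>e\<in>E. e \<subseteq> insert v F"
proof -
  define A where "A = {F. F0 \<subseteq> F \<and> F \<subseteq> V \<and> (\<forall>e\<in>E. \<not> e \<subseteq> F)}"
  have "finite A" by (rule finite_subset[of _ "Pow V"]) (auto simp: A_def finite_V)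
  moreover have "F0 \<in> A" using assms by (auto simp: A_def)
  ultimately obtain F where F: "F \<in> A" "\<And>G. G \<in> A \<Longrightarrow> F \<subseteq> G \<Longrightarrow> G = F"
    using finite_has_maximal2[of A F0] by metis
  show thesis
  proof (rule that[of F])
    fix v assume v: "v \<in> V - F"
    then have "insert v F \<notin> A" using F(2)[of "insert v F"] by auto
    then show "\<exists>e\<in>E. e \<subseteq> insert v F" using F(1) v by (auto simp: A_def)
  qed (use F(1) in \<open>auto simp: A_def\<close>)
qed

lemma card_independent_less:
  assumes F: "F \<subseteq> V" "\<And>e. e \<in> E \<Longrightarrow> \<not> e \<subseteq> F" and j: "j \<in> {1..n}" "x j \<notin> F" "y j \<notin> F"
  shows "card F < n"
proof -
  have "F \<subseteq> (\<Union>l\<in>{1..n} - {j}. F \<inter> {x l, y l})" using F(1) j vertices by fastforce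
  then have "card F \<le> card (\<Union>l\<in>{1..n} - {j}. F \<inter> {x l, y l})" by (intro card_mono) auto
  also have "\<dots> \<le> (\<Sum>l\<in>{1..n} - {j}. card (F \<inter> {x l, y l}))" by (intro card_UN_le) simp
  also have "\<dots> \<le> (\<Sum>l\<in>{1..n} - {j}. 1)"
  proof (rule sum_mono)
    fix l assume "l \<in> {1..n} - {j}"
    then have "\<not> {x l, y l} \<subseteq> F" using F(2) perfect_matching by blast
    then have "F \<inter> {x l, y l} \<subseteq> {x l} \<or> F \<inter> {x l, y l} \<subseteq> {y l}" by blast
    then show "card (F \<inter> {x l, y l}) \<le> 1" using card_mono[of "{x l}"] card_mono[of "{y l}"] by fastforce
  qed
  also have "\<dots> < n" using j(1) by simp
  finally show ?thesis .
qed

text \<open>Every edge contains some \<open>x_i\<close>, so modulo these variables nothing is left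
  of the edge ideal. The \<open>y_i\<close> are then independent variables, which bounds the
  dimension at the origin from below by \<open>n\<close>.\<close>

lemma adjoin_all_x:
  "adjoin_list (sub_ring (pol V)) (mon_ideal V E) (map (\<lambda>i. poly_var (x i)) [1..<Suc n]) =
    (mon_ideal V ((\<lambda>c. {c}) ` x ` {1..n}) :: ('v, 'k::field) mpoly set)"
    (is "?L = ?J")
proof
  interpret R: cring "sub_ring (pol V :: ('v, 'k) mpoly set)" by (rule cring_sub_ring[OF unital_subring_pol])
  have gs: "set (map (\<lambda>i. poly_var (x i)) [1..<Suc n]) = (poly_var ` x ` {1..n} :: ('v, 'k) mpoly set)"
    by (auto simp: image_image)
  have gsV: "set (map (\<lambda>i. poly_var (x i)) [1..<Suc n]) \<subseteq> carrier (sub_ring (pol V :: ('v, 'k) mpoly set))"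
    unfolding gs using x_V by (auto intro: poly_var_in_pol)
  have L: "ideal ?L (sub_ring (pol V))" by (rule R.adjoin_list_ideal[OF ideal_mon_ideal gsV])
  show "?L \<subseteq> ?J"
  proof (rule R.adjoin_list_minimal[OF ideal_mon_ideal])
    show "mon_ideal V E \<subseteq> ?J"
    proof (rule mon_ideal_cong_subset)
      fix e assume "e \<in> E"
      then show "\<exists>e'\<in>(\<lambda>c. {c}) ` x ` {1..n}. e' \<subseteq> e" by (elim edge_cases) auto
    qed
    show "set (map (\<lambda>i. poly_var (x i)) [1..<Suc n]) \<subseteq> ?J"
      unfolding gs using x_V by (auto simp: mon_ideal_def poly_var_in_pol) (auto simp: poly_var_def)
  qed
  show "?J \<subseteq> ?L"
    using R.adjoin_list_superset[OF ideal_mon_ideal gsV] gs by (intro mon_ideal_singles_subset L) auto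
qed

lemma condition_if_cohen_macaulay:
  assumes CM: "cohen_macaulay_graph TYPE('k::field) V E"
    and ijk: "i \<in> {1..n}" "j \<in> {1..n}" "k \<in> {1..n}" "{x i, y j} \<in> E" "{x j, y k} \<in> E"
  shows "{x i, y k} \<in> E"
proof (rule ccontr)
  assume neg: "{x i, y k} \<notin> E"
  have indep: "\<not> e \<subseteq> {x i, y k}" if eE: "e \<in> E" for e
  proof
    assume e: "e \<subseteq> {x i, y k}"
    obtain a b where ab: "a \<in> {1..n}" "b \<in> {1..n}" "e = {x a, y b}" by (rule edge_cases[OF eE])
    then have "x a = x i" "y b = y k" using e xy_neq[OF ab(1) ijk(3)] xy_neq[OF ijk(1) ab(2)] unfolding ab(3) by auto
    then show False using ab neg eE by simp
  qed
  have ikV: "{x i, y k} \<subseteq> V" using x_V y_V ijk by blast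
  obtain F where F: "{x i, y k} \<subseteq> F" "F \<subseteq> V" "\<And>e. e \<in> E \<Longrightarrow> \<not> e \<subseteq> F"
    "\<And>v. v \<in> V - F \<Longrightarrow> \<exists>e\<in>E. e \<subseteq> insert v F"
    by (rule independent_superset[OF ikV indep, rotated]) (rule that; assumption | assumption)+
  \<comment> \<open>\<open>F\<close> contains \<open>y k\<close>, a neighbour of \<open>x j\<close>,
    and \<open>x i\<close>, a neighbour of \<open>y j\<close>.\<close>
  have "x j \<notin> F" "y j \<notin> F" using F(1) F(3)[OF ijk(4)] F(3)[OF ijk(5)] by auto
  then have card: "card F < n" using card_independent_less[OF F(2,3) ijk(2)] by blast
  define R where "R = sub_ring (pol V :: ('v, 'k) mpoly set)"
  define I where "I = (mon_ideal V E :: ('v, 'k) mpoly set)"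
  define N where "N = {p \<in> (pol V :: ('v, 'k) mpoly set). lookup p 0 = 0}"
  interpret R: cring R unfolding R_def by (rule cring_sub_ring[OF unital_subring_pol])
  have I: "ideal I R" unfolding I_def R_def by (rule ideal_mon_ideal)
  have N: "maximalideal N R" unfolding N_def R_def by (rule origin_maximal)
  have E_ne: "e \<noteq> {}" if "e \<in> E" for e using edge_cases[OF that] by auto
  have IN: "I \<subseteq> N"
  proof
    fix p assume p: "p \<in> I"
    have "0 \<notin> keys p"
    proof
      assume "0 \<in> keys p"
      then obtain e where "e \<in> E" "e \<subseteq> keys (0 :: 'v \<Rightarrow>\<^sub>0 nat)" using p unfolding I_def mon_ideal_def by blast
      then show False using E_ne by auto
    qed
    then show "p \<in> N" using p by (auto simp: N_def I_def mon_ideal_def in_keys_iff)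
  qed
  define M where "M = (+>\<^bsub>R\<^esub>) I ` N"
  have M: "maximalideal M (R Quot I)" and NM: "{s \<in> carrier R. I +>\<^bsub>R\<^esub> s \<in> M} = N"
    unfolding M_def by (rule R.maximalideal_Quot[OF I N IN])+
  have Mp: "primeideal M (R Quot I)"
    by (rule cring.maximalideal_prime[OF ideal.quotient_is_cring[OF I R.is_cring] M])
  have "cohen_macaulay_ring (R Quot I)"
    using CM unfolding cohen_macaulay_graph_def polynomial_ring_eq edge_ideal_eq[OF graph] R_def I_def .
  then have CMM: "cohen_macaulay_local_ring (localization (R Quot I) (carrier (R Quot I) - M))"
    using M unfolding cohen_macaulay_ring_def by blast
  note loc = localization_Quot[OF R.is_cring I Mp, unfolded NM]
  \<comment> \<open>The product of the variables in \<open>F\<close>. By maximality of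
    \<open>F\<close>, each variable outside \<open>F\<close> completes an edge with \<open>F\<close>
    and so annihilates \<open>w\<close> modulo the edge ideal.\<close>
  define w :: "('v, 'k) mpoly" where "w = single (\<Sum>v\<in>F. single v 1) 1"
  have finF: "finite F" using F(2) finite_V by (rule finite_subset)
  note keysF = keys_sum_singles[OF finF]
  define gs where "gs = map (\<lambda>i. poly_var (x i) :: ('v, 'k) mpoly) [1..<Suc n]"
  define fs where "fs = map (\<lambda>i. poly_var (y i) :: ('v, 'k) mpoly) [1..<Suc n]"
  have varN: "poly_var v \<in> N" if "v \<in> V" for v
  proof -
    have "single v (1 :: nat) \<noteq> 0" by (metis lookup_single_eq lookup_zero one_neq_zero)
    then show ?thesis
      using poly_var_in_pol[OF that] unfolding N_def poly_var_def by (simp add: lookup_single_not_eq)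
  qed
  have "\<exists>k Q. length fs \<le> k \<and> prime_chain R k Q \<and> poly_var ` (V - F) \<subseteq> Q 0"
  proof (rule localization_at_prime.cohen_macaulay_T_imp_prime_chain[OF loc CMM])
    show "set gs \<subseteq> N" "set fs \<subseteq> N" using varN x_V y_V by (auto simp: gs_def fs_def)
    \<comment> \<open>Each \<open>y_i\<close> is taken as the value of the polynomial
      \<open>[:0, 1:]\<close> at itself.\<close>
    have "weakly_regular R (mon_ideal V ((\<lambda>c. {c}) ` x ` {1..n}))
        (map (\<lambda>z. poly [:0, 1:] (poly_var z)) (map y [1..<Suc n]))"
      unfolding R_def
    proof (rule weakly_regular_univariate)
      show "distinct (map y [1..<Suc n])" 
        by (simp only: distinct_map distinct_upt set_indices distinct(2) simp_thms)
      show "set (map y [1..<Suc n]) \<subseteq> V" using y_V by auto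
      show "extended z (mon_ideal V ((\<lambda>c. {c}) ` x ` {1..n}) :: ('v, 'k) mpoly set)" if "z \<in> set (map y [1..<Suc n])" for z
      proof (rule extended_mon_ideal_singles)
        have "z \<in> y ` {1..n}" using that by (simp only: set_map set_indices)
        then show "z \<notin> x ` {1..n}" using distinct(3) by blast
      qed
      show "coeffs_in (pol {} :: ('v, 'k) mpoly set) [:0, 1:] \<and> [:0, 1 :: ('v, 'k) mpoly:] \<noteq> 0"
        by (simp add: coeffs_in_def coeff_pCons pol_closed split: nat.split)
    qed (rule ideal_mon_ideal)
    then show "weakly_regular R (adjoin_list R I gs) fs"
      unfolding gs_def fs_def R_def I_def adjoin_all_x by (simp add: comp_def)
    show "w \<in> carrier R" using F(2) keysF by (simp add: R_def w_def single_in_pol)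
    \<comment> \<open>The nonzero constant term of \<open>u\<close> leaves the monomial of
      \<open>w\<close> in the product, and its support \<open>F\<close> contains no edge.\<close>
    show "u \<otimes>\<^bsub>R\<^esub> w \<notin> I" if "u \<in> carrier R - N" for u
    proof
      assume "u \<otimes>\<^bsub>R\<^esub> w \<in> I"
      then have "w * u \<in> I" by (simp add: R_def mult.commute)
      moreover have "(\<Sum>v\<in>F. single v 1) \<in> keys (w * u)"
        using that lookup_single_mult[of "\<Sum>v\<in>F. single v 1" 1 u 0]
        by (simp add: in_keys_iff w_def R_def N_def)
      ultimately obtain e where "e \<in> E" "e \<subseteq> keys (\<Sum>v\<in>F. single v (1 :: nat))"
        unfolding I_def mon_ideal_def by blast
      then show False using F(3) keysF by simp
    qed
    show "poly_var ` (V - F) \<subseteq> {a \<in> carrier R. a \<otimes>\<^bsub>R\<^esub> w \<in> I}"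
    proof clarify
      fix v assume v: "v \<in> V" "v \<notin> F"
      obtain e where e: "e \<in> E" "e \<subseteq> insert v F" using F(4) v by blast
      have "poly_var v * w = single (single v 1 + (\<Sum>v\<in>F. single v 1)) 1"
        by (simp add: poly_var_def w_def mult_single)
      then have "poly_var v * w \<in> I"
        using e F(2) v(1) keysF by (auto simp: I_def mon_ideal_def pol_def keys_add_nat intro!: bexI[of _ e])
      then show "poly_var v \<in> carrier R \<and> poly_var v \<otimes>\<^bsub>R\<^esub> w \<in> I"
        using poly_var_in_pol[OF v(1)] by (simp add: R_def)
    qed
  qed
  moreover have "length fs = n" by (simp add: fs_def del: upt_Suc)
  ultimately obtain k Q where kQ: "n \<le> k" "prime_chain R k Q" "poly_var ` (V - F) \<subseteq> Q 0"
    unfolding \<open>length fs = n\<close> by (elim exE conjE)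
  have "k \<le> card (V - (V - F))"
    by (rule prime_chain_length_le[OF finite_V kQ(2)[unfolded R_def] kQ(3)])
  moreover have "V - (V - F) = F" using F(2) by blast
  ultimately show False using card kQ(1) by simp
qed

section \<open>Sufficiency of the condition\<close>

lemma poly_pol_const:
  "coeffs_in (pol {}) q \<Longrightarrow> a \<in> pol V \<Longrightarrow> poly q a \<in> (pol V :: ('v, 'k::field) mpoly set)"
  using poly_in_ring_adjoin[OF unital_subring_pol]
    ring_adjoin_minimal[OF unital_subring_pol pol_mono[of "{}" V]] by blast

text \<open>Write \<open>i\<close> below \<open>j\<close> when \<open>{x i, y j}\<close> is an edge.
  The indices of the \<open>y\<close> in \<open>C\<close> are closed upwards and those of the
  \<open>x\<close> downwards. Hence, once \<open>C\<close> meets every pair, it meets every edge: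
  \<open>y i\<close> in \<open>C\<close> forces \<open>y j\<close> in \<open>C\<close>.\<close>

definition good :: "'v set \<Rightarrow> bool" where
  "good C \<longleftrightarrow> C \<subseteq> V \<and> (\<forall>i\<in>{1..n}. \<not> (x i \<in> C \<and> y i \<in> C)) \<and>
    (\<forall>i\<in>{1..n}. \<forall>j\<in>{1..n}. {x i, y j} \<in> E \<longrightarrow>
       (y i \<in> C \<longrightarrow> y j \<in> C) \<and> (x j \<in> C \<longrightarrow> x i \<in> C))"

lemma goodD:
  assumes "good C"
  shows "C \<subseteq> V" and "i \<in> {1..n} \<Longrightarrow> x i \<in> C \<Longrightarrow> y i \<notin> C"
    and "i \<in> {1..n} \<Longrightarrow> j \<in> {1..n} \<Longrightarrow> {x i, y j} \<in> E \<Longrightarrow> y i \<in> C \<Longrightarrow> y j \<in> C"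
    and "i \<in> {1..n} \<Longrightarrow> j \<in> {1..n} \<Longrightarrow> {x i, y j} \<in> E \<Longrightarrow> x j \<in> C \<Longrightarrow> x i \<in> C"
  using assms unfolding good_def by blast+

definition alive :: "'v set \<Rightarrow> nat set" where
  "alive C = {i \<in> {1..n}. x i \<notin> C \<and> y i \<notin> C}"

lemma finite_alive [simp]: "finite (alive C)"
  by (simp add: alive_def)

text \<open>The edges are absorbed by the variables in \<open>C\<close>, and modulo these
  \<open>x_i + y_i\<close> becomes the variable of the pair outside \<open>C\<close>. What remains
  are nonzero univariate polynomials in distinct variables.\<close>

lemma weakly_regular_if_no_alive:
  fixes p :: "nat \<Rightarrow> ('v, 'k::field) mpoly poly"
  assumes p: "\<And>i. i \<in> {1..n} \<Longrightarrow> coeffs_in (pol {}) (p i) \<and> p i \<noteq> 0"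
    and C: "good C" and alive: "alive C = {}"
  shows "weakly_regular (sub_ring (pol V)) (mon_ideal V (E \<union> (\<lambda>c. {c}) ` C))
    (map (\<lambda>i. poly (p i) (poly_var (x i) + poly_var (y i))) [1..<Suc n])"
proof -
  note g = goodD[OF C]
  define J where "J = (mon_ideal V ((\<lambda>c. {c}) ` C) :: ('v, 'k) mpoly set)"
  have J: "ideal J (sub_ring (pol V))" unfolding J_def by (rule ideal_mon_ideal)
  have "mon_ideal V (E \<union> (\<lambda>c. {c}) ` C) = J"
    unfolding J_def
  proof (intro equalityI mon_ideal_cong_subset)
    fix e assume "e \<in> E \<union> (\<lambda>c. {c}) ` C"
    then show "\<exists>e'\<in>(\<lambda>c. {c}) ` C. e' \<subseteq> e"
    proof
      assume e: "e \<in> E"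
      obtain i j where ij: "i \<in> {1..n}" "j \<in> {1..n}" "e = {x i, y j}" by (rule edge_cases[OF e])
      have "x i \<in> C \<or> y i \<in> C" using alive ij(1) unfolding alive_def by blast
      then have "x i \<in> C \<or> y j \<in> C" using g(3)[OF ij(1,2)] e ij(3) by blast
      then show ?thesis using ij(3) by blast
    qed blast
  qed blast
  moreover have "weakly_regular (sub_ring (pol V)) J (map (\<lambda>i. poly (p i) (poly_var (x i) + poly_var (y i))) [1..<Suc n])"
  proof -
    define z where "z i = (if x i \<in> C then y i else x i)" for i
    have z: "z i \<in> V" "z i \<notin> C" "poly_var (x i) + poly_var (y i) - poly_var (z i) \<in> J" if i: "i \<in> {1..n}" for i
    proof -
      have mem: "poly_var v \<in> J" if "v \<in> C" for v
        using that g(1) poly_var_in_pol[of v V] by (auto simp: J_def mon_ideal_def poly_var_def)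
      have "x i \<in> C \<or> y i \<in> C" using alive i unfolding alive_def by blast
      then show "z i \<in> V" "z i \<notin> C" "poly_var (x i) + poly_var (y i) - poly_var (z i) \<in> J"
        using g(2)[OF i] mem x_V[OF i] y_V[OF i] by (auto simp: z_def)
    qed
    have inj: "inj_on z {1..n}"
    proof (rule inj_onI)
      fix i j assume ij: "i \<in> {1..n}" "j \<in> {1..n}" "z i = z j"
      then show "i = j"
        using xy_neq[OF ij(1,2)] xy_neq[OF ij(2,1)] x_eq_iff[OF ij(1,2)] y_eq_iff[OF ij(1,2)]
        unfolding z_def by (metis (full_types))
    qed
    \<comment> \<open>The polynomials are reindexed from pairs to surviving variables, as
      \<open>weakly_regular_univariate\<close> expects.\<close>
    define q where "q v = p (the_inv_into {1..n} z v)" for v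
    have q: "q (z i) = p i" if "i \<in> {1..n}" for i
      unfolding q_def by (simp only: the_inv_into_f_f[OF inj that])
    show ?thesis
    proof (rule weakly_regular_cong[OF unital_subring_pol J])
      show "weakly_regular (sub_ring (pol V)) J (map (\<lambda>z. poly (q z) (poly_var z)) (map z [1..<Suc n]))"
      proof (rule weakly_regular_univariate[OF J])
        show "distinct (map z [1..<Suc n])"
          by (simp only: distinct_map distinct_upt set_indices inj simp_thms)
        show "set (map z [1..<Suc n]) \<subseteq> V"
          unfolding set_map set_indices using z(1) by blast
        fix v assume "v \<in> set (map z [1..<Suc n])"
        then obtain i where i: "i \<in> {1..n}" "v = z i" unfolding set_map set_indices by blast
        show "extended v J" unfolding J_def i(2) by (rule extended_mon_ideal_singles[OF z(2)[OF i(1)]])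
        show "coeffs_in (pol {}) (q v) \<and> q v \<noteq> 0" using p[OF i(1)] by (simp add: i(2) q[OF i(1)])
      qed
      show "list_all2 (\<lambda>f g. f \<in> pol V \<and> g \<in> pol V \<and> f - g \<in> J)
          (map (\<lambda>i. poly (p i) (poly_var (x i) + poly_var (y i))) [1..<Suc n])
          (map (\<lambda>z. poly (q z) (poly_var z)) (map z [1..<Suc n]))"
        unfolding map_map list_all2_map1 list_all2_map2
      proof (rule list_all2_same[THEN iffD2], intro ballI)
        fix i assume "i \<in> set [1..<Suc n]"
        then have i: "i \<in> {1..n}" by (simp only: set_indices)
        have V: "poly_var (x i) + poly_var (y i) \<in> (pol V :: ('v, 'k) mpoly set)" "poly_var (z i) \<in> (pol V :: ('v, 'k) mpoly set)"
          using x_V[OF i] y_V[OF i] z(1)[OF i] by (simp_all add: poly_var_in_pol pol_closed(6))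
        have pi: "coeffs_in (pol {}) (p i)" using p[OF i] by blast
        then have "coeffs_in (pol V) (p i)" using pol_mono[of "{}" V] by (auto simp: coeffs_in_def)
        then have "poly (p i) (poly_var (x i) + poly_var (y i)) - poly (p i) (poly_var (z i)) \<in> J"
          by (intro poly_diff_mem[OF unital_subring_pol J] V z(3)[OF i])
        then show "poly (p i) (poly_var (x i) + poly_var (y i)) \<in> pol V \<and>
            ((\<lambda>z. poly (q z) (poly_var z)) \<circ> z) i \<in> pol V \<and>
            poly (p i) (poly_var (x i) + poly_var (y i)) - ((\<lambda>z. poly (q z) (poly_var z)) \<circ> z) i \<in> J"
          using poly_pol_const[OF pi] V by (simp add: q[OF i])
      qed
    qed
  qed
  ultimately show ?thesis by simp
qed

text \<open>The ideals \<open>J\<close> generated by the edges and a good set \<open>C\<close> of variables are closed under \<open>J : y\<^sub>d\<close> and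
  \<open>J + (y\<^sub>d)\<close>, where \<open>d\<close> is the largest index of a pair not meeting \<open>C\<close>.\<close>

lemma weakly_regular_good:
  fixes p :: "nat \<Rightarrow> ('v, 'k::field) mpoly poly"
  assumes trans: "\<And>i j k. \<lbrakk>i \<in> {1..n}; j \<in> {1..n}; k \<in> {1..n}; i < j; j < k;
      {x i, y j} \<in> E; {x j, y k} \<in> E\<rbrakk> \<Longrightarrow> {x i, y k} \<in> E"
    and p: "\<And>i. i \<in> {1..n} \<Longrightarrow> coeffs_in (pol {}) (p i) \<and> p i \<noteq> 0"
    and C: "good C"
  shows "weakly_regular (sub_ring (pol V)) (mon_ideal V (E \<union> (\<lambda>c. {c}) ` C))
    (map (\<lambda>i. poly (p i) (poly_var (x i) + poly_var (y i))) [1..<Suc n])"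
  using C
proof (induction "card (alive C)" arbitrary: C rule: less_induct)
  case less
  note g = goodD[OF less.prems]
  show ?case
  proof (cases "alive C = {}")
    case True
    show ?thesis by (rule weakly_regular_if_no_alive[OF p less.prems True])
  next
    case False
    define d where "d = Max (alive C)"
    have "d \<in> alive C" unfolding d_def using False by (intro Max_in) simp_all
    then have d: "d \<in> {1..n}" "x d \<notin> C" "y d \<notin> C" by (simp_all add: alive_def)
    have dmax: "j \<le> d" if "j \<in> alive C" for j unfolding d_def using that by simp
    have edd: "{x d, y d} \<in> E" using perfect_matching d(1) by blast
    define C1 where "C1 = insert (y d) C"
    \<comment> \<open>\<open>C1\<close> describes \<open>J + (y_d)\<close> and \<open>C2\<close>
      describes \<open>J : y_d\<close>, where dividing by \<open>y_d\<close> shrinks each edge at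
      \<open>y_d\<close> to its other endpoint.\<close>
    define C2 where "C2 = C \<union> {x i | i. i \<in> {1..n} \<and> {x i, y d} \<in> E}"
    have xC1: "x i \<in> C1 \<longleftrightarrow> x i \<in> C" if "i \<in> {1..n}" for i
      using xy_neq[OF that d(1)] by (simp add: C1_def)
    have yC1: "y i \<in> C1 \<longleftrightarrow> y i \<in> C \<or> i = d" if "i \<in> {1..n}" for i
      using y_eq_iff[OF that d(1)] by (auto simp: C1_def)
    have yC2: "y i \<in> C2 \<longleftrightarrow> y i \<in> C" if "i \<in> {1..n}" for i
      using xy_neq[OF _ that] by (auto simp: C2_def) (metis atLeastAtMost_iff)
    have xC2: "x i \<in> C2 \<longleftrightarrow> x i \<in> C \<or> {x i, y d} \<in> E" if "i \<in> {1..n}" for i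
      using x_eq_iff[OF that] that unfolding C2_def by blast
    have good1: "good C1"
      unfolding good_def
    proof (intro conjI ballI impI)
      show "C1 \<subseteq> V" using g(1) y_V[OF d(1)] by (simp add: C1_def)
      show "\<not> (x i \<in> C1 \<and> y i \<in> C1)" if i: "i \<in> {1..n}" for i
        using g(2)[OF i] d(2) by (auto simp: xC1[OF i] yC1[OF i])
      fix i j assume ij: "i \<in> {1..n}" "j \<in> {1..n}" "{x i, y j} \<in> E"
      show "x i \<in> C1" if "x j \<in> C1" using that g(4)[OF ij] ij by (simp add: xC1)
      \<comment> \<open>For \<open>i = d\<close> this needs the maximality of \<open>d\<close>: an
        index \<open>j > d\<close> is not alive, and \<open>x j\<close> in \<open>C\<close> would
        put \<open>x d\<close> into \<open>C\<close>, so \<open>y j\<close> is in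
        \<open>C\<close>.\<close>
      show "y j \<in> C1" if "y i \<in> C1"
      proof (cases "i = d")
        case True
        have "i \<le> j" using ordered ij by blast
        moreover have "x j \<notin> C" using g(4)[OF ij] d(2) True by blast
        ultimately show ?thesis
          using dmax[of j] True ij(2) by (auto simp: yC1[OF ij(2)] alive_def)
      qed (use that g(3)[OF ij] ij in \<open>simp add: yC1\<close>)
    qed
    have good2: "good C2"
      unfolding good_def
    proof (intro conjI ballI impI)
      show "C2 \<subseteq> V" using g(1) x_V by (auto simp: C2_def)
      show "\<not> (x i \<in> C2 \<and> y i \<in> C2)" if i: "i \<in> {1..n}" for i
        using g(2)[OF i] g(3)[OF i d(1)] d(3) by (auto simp: xC2[OF i] yC2[OF i])
      fix i j assume ij: "i \<in> {1..n}" "j \<in> {1..n}" "{x i, y j} \<in> E"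
      show "y j \<in> C2" if "y i \<in> C2" using that g(3)[OF ij] ij by (simp add: yC2)
      \<comment> \<open>Here the condition on \<open>G\<close> enters: if \<open>x j\<close> is a
        neighbour of \<open>y d\<close>, the edges \<open>{x i, y j}\<close> and
        \<open>{x j, y d}\<close> make \<open>x i\<close> a neighbour too.\<close>
      show "x i \<in> C2" if xj: "x j \<in> C2"
      proof -
        have le: "i \<le> j" using ordered ij by blast
        consider "x j \<in> C" | "{x j, y d} \<in> E" using xj xC2[OF ij(2)] by blast
        then show ?thesis
        proof cases
          case 1
          then show ?thesis using g(4)[OF ij] xC2[OF ij(1)] by blast
        next
          case 2
          then have "j \<le> d" using ordered ij(2) d(1) by blast
          then have "{x i, y d} \<in> E"
            using le 2 ij(3) trans[OF ij(1,2) d(1) _ _ ij(3) 2] by (cases "i = j \<or> j = d") auto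
          then show ?thesis using xC2[OF ij(1)] by blast
        qed
      qed
    qed
    have dead: "card (alive C1) < card (alive C)" "card (alive C2) < card (alive C)"
    proof -
      have "alive C1 \<subseteq> alive C" "alive C2 \<subseteq> alive C" by (auto simp: alive_def C1_def C2_def)
      moreover have "d \<notin> alive C1" "d \<notin> alive C2" using yC1[OF d(1)] xC2[OF d(1)] edd by (simp_all add: alive_def)
      ultimately have "alive C1 \<subset> alive C" "alive C2 \<subset> alive C" using \<open>d \<in> alive C\<close> by blast+
      then show "card (alive C1) < card (alive C)" "card (alive C2) < card (alive C)"
        by (simp_all add: psubset_card_mono)
    qed
    let ?F = "E \<union> (\<lambda>c. {c}) ` C"
    show ?thesis
    proof (rule weakly_regular_exact[OF unital_subring_pol ideal_mon_ideal ideal_mon_ideal poly_var_in_pol[OF y_V[OF d(1)]]])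
      show "set (map (\<lambda>i. poly (p i) (poly_var (x i) + poly_var (y i))) [1..<Suc n]) \<subseteq> pol V"
        unfolding set_map set_indices
      proof clarify
        fix i assume i: "i \<in> {1..n}"
        have "poly_var (x i) + poly_var (y i) \<in> (pol V :: ('v, 'k) mpoly set)"
          using x_V[OF i] y_V[OF i] by (simp add: poly_var_in_pol pol_closed(6))
        then show "poly (p i) (poly_var (x i) + poly_var (y i)) \<in> pol V"
          using p[OF i] poly_pol_const by blast
      qed
      have "mon_ideal V ((\<lambda>e. e - {y d}) ` ?F) = (mon_ideal V (E \<union> (\<lambda>c. {c}) ` C2) :: ('v, 'k) mpoly set)"
      proof (intro equalityI mon_ideal_cong_subset)
        fix e assume "e \<in> (\<lambda>e. e - {y d}) ` ?F"
        then obtain e' where e': "e' \<in> ?F" "e = e' - {y d}" by blast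
        show "\<exists>e'\<in>E \<union> (\<lambda>c. {c}) ` C2. e' \<subseteq> e"
        proof (cases "e' \<in> E")
          case True
          obtain i j where ij: "i \<in> {1..n}" "j \<in> {1..n}" "e' = {x i, y j}" by (rule edge_cases[OF True])
          show ?thesis
          proof (cases "j = d")
            case jd: True
            then have "x i \<in> C2" using xC2[OF ij(1)] True ij(3) by simp
            moreover have "{x i} \<subseteq> e" using e'(2) ij(3) xy_neq[OF ij(1) d(1)] by blast
            ultimately show ?thesis by blast
          next
            case False
            then have "e = e'" using e'(2) ij xy_neq[OF ij(1) d(1)] y_eq_iff[OF ij(2) d(1)] by auto
            then show ?thesis using True by blast
          qed
        next
          case False
          then obtain c where "c \<in> C" "e' = {c}" using e'(1) by blast
          then have "c \<in> C2" "{c} \<subseteq> e" using e'(2) d(3) by (auto simp: C2_def)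
          then show ?thesis by blast
        qed
      next
        fix e assume "e \<in> E \<union> (\<lambda>c. {c}) ` C2"
        then consider "e \<in> ?F" | i where "i \<in> {1..n}" "{x i, y d} \<in> E" "e = {x i}"
          unfolding C2_def by blast
        then show "\<exists>e'\<in>(\<lambda>e. e - {y d}) ` ?F. e' \<subseteq> e"
        proof cases
          case 2
          then have "{x i, y d} \<in> ?F" "{x i, y d} - {y d} \<subseteq> e" by blast+
          then show ?thesis by (intro bexI[of _ "{x i, y d} - {y d}"] imageI)
        next
          case 1
          then show ?thesis by (intro bexI[of _ "e - {y d}"] imageI Diff_subset)
        qed
      qed
      then show "poly_var (y d) * c \<in> mon_ideal V ?F \<longleftrightarrow> c \<in> mon_ideal V (E \<union> (\<lambda>c. {c}) ` C2)"
        if "c \<in> pol V" for c :: "('v, 'k) mpoly"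
        using poly_var_mult_in_mon_ideal[OF that y_V[OF d(1)], of ?F] by simp
      show "weakly_regular (sub_ring (pol V)) (mon_ideal V (E \<union> (\<lambda>c. {c}) ` C2))
          (map (\<lambda>i. poly (p i) (poly_var (x i) + poly_var (y i))) [1..<Suc n])"
        by (rule less.hyps[OF dead(2) good2])
      have "E \<union> (\<lambda>c. {c}) ` C1 = insert {y d} ?F" by (simp add: C1_def)
      then show "weakly_regular (sub_ring (pol V)) (adjoin (sub_ring (pol V)) (mon_ideal V ?F) (poly_var (y d)))
          (map (\<lambda>i. poly (p i) (poly_var (x i) + poly_var (y i))) [1..<Suc n])"
        using less.hyps[OF dead(1) good1] by (simp only: mon_ideal_insert[OF y_V[OF d(1)], symmetric])
    qed
  qed
qed

text \<open>Zariski's lemma over the constants \<open>pol {}\<close>, from which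
  \<open>pol V\<close> is reached by adjoining the variables; a coefficient outside \<open>N\<close>
  shows that \<open>p\<close> is nonzero.\<close>

lemma exists_univariate_in_maximal:
  fixes N :: "('v, 'k::field) mpoly set"
  assumes N: "primeideal N (sub_ring (pol V))"
    and max: "\<And>s. s \<in> pol V - N \<Longrightarrow> \<exists>h\<in>pol V. s * h - 1 \<in> N" and t: "t \<in> pol V"
  shows "\<exists>p. (coeffs_in (pol {}) p \<and> p \<noteq> 0) \<and> poly p t \<in> N"
proof -
  interpret N: primeideal N "sub_ring (pol V)" by fact
  interpret subring_prime "pol V" N
  proof
    show "1 \<notin> N" using N.one_imp_carrier N.I_notcarr by auto
    show "a \<in> N \<or> b \<in> N" if "a \<in> pol V" "b \<in> pol V" "a * b \<in> N" for a b
      using N.I_prime[of a b] that by simp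
  qed (rule unital_subring_pol N.is_ideal)+
  obtain vs where vs: "set vs = V" using finite_list[OF finite_V] by blast
  have "\<exists>p. coeffs_in (pol {}) p \<and> (\<exists>i. Polynomial.coeff p i \<notin> N) \<and> poly p t \<in> N"
  proof (rule exists_algebraic_relation[OF max unital_subring_pol _ _ _ t])
    show "pol {} \<subseteq> (pol V :: ('v, 'k) mpoly set)" by (rule pol_mono) simp
    show "set (map poly_var vs) \<subseteq> (pol V :: ('v, 'k) mpoly set)" using vs by (auto intro: poly_var_in_pol)
    show "pol V \<subseteq> foldl ring_adjoin (pol {} :: ('v, 'k) mpoly set) (map poly_var vs)"
      by (simp only: pol_foldl[symmetric] vs Un_empty_left order_refl)
  qed
  moreover have "p \<noteq> 0" if "Polynomial.coeff p i \<notin> N" for p i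
    using that ideal_sub_ringD(2)[OF unital_subring_pol N.is_ideal] by auto
  ultimately show ?thesis by blast
qed

lemma cohen_macaulay_if_condition:
  assumes trans: "\<And>i j k. \<lbrakk>i \<in> {1..n}; j \<in> {1..n}; k \<in> {1..n}; i < j; j < k;
      {x i, y j} \<in> E; {x j, y k} \<in> E\<rbrakk> \<Longrightarrow> {x i, y k} \<in> E"
  shows "cohen_macaulay_graph TYPE('k::field) V E"
  unfolding cohen_macaulay_graph_def cohen_macaulay_ring_def
proof (intro conjI allI impI)
  show "cring (polynomial_ring V Quot (edge_ideal V E :: ('v, 'k) mpoly set))" by (rule cring_quotient)
  show "noetherian_ring (polynomial_ring V Quot (edge_ideal V E :: ('v, 'k) mpoly set))"
    by (rule noetherian_quotient)
  define R where "R = sub_ring (pol V :: ('v, 'k) mpoly set)"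
  define I where "I = (mon_ideal V E :: ('v, 'k) mpoly set)"
  have RI: "polynomial_ring V Quot (edge_ideal V E :: ('v, 'k) mpoly set) = R Quot I"
    unfolding polynomial_ring_eq edge_ideal_eq[OF graph] R_def I_def ..
  interpret R: cring R unfolding R_def by (rule cring_sub_ring[OF unital_subring_pol])
  have I: "ideal I R" unfolding I_def R_def by (rule ideal_mon_ideal)
  fix M assume "maximalideal M (polynomial_ring V Quot (edge_ideal V E :: ('v, 'k) mpoly set))"
  then have M: "maximalideal M (R Quot I)" unfolding RI .
  have Mp: "primeideal M (R Quot I)"
    by (rule cring.maximalideal_prime[OF ideal.quotient_is_cring[OF I R.is_cring] M])
  interpret q: ring_hom_cring R "R Quot I" "(+>\<^bsub>R\<^esub>) I" by (rule ideal.rcos_ring_hom_cring[OF I R.is_cring])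
  define N where "N = {s \<in> carrier R. I +>\<^bsub>R\<^esub> s \<in> M}"
  have Np: "primeideal N R" unfolding N_def
    by (rule ring_hom_ring.primeideal_vimage[OF q.ring.is_ring_hom_ring R.is_cring Mp])
  note clN = ideal_sub_ringD[OF unital_subring_pol primeideal.axioms(1)[OF Np, unfolded R_def]]
  have max: "\<exists>h\<in>pol V. s * h - 1 \<in> N" if s: "s \<in> pol V - N" for s
  proof -
    have "s \<in> carrier R" "I +>\<^bsub>R\<^esub> s \<notin> M" using s by (simp_all add: N_def R_def)
    from q.vimage_maximal_inverse[OF ideal.rcos_image_carrier[OF I] M this]
    obtain h where h: "h \<in> carrier R" "I +>\<^bsub>R\<^esub> (\<one>\<^bsub>R\<^esub> \<ominus>\<^bsub>R\<^esub> h \<otimes>\<^bsub>R\<^esub> s) \<in> M" by (elim bexE)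
    have hs: "h * s \<in> pol V" using h(1) s by (simp add: R_def pol_closed(3))
    have "\<one>\<^bsub>R\<^esub> \<ominus>\<^bsub>R\<^esub> h \<otimes>\<^bsub>R\<^esub> s = 1 - h * s"
      using a_inv_sub_ring[OF unital_subring_pol hs] by (simp add: a_minus_def R_def)
    then have "1 - h * s \<in> N" using h(2) pol_closed(2)[OF pol_closed(1) hs] by (simp add: N_def R_def)
    then have "- (1 - h * s) \<in> N" by (rule clN(5))
    then show ?thesis using h(1) by (intro bexI[of _ h]) (simp_all add: R_def mult.commute)
  qed
  define t where "t i = (poly_var (x i) + poly_var (y i) :: ('v, 'k) mpoly)" for i
  have "\<exists>p. (coeffs_in (pol {}) p \<and> p \<noteq> 0) \<and> poly p (t i) \<in> N" if "i \<in> {1..n}" for i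
    using x_V[OF that] y_V[OF that]
    by (intro exists_univariate_in_maximal max Np[unfolded R_def]) (auto simp: t_def poly_var_in_pol pol_closed(6))
  then obtain p where p: "\<And>i. i \<in> {1..n} \<Longrightarrow> coeffs_in (pol {}) (p i) \<and> p i \<noteq> 0"
    and pN: "\<And>i. i \<in> {1..n} \<Longrightarrow> poly (p i) (t i) \<in> N" by metis
  define fs where "fs = map (\<lambda>i. poly (p i) (t i)) [1..<Suc n]"
  have len: "length fs = n" by (simp add: fs_def del: upt_Suc)
  have good: "good {}" by (simp add: good_def)
  have "weakly_regular (sub_ring (pol V)) (mon_ideal V (E \<union> (\<lambda>c. {c}) ` {}))
      (map (\<lambda>i. poly (p i) (poly_var (x i) + poly_var (y i))) [1..<Suc n])"
  proof (rule weakly_regular_good)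
    show "{x i, y k} \<in> E" if "i \<in> {1..n}" "j \<in> {1..n}" "k \<in> {1..n}" "i < j" "j < k"
      "{x i, y j} \<in> E" "{x j, y k} \<in> E" for i j k
      using that by (rule trans)
    show "coeffs_in (pol {}) (p i) \<and> p i \<noteq> 0" if "i \<in> {1..n}" for i using that by (rule p)
  qed (rule good)
  then have reg: "weakly_regular R I fs" by (simp only: image_empty Un_empty_right R_def I_def fs_def t_def)
  note loc = localization_Quot[OF R.is_cring I Mp, folded N_def]
  have "cohen_macaulay_local_ring (localization (R Quot I) (carrier (R Quot I) - M))"
  proof (rule localization_at_prime.cohen_macaulay_T[OF loc])
    show "noetherian_ring R" unfolding R_def by (rule noetherian_pol[OF finite_V])
    show "set fs \<subseteq> N" unfolding fs_def set_map set_indices using pN by blast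
    show "weakly_regular R I fs" by (rule reg)
    fix k Q assume Q: "prime_chain R k Q" and IQ: "I \<subseteq> Q 0"
    interpret Q0: primeideal "Q 0" R using Q by (simp add: prime_chain_def)
    have "\<exists>v\<in>{x i, y i}. poly_var v \<in> Q 0" if i: "i \<in> {1..n}" for i
    proof -
      have V: "poly_var (x i) \<in> (pol V :: ('v, 'k) mpoly set)" "poly_var (y i) \<in> (pol V :: ('v, 'k) mpoly set)"
        using x_V[OF i] y_V[OF i] by (simp_all add: poly_var_in_pol)
      have e: "{x i, y i} \<in> E" using perfect_matching i by blast
      have "poly_var (x i) * poly_var (y i) \<in> I"
        unfolding I_def mon_ideal_def
      proof (intro CollectI conjI ballI)
        show "poly_var (x i) * poly_var (y i) \<in> (pol V :: ('v, 'k) mpoly set)" by (rule pol_closed(3)[OF V])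
        fix m assume "m \<in> keys (poly_var (x i) * poly_var (y i) :: ('v, 'k) mpoly)"
        then have "m = single (x i) 1 + single (y i) 1" by (simp add: poly_var_def mult_single)
        then show "\<exists>e\<in>E. e \<subseteq> keys m" using e by (intro bexI[of _ "{x i, y i}"]) (simp_all add: keys_add_nat)
      qed
      then have "poly_var (x i) \<otimes>\<^bsub>R\<^esub> poly_var (y i) \<in> Q 0" using IQ by (auto simp: R_def)
      then show ?thesis using Q0.I_prime V by (auto simp: R_def)
    qed
    then obtain c where c: "\<And>i. i \<in> {1..n} \<Longrightarrow> c i \<in> {x i, y i} \<and> poly_var (c i) \<in> Q 0" by metis
    have "inj_on c {1..n}"
    proof (rule inj_onI)
      fix i j assume ij: "i \<in> {1..n}" "j \<in> {1..n}" "c i = c j"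
      then show "i = j"
        using c[OF ij(1)] c[OF ij(2)] xy_neq[OF ij(1,2)] xy_neq[OF ij(2,1)] x_eq_iff[OF ij(1,2)] y_eq_iff[OF ij(1,2)]
        by (metis insertE singletonD)
    qed
    then have "card (c ` {1..n}) = n" by (simp add: card_image)
    moreover have "c ` {1..n} \<subseteq> V"
    proof (rule image_subsetI)
      fix i assume i: "i \<in> {1..n}"
      show "c i \<in> V" using c[OF i] x_V[OF i] y_V[OF i] by auto
    qed
    ultimately have "card (V - c ` {1..n}) = n"
      using card_V by (simp add: card_Diff_subset)
    moreover have "poly_var ` c ` {1..n} \<subseteq> Q 0"
      unfolding image_image by (rule image_subsetI) (use c in blast)
    ultimately show "k \<le> length fs"
      using prime_chain_length_le[OF finite_V Q[unfolded R_def], of "c ` {1..n}"] by (simp add: len)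
  qed
  then show "cohen_macaulay_local_ring (localization (polynomial_ring V Quot edge_ideal V E)
      (carrier (polynomial_ring V Quot (edge_ideal V E :: ('v, 'k) mpoly set)) - M))"
    unfolding RI .
qed

end

theorem theorem3p4:
  fixes K :: "'k::field itself"
    and V :: "'v set" and E :: "'v set set"
    and n :: nat and x y :: "nat \<Rightarrow> 'v"
  assumes graph: "finite_simple_graph V E"
    and vertices: "V = x ` {1..n} \<union> y ` {1..n}"
    and distinct: "inj_on x {1..n}" "inj_on y {1..n}" "x ` {1..n} \<inter> y ` {1..n} = {}"
    and bipartite: "\<forall>e\<in>E. \<exists>w\<in>x ` {1..n}. \<exists>w'\<in>y ` {1..n}. e = {w, w'}"
    and perfect_matching: "\<forall>i\<in>{1..n}. {x i, y i} \<in> E"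
    and ordered: "\<forall>i\<in>{1..n}. \<forall>j\<in>{1..n}. {x i, y j} \<in> E \<longrightarrow> i \<le> j"
  shows "cohen_macaulay_graph K V E \<longleftrightarrow>
    (\<forall>i\<in>{1..n}. \<forall>j\<in>{1..n}. \<forall>k\<in>{1..n}.
       i < j \<and> j < k \<and> {x i, y j} \<in> E \<and> {x j, y k} \<in> E \<longrightarrow> {x i, y k} \<in> E)"
proof -
  interpret ordered_bipartite_graph V E n x y
    using assms by unfold_locales
  have "cohen_macaulay_graph K V E \<longleftrightarrow> cohen_macaulay_graph TYPE('k) V E"
    by (simp add: cohen_macaulay_graph_def)
  then show ?thesis
    using condition_if_cohen_macaulay[where 'k = 'k] cohen_macaulay_if_condition[where 'k = 'k] by blast
qed

end
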